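(* Let $n\ge1$, $G=SL_{n+1}$ over $\mathbb{C}$, and let $\lambda=\sum_{i=1}^n a_i\alpha_i^{\vee}$ be a dominant coweight. Let $A=\mathbb{C}[\overline{W}_0^\lambda]$ with $\mathfrak{m}_A$ the maximal ideal of the point $t^0$. Then the vector space $(T_0^*\overline{W}_0^{\lambda})^{\neq0}=(\mathfrak{m}_A/\mathfrak{m}_A^2)^{\neq0}$ has a basis given by the images (all of which are nonzero) of the matrix coefficients $\Delta_{i,j}^{(l)}$ with $1\le i\neq j\le n+1$ and $1\le l\le\min_k\{a_k\}$. Moreover, this minimum is attained by $a_1$ or $a_n$. The ideal $I^T(\overline{W}_0^\lambda)\subset A$ is minimally generated by these matrix coefficients: $$I^T(\overline{W}_0^{\lambda})=\Bigl(\{\Delta_{i,j}^{(l)}\}_{i\neq j,\;1\le l\le\min_k\{a_k\}}\Bigr).$$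
   Context: $T\subset SL_{n+1}$ is the diagonal torus, $\alpha_1^\vee,\dots,\alpha_n^\vee$ are the simple coroots in the standard order. $L^{--}G$ is the affine scheme with $R$-points $\ker\big(G(R[[t^{-1}]])\to G(R)\big)$ (evaluation at $t^{-1}=0$). $\overline{\mathrm{Gr}}^\lambda$ is the closure of the $G[[t]]$-orbit of $t^\lambda$ in the affine Grassmannian $\mathrm{Gr}_G=G((t))/G[[t]]$. The slice $\overline{W}_0^\lambda:=\overline{\mathrm{Gr}}^\lambda\cap L^{--}G\,t^0$ (intersection in the thick affine Grassmannian, where $L^{--}G$ embeds as the orbit of the base point $t^0$) is an affine open neighbourhood of $t^0$ in $\overline{\mathrm{Gr}}^\lambda$ and a closed subscheme of $L^{--}G$. It carries an action of $T$ (by conjugation on $L^{--}G$) and of $\mathbb{G}_m$ (loop rotation, scaling $t$), for which $A$ is non-negatively graded with degree-zero part $\mathbb{C}$ and unique fixed point $t^0$ (denoted $0$). $\Delta_{i,j}^{(s)}$ is the function on $L^{--}G$ (and its restriction to $\overline{W}_0^\lambda$) sending a matrix $M$ to the coefficient of $t^{-s}$ in its $(i,j)$ entry. $I^T(\overline{W}_0^\lambda)$ is the ideal of $A$ generated by all elements of nontrivial $T$-weight, and $V^{\neq0}$ is the direct sum of nontrivial $T$-weight spaces of a $T$-representation $V$. *)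

theory Defs
  imports
    "Jordan_Normal_Form.VS_Connect"
    "HOL-Algebra.Left_Coset"
    "HOL-Algebra.QuotRing"
    "HOL-Algebra.Ideal_Product"
    "HOL-Computational_Algebra.Formal_Laurent_Series"
    "HOL-Computational_Algebra.Polynomial_FPS"
begin

hide_const (open) Multiset.mult Polynomial.smult Modules.module

text \<open>
  Everything is expressed through complex points.  This loses nothing: the orbit closure carries its
  reduced structure and the slice is an affine scheme of finite type over the complex numbers, so
  its coordinate ring is a ring of functions on its set of complex points.

  Matrices have 0-based indices; coweights, weights and the matrix coefficients below are indexed
  from 1, as usual for the root system of type A.
\<close>

definition SL :: "nat \<Rightarrow> 'a::comm_ring_1 mat monoid" where
  "SL m = \<lparr>carrier = {M \<in> carrier_mat m m. det M = 1}, mult = (*), one = 1\<^sub>m m\<rparr>"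

definition torus :: "nat \<Rightarrow> complex mat set" where
  "torus m = {\<tau> \<in> carrier (SL m). diagonal_mat \<tau>}"

definition torus_char :: "nat \<Rightarrow> (nat \<Rightarrow> int) \<Rightarrow> complex mat \<Rightarrow> complex" where
  "torus_char m \<mu> \<tau> = (\<Prod>k=1..m. (\<tau> $$ (k - 1, k - 1)) powi (\<mu> k))"

text \<open>Distinct exponent vectors can define the same character, since the determinant is 1; hence
  nontriviality is a condition on the function, not on the exponents.\<close>

definition nontrivial_weight :: "nat \<Rightarrow> (nat \<Rightarrow> int) \<Rightarrow> bool" where
  "nontrivial_weight m \<mu> \<longleftrightarrow> (\<exists>\<tau>\<in>torus m. torus_char m \<mu> \<tau> \<noteq> 1)"

text \<open>A coweight of \<open>SL\<^sub>m\<close> is a cocharacter of the diagonal torus, given by its integer exponents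
  at the positions \<open>1, \<dots>, m\<close>.\<close>

definition simple_coroot :: "nat \<Rightarrow> nat \<Rightarrow> int" where
  "simple_coroot i k = (if k = i then 1 else if k = i + 1 then - 1 else 0)"

definition dominant :: "nat \<Rightarrow> (nat \<Rightarrow> int) \<Rightarrow> bool" where
  "dominant m lam \<longleftrightarrow> (\<forall>i\<in>{1..<m}. lam i - lam (i + 1) \<ge> 0)"

inductive_set polynomials_in :: "('x \<Rightarrow> complex) set \<Rightarrow> ('x \<Rightarrow> complex) set"
  for F :: "('x \<Rightarrow> complex) set" where
  const: "(\<lambda>_. c) \<in> polynomials_in F"
| gen: "f \<in> F \<Longrightarrow> f \<in> polynomials_in F"
| add: "f \<in> polynomials_in F \<Longrightarrow> g \<in> polynomials_in F \<Longrightarrow> (\<lambda>x. f x + g x) \<in> polynomials_in F"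
| mult: "f \<in> polynomials_in F \<Longrightarrow> g \<in> polynomials_in F \<Longrightarrow> (\<lambda>x. f x * g x) \<in> polynomials_in F"

definition function_algebra ::
  "'x set \<Rightarrow> ('x \<Rightarrow> complex) set \<Rightarrow> (complex, 'x \<Rightarrow> complex) module" where
  "function_algebra W F =
     \<lparr>carrier = (\<lambda>f. restrict f W) ` polynomials_in F,
      mult = (\<lambda>f g. \<lambda>x\<in>W. f x * g x),
      one = (\<lambda>x\<in>W. 1),
      zero = (\<lambda>x\<in>W. 0),
      add = (\<lambda>f g. \<lambda>x\<in>W. f x + g x),
      smult = (\<lambda>c f. \<lambda>x\<in>W. c * f x)\<rparr>"

text \<open>\<open>G((t))\<close> is \<open>SL m\<close> over formal Laurent series.\<close>

definition arc_group :: "nat \<Rightarrow> complex fls mat set" where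
  "arc_group m = map_mat fps_to_fls ` carrier (SL m)"

definition Gr :: "nat \<Rightarrow> complex fls mat set set" where
  "Gr m = lcosets\<^bsub>SL m\<^esub> (arc_group m)"

definition t_pow :: "nat \<Rightarrow> (nat \<Rightarrow> int) \<Rightarrow> complex fls mat" where
  "t_pow m lam = mat m m (\<lambda>(i, j). if i = j then fls_X powi lam (i + 1) else 0)"

definition Gr_orbit :: "nat \<Rightarrow> (nat \<Rightarrow> int) \<Rightarrow> complex fls mat set set" where
  "Gr_orbit m lam = {(h * t_pow m lam) <#\<^bsub>SL m\<^esub> arc_group m | h. h \<in> arc_group m}"

definition loop_coordinates :: "nat \<Rightarrow> (complex fls mat \<Rightarrow> complex) set" where
  "loop_coordinates m = {(\<lambda>g. fls_nth (g $$ (i, j)) k) | i j k. i < m \<and> j < m}"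

definition pole_bounded :: "nat \<Rightarrow> nat \<Rightarrow> complex fls mat set" where
  "pole_bounded m N =
     {g \<in> carrier (SL m). \<forall>i<m. \<forall>j<m. \<forall>k < - int N. fls_nth (g $$ (i, j)) k = 0}"

text \<open>The ind-scheme \<open>G((t))\<close> is the increasing union of the affine schemes of matrices with poles
  of order at most \<open>N\<close>; a subset is closed if it is closed in each of them.\<close>

definition loop_closed :: "nat \<Rightarrow> complex fls mat set \<Rightarrow> bool" where
  "loop_closed m Z \<longleftrightarrow> Z \<subseteq> carrier (SL m) \<and>
     (\<forall>N. \<exists>P \<subseteq> polynomials_in (loop_coordinates m).
        Z \<inter> pole_bounded m N = {g \<in> pole_bounded m N. \<forall>p\<in>P. p g = 0})"

text \<open>The Zariski topology of the affine Grassmannian is the quotient topology, because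
  \<open>G((t)) \<rightarrow> Gr\<close> is a Zariski locally trivial \<open>G[[t]]\<close>-torsor.\<close>

definition Gr_closed :: "nat \<Rightarrow> complex fls mat set set \<Rightarrow> bool" where
  "Gr_closed m Z \<longleftrightarrow> Z \<subseteq> Gr m \<and>
     loop_closed m {g \<in> carrier (SL m). g <#\<^bsub>SL m\<^esub> arc_group m \<in> Z}"

definition Gr_orbit_closure :: "nat \<Rightarrow> (nat \<Rightarrow> int) \<Rightarrow> complex fls mat set set" where
  "Gr_orbit_closure m lam = Gr_closed m hull Gr_orbit m lam"

text \<open>From here on, formal power series are in the variable \<open>t\<inverse>\<close>.\<close>

definition neg_loop_group :: "nat \<Rightarrow> complex fps mat set" where
  "neg_loop_group m = kernel (SL m) (SL m) (map_mat (\<lambda>f. fps_nth f 0))"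

definition Delta :: "nat \<Rightarrow> nat \<Rightarrow> nat \<Rightarrow> complex fps mat \<Rightarrow> complex" where
  "Delta i j s M = fps_nth (M $$ (i - 1, j - 1)) s"

text \<open>The coefficients with \<open>s = 0\<close> are omitted because they are constant on the negative loop group.\<close>

definition neg_loop_coordinates :: "nat \<Rightarrow> (complex fps mat \<Rightarrow> complex) set" where
  "neg_loop_coordinates m = {Delta i j s | i j s. i \<in> {1..m} \<and> j \<in> {1..m} \<and> s \<ge> 1}"

text \<open>Exchanges the expansions in \<open>t\<close> and in \<open>t\<inverse>\<close> of a Laurent polynomial; only meaningful on
  series with finitely many nonzero coefficients.\<close>

definition fls_flip :: "complex fls \<Rightarrow> complex fls" where
  "fls_flip f = Abs_fls (\<lambda>k. fls_nth f (- k))"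

definition laurent_poly_group :: "nat \<Rightarrow> complex fls mat set" where
  "laurent_poly_group m =
     {g \<in> carrier (SL m). \<forall>i<m. \<forall>j<m. finite {k. fls_nth (g $$ (i, j)) k \<noteq> 0}}"

text \<open>\<open>G[t]\<close> as a subgroup of \<open>G((t\<inverse>))\<close>.\<close>

definition poly_group :: "nat \<Rightarrow> complex fls mat set" where
  "poly_group m = map_mat (\<lambda>p. fls_flip (fps_to_fls (fps_of_poly p))) ` carrier (SL m)"

text \<open>The thick affine Grassmannian is \<open>G((t\<inverse>))/G[t]\<close>.  Every point of \<open>Gr\<close> has a representative
  \<open>h\<close> in \<open>G[t, t\<inverse>]\<close>, unique up to \<open>G[t]\<close>, and is sent to the coset of \<open>h\<close> expanded in \<open>t\<inverse>\<close>;
  an element of the negative loop group is sent to its translate of the base point.\<close>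

definition slice :: "nat \<Rightarrow> (nat \<Rightarrow> int) \<Rightarrow> complex fps mat set" where
  "slice m lam = {M \<in> neg_loop_group m. \<exists>h \<in> laurent_poly_group m.
     h <#\<^bsub>SL m\<^esub> arc_group m \<in> Gr_orbit_closure m lam \<and>
     map_mat fps_to_fls M <#\<^bsub>SL m\<^esub> poly_group m = map_mat fls_flip h <#\<^bsub>SL m\<^esub> poly_group m}"

definition slice_ring ::
  "nat \<Rightarrow> (nat \<Rightarrow> int) \<Rightarrow> (complex, complex fps mat \<Rightarrow> complex) module" where
  "slice_ring m lam = function_algebra (slice m lam) (neg_loop_coordinates m)"

definition slice_Delta ::
  "nat \<Rightarrow> (nat \<Rightarrow> int) \<Rightarrow> nat \<times> nat \<times> nat \<Rightarrow> complex fps mat \<Rightarrow> complex" where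
  "slice_Delta m lam = (\<lambda>(i, j, s). restrict (Delta i j s) (slice m lam))"

definition slice_max_ideal :: "nat \<Rightarrow> (nat \<Rightarrow> int) \<Rightarrow> (complex fps mat \<Rightarrow> complex) set" where
  "slice_max_ideal m lam = {f \<in> carrier (slice_ring m lam). f (1\<^sub>m m) = 0}"

text \<open>\<open>I/I\<^sup>2\<close> as a complex vector space, for an ideal \<open>I\<close> of a complex algebra \<open>A\<close>.  The fields
  \<open>mult\<close> and \<open>one\<close>, which a module does not use, are those of the quotient ring \<open>A/I\<^sup>2\<close>.\<close>

definition conormal_module ::
  "(complex, 'a) module \<Rightarrow> 'a set \<Rightarrow> (complex, 'a set) module" where
  "conormal_module A I = (let J = ideal_prod A I I in
     \<lparr>carrier = (\<lambda>f. J +>\<^bsub>A\<^esub> f) ` I,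
      mult = rcoset_mult A J,
      one = J +>\<^bsub>A\<^esub> \<one>\<^bsub>A\<^esub>,
      zero = J,
      add = set_add A,
      smult = (\<lambda>c X. \<Union>f\<in>X. J +>\<^bsub>A\<^esub> (c \<odot>\<^bsub>A\<^esub> f))\<rparr>)"

definition slice_cotangent ::
  "nat \<Rightarrow> (nat \<Rightarrow> int) \<Rightarrow> (complex, (complex fps mat \<Rightarrow> complex) set) module" where
  "slice_cotangent m lam = conormal_module (slice_ring m lam) (slice_max_ideal m lam)"

definition cotangent_class ::
  "nat \<Rightarrow> (nat \<Rightarrow> int) \<Rightarrow> (complex fps mat \<Rightarrow> complex) \<Rightarrow> (complex fps mat \<Rightarrow> complex) set" where
  "cotangent_class m lam f =
     ideal_prod (slice_ring m lam) (slice_max_ideal m lam) (slice_max_ideal m lam)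
       +>\<^bsub>slice_ring m lam\<^esub> f"

definition weight_space ::
  "nat \<Rightarrow> (complex, 'v) module \<Rightarrow> (complex mat \<Rightarrow> 'v \<Rightarrow> 'v) \<Rightarrow> (nat \<Rightarrow> int) \<Rightarrow> 'v set" where
  "weight_space m V \<rho> \<mu> =
     {v \<in> carrier V. \<forall>\<tau>\<in>torus m. \<rho> \<tau> v = torus_char m \<mu> \<tau> \<odot>\<^bsub>V\<^esub> v}"

definition nontrivial_weight_vectors ::
  "nat \<Rightarrow> (complex, 'v) module \<Rightarrow> (complex mat \<Rightarrow> 'v \<Rightarrow> 'v) \<Rightarrow> 'v set" where
  "nontrivial_weight_vectors m V \<rho> = (\<Union>\<mu>\<in>Collect (nontrivial_weight m). weight_space m V \<rho> \<mu>)"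

text \<open>Weight spaces for distinct characters are linearly independent, so the span of their union
  is their direct sum.\<close>

definition nontrivial_weight_part ::
  "nat \<Rightarrow> (complex, 'v) module \<Rightarrow> (complex mat \<Rightarrow> 'v \<Rightarrow> 'v) \<Rightarrow> (complex, 'v) module" where
  "nontrivial_weight_part m V \<rho> =
     V\<lparr>carrier := LinearCombinations.module.span class_ring V (nontrivial_weight_vectors m V \<rho>)\<rparr>"

definition torus_conj :: "nat \<Rightarrow> complex mat \<Rightarrow> complex fps mat \<Rightarrow> complex fps mat" where
  "torus_conj m \<tau> M = map_mat fps_const \<tau> * M * map_mat fps_const (inv\<^bsub>SL m\<^esub> \<tau>)"

definition slice_ring_action ::
  "nat \<Rightarrow> (nat \<Rightarrow> int) \<Rightarrow> complex mat \<Rightarrow> (complex fps mat \<Rightarrow> complex) \<Rightarrow> complex fps mat \<Rightarrow> complex" where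
  "slice_ring_action m lam \<tau> f = (\<lambda>M\<in>slice m lam. f (torus_conj m (inv\<^bsub>SL m\<^esub> \<tau>) M))"

text \<open>The action induced on cosets is the elementwise one.\<close>

definition slice_cotangent_nontrivial ::
  "nat \<Rightarrow> (nat \<Rightarrow> int) \<Rightarrow> (complex, (complex fps mat \<Rightarrow> complex) set) module" where
  "slice_cotangent_nontrivial m lam =
     nontrivial_weight_part m (slice_cotangent m lam) (\<lambda>\<tau> X. slice_ring_action m lam \<tau> ` X)"

definition slice_torus_ideal :: "nat \<Rightarrow> (nat \<Rightarrow> int) \<Rightarrow> (complex fps mat \<Rightarrow> complex) set" where
  "slice_torus_ideal m lam =
     Idl\<^bsub>slice_ring m lam\<^esub>
       (nontrivial_weight_vectors m (slice_ring m lam) (slice_ring_action m lam))"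

definition offdiag_index :: "nat \<Rightarrow> int \<Rightarrow> (nat \<times> nat \<times> nat) set" where
  "offdiag_index m b =
     {(i, j, l). i \<in> {1..m} \<and> j \<in> {1..m} \<and> i \<noteq> j \<and> 1 \<le> l \<and> int l \<le> b}"

end

(* The slice consists of the matrices M in 1 + t^-1 Mat(C[t^-1]) of determinant 1 whose class in the
   affine Grassmannian lies in the orbit closure.

   Tangent vectors. If nu is in the closure and 0 <= c <= nu_i - nu_j, a rank one degeneration puts
   nu - c (e_i - e_j) in the closure. Starting from lam one reaches l (e_i - e_j) for all i, j and all
   l <= min a_k, so the lines 1 + s E_ij t^-l lie in the slice. Differentiation along them separates
   the coefficients Delta_ij^(l), i /= j, l <= min a_k, modulo the square of the maximal ideal.

   Generation. On the slice M has degree at most a_n and M^-1 has degree at most a_1 in t^-1, and the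
   minimum of the a_k is a_1 or a_n by concavity. If it is a_n, the other off-diagonal coefficients
   vanish. If it is a_1, the off-diagonal coefficients of M of degree at most a_1 generate those of
   M^-1 of degree at most a_1, which are all of them, and these generate those of M in all degrees.
   Modulo the ideal J so generated the torus acts trivially on the coordinate ring, because it fixes
   the diagonal coefficients; hence J contains every element of nontrivial weight. *)

theory Submission
  imports Defs
begin

section \<open>Special linear groups and algebras of functions\<close>

text \<open>The orbit closure is given only as the smallest closed set containing the orbit, so no
  equations for it are at hand. It is approached from both sides. From outside, two closed
  conditions are used that \<open>G[[t]]\<close> respects on both sides, pole bounds for g and for
  its inverse; the least entry of the coweight is -a_n and the greatest is a_1, which is where these
  two degrees come from. From inside, a line all of whose points but one lie in a closed set lies in
  it entirely.

  The outer conditions say little about the diagonal coefficients, but these have weight zero and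
  never have to be controlled. If a torus element tau multiplies f by c /= 1, then (c - 1) f = tau f
  - f, and this difference lies in J once the torus acts trivially modulo J. Read for functions, the
  argument determines the ideal; read modulo the square of the maximal ideal, it gives the spanning
  half of the basis. Weight decompositions do not enter.\<close>

lemma SL_simps [simp]:
  "carrier (SL m) = {M \<in> carrier_mat m m. det M = 1}"
  "mult (SL m) = (*)" "one (SL m) = 1\<^sub>m m"
  by (simp_all add: SL_def)

lemma SL_mult_closed: "x \<in> carrier (SL m) \<Longrightarrow> y \<in> carrier (SL m) \<Longrightarrow> x * y \<in> carrier (SL m)"
  by (auto simp: det_mult[of _ m] intro: mult_carrier_mat)

text \<open>With determinant 1 the adjugate is the two-sided inverse. Inverses are mostly written
  this way because the entries of the adjugate are polynomials in those of the matrix, which is the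
  form that closedness conditions and ring homomorphisms can handle.\<close>

lemma SL_adj_mat:
  assumes "g \<in> carrier (SL m)"
  shows "adj_mat g \<in> carrier (SL m)" "g * adj_mat g = 1\<^sub>m m" "adj_mat g * g = 1\<^sub>m m"
proof -
  have g: "g \<in> carrier_mat m m" "det g = 1" using assms by auto
  show 1: "g * adj_mat g = 1\<^sub>m m" and "adj_mat g * g = 1\<^sub>m m"
    using adj_mat[OF g(1)] g(2) by (auto intro!: eq_matI)
  have "det g * det (adj_mat g) = 1"
    using det_mult[OF g(1) adj_mat(1)[OF g(1)]] 1 by simp
  then show "adj_mat g \<in> carrier (SL m)"
    using adj_mat(1)[OF g(1)] g by simp
qed

lemma SL_group: "group (SL m)"
proof (rule groupI)
  fix x y :: "'a mat" assume "x \<in> carrier (SL m)" "y \<in> carrier (SL m)"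
  then show "x \<otimes>\<^bsub>SL m\<^esub> y \<in> carrier (SL m)" using SL_mult_closed by auto
next
  fix x :: "'a mat" assume "x \<in> carrier (SL m)"
  then show "\<exists>y\<in>carrier (SL m). y \<otimes>\<^bsub>SL m\<^esub> x = \<one>\<^bsub>SL m\<^esub>"
    using SL_adj_mat by (metis SL_simps(2,3))
qed (auto simp: assoc_mult_mat)

lemma SL_inv_eq_adj_mat: "g \<in> carrier (SL m) \<Longrightarrow> inv\<^bsub>SL m\<^esub> g = adj_mat g"
  by (metis SL_adj_mat(1,3) SL_group SL_simps(2,3) group.inv_equality)

lemma SL_inverse_unique:
  assumes "g \<in> carrier (SL m)" "h \<in> carrier_mat m m" "h * g = 1\<^sub>m m"
  shows "h = adj_mat g"
proof -
  have c: "g \<in> carrier_mat m m" "adj_mat g \<in> carrier_mat m m" using assms(1) SL_adj_mat(1)[OF assms(1)] by auto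
  have "h = h * (g * adj_mat g)" using SL_adj_mat(2)[OF assms(1)] assms(2) by simp
  also have "\<dots> = adj_mat g" using assms(2,3) c by (simp flip: assoc_mult_mat)
  finally show ?thesis .
qed

lemma SL_adj_mat_mult:
  assumes "g \<in> carrier (SL m)" "h \<in> carrier (SL m)"
  shows "adj_mat (g * h) = adj_mat h * adj_mat g"
  using group.inv_mult_group[OF SL_group assms] SL_mult_closed[OF assms] assms
  by (simp add: SL_inv_eq_adj_mat del: SL_simps(1))

lemma (in comm_ring_hom) hom_SL: "g \<in> carrier (SL m) \<Longrightarrow> map_mat hom g \<in> carrier (SL m)"
  by simp

lemma (in comm_ring_hom) hom_adj_mat:
  assumes "g \<in> carrier (SL m)"
  shows "adj_mat (map_mat hom g) = map_mat hom (adj_mat g)"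
proof -
  have "map_mat hom (adj_mat g) * map_mat hom g = map_mat hom (adj_mat g * g)"
    using assms adj_mat(1)[of g m] by (auto simp: mat_hom_mult[of "adj_mat g" m m g m])
  also have "\<dots> = 1\<^sub>m m" using SL_adj_mat(3)[OF assms] by (simp add: mat_hom_one)
  finally show ?thesis
    using SL_inverse_unique[OF hom_SL[OF assms], of "map_mat hom (adj_mat g)"] assms adj_mat(1)[of g m]
    by simp
qed

section \<open>Algebras of polynomial functions on a set\<close>

lemma polynomials_in_sum:
  "finite S \<Longrightarrow> (\<And>s. s \<in> S \<Longrightarrow> f s \<in> polynomials_in F) \<Longrightarrow> (\<lambda>x. \<Sum>s\<in>S. f s x) \<in> polynomials_in F"
  by (induction S rule: finite_induct) (auto intro: polynomials_in.intros)

lemma polynomials_in_uminus: "f \<in> polynomials_in F \<Longrightarrow> (\<lambda>x. - f x) \<in> polynomials_in F"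
  using polynomials_in.mult[OF polynomials_in.const[of "-1"]] by fastforce

lemma polynomials_in_diff:
  "f \<in> polynomials_in F \<Longrightarrow> g \<in> polynomials_in F \<Longrightarrow> (\<lambda>x. f x - g x) \<in> polynomials_in F"
  using polynomials_in.add[OF _ polynomials_in_uminus] by fastforce

lemma function_algebra_simps [simp]:
  "mult (function_algebra W F) = (\<lambda>f g. \<lambda>x\<in>W. f x * g x)"
  "one (function_algebra W F) = (\<lambda>x\<in>W. 1)"
  "zero (function_algebra W F) = (\<lambda>x\<in>W. 0)"
  "add (function_algebra W F) = (\<lambda>f g. \<lambda>x\<in>W. f x + g x)"
  "smult (function_algebra W F) = (\<lambda>c f. \<lambda>x\<in>W. c * f x)"
  by (simp_all add: function_algebra_def)

lemma function_algebra_carrier: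
  "carrier (function_algebra W F) = (\<lambda>f. restrict f W) ` polynomials_in F"
  by (simp add: function_algebra_def)

lemma function_algebra_carrierI:
  "p \<in> polynomials_in F \<Longrightarrow> f = restrict p W \<Longrightarrow> f \<in> carrier (function_algebra W F)"
  by (auto simp: function_algebra_carrier)

lemma function_algebra_const: "(\<lambda>x\<in>W. c) \<in> carrier (function_algebra W F)"
  by (rule function_algebra_carrierI[OF polynomials_in.const]) simp

lemma function_algebra_closed:
  assumes "f \<in> carrier (function_algebra W F)" "g \<in> carrier (function_algebra W F)"
  shows "(\<lambda>x\<in>W. f x + g x) \<in> carrier (function_algebra W F)"
    "(\<lambda>x\<in>W. f x * g x) \<in> carrier (function_algebra W F)"
    "(\<lambda>x\<in>W. c * f x) \<in> carrier (function_algebra W F)"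
    "(\<lambda>x\<in>W. f x - g x) \<in> carrier (function_algebra W F)"
    "(\<lambda>x\<in>W. - f x) \<in> carrier (function_algebra W F)"
proof -
  obtain p q where p: "p \<in> polynomials_in F" "f = restrict p W"
    and q: "q \<in> polynomials_in F" "g = restrict q W" using assms by (auto simp: function_algebra_carrier)
  note I = function_algebra_carrierI
  show "(\<lambda>x\<in>W. f x + g x) \<in> carrier (function_algebra W F)"
    by (rule I[OF polynomials_in.add[OF p(1) q(1)]]) (auto simp: p q)
  show "(\<lambda>x\<in>W. f x * g x) \<in> carrier (function_algebra W F)"
    by (rule I[OF polynomials_in.mult[OF p(1) q(1)]]) (auto simp: p q)
  show "(\<lambda>x\<in>W. c * f x) \<in> carrier (function_algebra W F)"
    by (rule I[OF polynomials_in.mult[OF polynomials_in.const p(1)]]) (auto simp: p)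
  show "(\<lambda>x\<in>W. f x - g x) \<in> carrier (function_algebra W F)"
    by (rule I[OF polynomials_in_diff[OF p(1) q(1)]]) (auto simp: p q)
  show "(\<lambda>x\<in>W. - f x) \<in> carrier (function_algebra W F)"
    by (rule I[OF polynomials_in_uminus[OF p(1)]]) (auto simp: p)
qed

lemma function_algebra_extensional:
  "f \<in> carrier (function_algebra W F) \<Longrightarrow> restrict f W = f"
  by (auto simp: function_algebra_carrier)

lemma function_algebra_cring: "cring (function_algebra W F)"
proof -
  let ?A = "function_algebra W F"
  note cl = function_algebra_closed and ext = function_algebra_extensional
  have "abelian_group ?A"
  proof (rule abelian_groupI)
    fix f assume f: "f \<in> carrier ?A"
    show "\<zero>\<^bsub>?A\<^esub> \<oplus>\<^bsub>?A\<^esub> f = f"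
      using f by (auto simp: fun_eq_iff function_algebra_carrier)
    show "\<exists>y\<in>carrier ?A. y \<oplus>\<^bsub>?A\<^esub> f = \<zero>\<^bsub>?A\<^esub>"
      by (rule bexI[OF _ cl(5)[OF f f]]) auto
  qed (use cl(1) function_algebra_const in \<open>auto simp: add_ac\<close>)
  moreover have "comm_monoid ?A"
  proof (rule comm_monoidI)
    fix f assume f: "f \<in> carrier ?A"
    show "\<one>\<^bsub>?A\<^esub> \<otimes>\<^bsub>?A\<^esub> f = f"
      using f by (auto simp: fun_eq_iff function_algebra_carrier)
  qed (use cl(2) function_algebra_const in \<open>auto simp: mult_ac\<close>)
  ultimately show ?thesis
    by (rule cringI) (auto simp: distrib_right)
qed

lemma function_algebra_minus:
  assumes "f \<in> carrier (function_algebra W F)" "g \<in> carrier (function_algebra W F)"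
  shows "f \<ominus>\<^bsub>function_algebra W F\<^esub> g = (\<lambda>x\<in>W. f x - g x)"
proof -
  let ?A = "function_algebra W F"
  interpret cring ?A by (rule function_algebra_cring)
  have "\<ominus>\<^bsub>?A\<^esub> g = (\<lambda>x\<in>W. - g x)"
    by (intro minus_equality assms(2) function_algebra_closed(5)[OF assms(2,2)]) auto
  then show ?thesis using function_algebra_closed(5)[OF assms(2,2)]
    unfolding a_minus_def by auto
qed

section \<open>Closed subsets of the loop group\<close>

text \<open>The convolution may be summed over any finite set that contains its support. This frees
  the range from the subdegrees of the factors, so that one range can serve all matrices with a
  given pole bound.\<close>

lemma fls_times_nth_finite:
  fixes f g :: "'a::semiring_0 fls"
  assumes "finite S" "{i. fls_nth f i * fls_nth g (n - i) \<noteq> 0} \<subseteq> S"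
  shows "fls_nth (f * g) n = (\<Sum>i\<in>S. fls_nth f i * fls_nth g (n - i))"
proof -
  let ?T = "{i. fls_nth f i * fls_nth g (n - i) \<noteq> 0}"
  let ?I = "{fls_subdegree f..n - fls_subdegree g}"
  have "?T \<subseteq> ?I"
  proof
    fix i assume "i \<in> ?T"
    then have "fls_nth f i \<noteq> 0" "fls_nth g (n - i) \<noteq> 0" by auto
    then show "i \<in> ?I" using fls_subdegree_leI[of f i] fls_subdegree_leI[of g "n - i"] by auto
  qed
  then have "(\<Sum>i\<in>?I. fls_nth f i * fls_nth g (n - i)) = (\<Sum>i\<in>?T. fls_nth f i * fls_nth g (n - i))"
    by (intro sum.mono_neutral_right) auto
  also have "\<dots> = (\<Sum>i\<in>S. fls_nth f i * fls_nth g (n - i))"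
    by (intro sum.mono_neutral_left) (use assms in auto)
  finally show ?thesis by (simp add: fls_times_nth(2))
qed

lemma fls_times_nth_eq_0:
  fixes f g :: "'a::semiring_0 fls"
  assumes "\<forall>k<a. fls_nth f k = 0" "\<forall>k<b. fls_nth g k = 0" "n < a + b"
  shows "fls_nth (f * g) n = 0"
proof -
  have "fls_nth f i * fls_nth g (n - i) = 0" for i
    using assms by (cases "i < a") auto
  then show ?thesis using fls_times_nth_finite[of "{}" f g n] by simp
qed

lemma fls_sum_nth: "fls_nth (sum f S) k = (\<Sum>s\<in>S. fls_nth (f s) k)"
  by (induction S rule: infinite_finite_induct) auto

lemma fps_to_fls_hom: "comm_ring_hom (fps_to_fls :: 'a::comm_ring_1 fps \<Rightarrow> 'a fls)"
  by unfold_locales (auto simp: fls_times_fps_to_fls)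

lemma fls_const_hom: "comm_ring_hom (fls_const :: 'a::comm_ring_1 \<Rightarrow> 'a fls)"
  by unfold_locales (auto simp: fls_plus_const)

section \<open>The arc group, its cosets and the points of the torus\<close>

lemma arc_group_subset: "arc_group m \<subseteq> carrier (SL m)"
  unfolding arc_group_def using comm_ring_hom.hom_SL[OF fps_to_fls_hom] by blast

lemma arc_groupI: "P \<in> carrier (SL m) \<Longrightarrow> g = map_mat fps_to_fls P \<Longrightarrow> g \<in> arc_group m"
  by (auto simp: arc_group_def)

lemma arc_group_mult:
  assumes "g \<in> arc_group m" "h \<in> arc_group m"
  shows "g * h \<in> arc_group m"
proof -
  interpret comm_ring_hom "fps_to_fls :: complex fps \<Rightarrow> _" by (rule fps_to_fls_hom)
  obtain P Q where P: "P \<in> carrier (SL m)" "g = map_mat fps_to_fls P"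
    and Q: "Q \<in> carrier (SL m)" "h = map_mat fps_to_fls Q" using assms by (auto simp: arc_group_def)
  show ?thesis
    by (rule arc_groupI[OF SL_mult_closed[OF P(1) Q(1)]]) (use P Q in \<open>auto simp: mat_hom_mult[of P m m Q m]\<close>)
qed

lemma arc_group_one: "1\<^sub>m m \<in> arc_group m"
proof -
  interpret comm_ring_hom "fps_to_fls :: complex fps \<Rightarrow> _" by (rule fps_to_fls_hom)
  show ?thesis by (rule arc_groupI[of "1\<^sub>m m"]) (auto simp: mat_hom_one)
qed

lemma arc_group_adj_mat: "g \<in> arc_group m \<Longrightarrow> adj_mat g \<in> arc_group m"
  unfolding arc_group_def
  using comm_ring_hom.hom_adj_mat[OF fps_to_fls_hom] SL_adj_mat(1) by blast

lemma arc_group_nth: "g \<in> arc_group m \<Longrightarrow> i < m \<Longrightarrow> j < m \<Longrightarrow> k < 0 \<Longrightarrow> fls_nth (g $$ (i, j)) k = 0"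
  by (auto simp: arc_group_def)

lemma l_coset_SL: "g <#\<^bsub>SL m\<^esub> H = (\<lambda>h. g * h) ` H"
  by (auto simp: l_coset_def)

lemma arc_coset_mult:
  assumes "g \<in> carrier (SL m)" "p \<in> arc_group m"
  shows "(g * p) <#\<^bsub>SL m\<^esub> arc_group m = g <#\<^bsub>SL m\<^esub> arc_group m"
proof -
  have c: "g \<in> carrier_mat m m" "p \<in> carrier_mat m m" "adj_mat p \<in> carrier_mat m m"
    "h \<in> arc_group m \<Longrightarrow> h \<in> carrier_mat m m" for h
    using assms arc_group_subset arc_group_adj_mat[OF assms(2)] by fastforce+
  have p: "p \<in> carrier (SL m)" using assms(2) arc_group_subset by blast
  have "g * h = g * p * (adj_mat p * h)" if "h \<in> arc_group m" for h
  proof -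
    have "g * p * (adj_mat p * h) = g * (p * (adj_mat p * h))"
      using c c(4)[OF that] by (simp add: assoc_mult_mat[of _ m m _ m _ m])
    also have "p * (adj_mat p * h) = p * adj_mat p * h"
      using c c(4)[OF that] by (simp add: assoc_mult_mat[of _ m m _ m _ m])
    finally show ?thesis using SL_adj_mat(2)[OF p] c(4)[OF that] by simp
  qed
  moreover have "g * p * h = g * (p * h)" if "h \<in> arc_group m" for h
    using c c(4)[OF that] by (simp add: assoc_mult_mat[of _ m m _ m _ m])
  ultimately show ?thesis
    unfolding l_coset_SL
    by (intro subset_antisym image_subsetI)
      (blast intro: image_eqI arc_group_mult arc_group_adj_mat assms(2))+
qed

lemma arc_coset_eqD:
  assumes "g <#\<^bsub>SL m\<^esub> arc_group m = g' <#\<^bsub>SL m\<^esub> arc_group m" "g \<in> carrier (SL m)"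
  shows "\<exists>p\<in>arc_group m. g = g' * p"
proof -
  have "g \<in> g <#\<^bsub>SL m\<^esub> arc_group m"
    unfolding l_coset_SL by (rule image_eqI[OF _ arc_group_one]) (use assms(2) in auto)
  then have "g \<in> g' <#\<^bsub>SL m\<^esub> arc_group m" by (simp only: assms(1))
  then show ?thesis unfolding l_coset_SL by auto
qed

lemma t_pow_carrier [simp]: "t_pow m \<nu> \<in> carrier_mat m m"
  by (simp add: t_pow_def)

lemma mat_mult_entry:
  assumes "A \<in> carrier_mat m m" "B \<in> carrier_mat m m" "i < m" "j < m"
  shows "(A * B) $$ (i, j) = (\<Sum>k<m. A $$ (i, k) * B $$ (k, j))"
  using assms by (auto simp: scalar_prod_def lessThan_atLeast0)

lemma t_pow_index:
  "i < m \<Longrightarrow> j < m \<Longrightarrow> t_pow m \<nu> $$ (i, j) = (if i = j then fls_X powi \<nu> (i + 1) else 0)"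
  by (simp add: t_pow_def)

lemma mult_t_pow_index:
  assumes "A \<in> carrier_mat m m" "i < m" "j < m"
  shows "(A * t_pow m \<nu>) $$ (i, j) = A $$ (i, j) * fls_X powi \<nu> (j + 1)"
    and "(t_pow m \<nu> * A) $$ (i, j) = fls_X powi \<nu> (i + 1) * A $$ (i, j)"
proof -
  have "(A * t_pow m \<nu>) $$ (i, j) = (\<Sum>k<m. if k = j then A $$ (i, j) * fls_X powi \<nu> (j + 1) else 0)"
    unfolding mat_mult_entry[OF assms(1) t_pow_carrier assms(2,3)]
    by (rule sum.cong) (use assms in \<open>auto simp: t_pow_index\<close>)
  then show "(A * t_pow m \<nu>) $$ (i, j) = A $$ (i, j) * fls_X powi \<nu> (j + 1)" using assms by simp
  have "(t_pow m \<nu> * A) $$ (i, j) = (\<Sum>k<m. if k = i then fls_X powi \<nu> (i + 1) * A $$ (i, j) else 0)"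
    unfolding mat_mult_entry[OF t_pow_carrier assms]
    by (rule sum.cong) (use assms in \<open>auto simp: t_pow_index\<close>)
  then show "(t_pow m \<nu> * A) $$ (i, j) = fls_X powi \<nu> (i + 1) * A $$ (i, j)" using assms by simp
qed

lemma t_pow_SL:
  assumes "(\<Sum>k=1..m. \<nu> k) = 0"
  shows "t_pow m \<nu> \<in> carrier (SL m)"
proof -
  have *: "prod_list (map (\<lambda>i. fls_X powi \<nu> (i + 1)) [0..<k]) = (fls_X :: complex fls) powi (\<Sum>i=1..k. \<nu> i)" for k
    by (induction k) (auto simp: power_int_add simp del: fls_X_power_int)
  have "det (t_pow m \<nu>) = prod_list (diag_mat (t_pow m \<nu>))"
    by (rule det_upper_triangular[of _ m]) (auto simp: t_pow_def)
  also have "diag_mat (t_pow m \<nu>) = map (\<lambda>i. fls_X powi \<nu> (i + 1)) [0..<m]"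
    by (auto simp: diag_mat_def t_pow_def)
  finally show ?thesis using * assms by simp
qed

text \<open>The defining family at each pole bound can be enlarged to all polynomials that vanish on
  \<open>Z\<close> there. Closedness then means that each point outside \<open>Z\<close> is
  separated from \<open>Z\<close> by a single polynomial, which is easier to produce and to
  use.\<close>

lemma loop_closed_iff:
  "loop_closed m Z \<longleftrightarrow> Z \<subseteq> carrier (SL m) \<and>
     (\<forall>N. \<forall>g\<in>pole_bounded m N - Z. \<exists>q\<in>polynomials_in (loop_coordinates m).
        (\<forall>z\<in>Z \<inter> pole_bounded m N. q z = 0) \<and> q g \<noteq> 0)" (is "?L \<longleftrightarrow> ?R")
proof
  assume ?L
  show ?R
  proof (intro conjI allI ballI)
    show "Z \<subseteq> carrier (SL m)" using \<open>?L\<close> unfolding loop_closed_def by blast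
    fix N g assume g: "g \<in> pole_bounded m N - Z"
    obtain P where P: "P \<subseteq> polynomials_in (loop_coordinates m)"
      "Z \<inter> pole_bounded m N = {g \<in> pole_bounded m N. \<forall>p\<in>P. p g = 0}"
      using \<open>?L\<close> unfolding loop_closed_def by blast
    have "g \<notin> {g \<in> pole_bounded m N. \<forall>p\<in>P. p g = 0}" using g P(2) by blast
    then obtain p where p: "p \<in> P" "p g \<noteq> 0" using g by blast
    show "\<exists>q\<in>polynomials_in (loop_coordinates m). (\<forall>z\<in>Z \<inter> pole_bounded m N. q z = 0) \<and> q g \<noteq> 0"
      by (rule bexI[of _ p]) (use P p in auto)
  qed
next
  assume R: ?R
  let ?P = "\<lambda>N. {q \<in> polynomials_in (loop_coordinates m). \<forall>z\<in>Z \<inter> pole_bounded m N. q z = 0}"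
  have "Z \<inter> pole_bounded m N = {g \<in> pole_bounded m N. \<forall>p\<in>?P N. p g = 0}" for N
  proof (intro subset_antisym subsetI)
    fix g assume g: "g \<in> {g \<in> pole_bounded m N. \<forall>p\<in>?P N. p g = 0}"
    then have "g \<in> Z" using R by blast
    then show "g \<in> Z \<inter> pole_bounded m N" using g by blast
  qed auto
  then show ?L unfolding loop_closed_def using R
    by (intro conjI allI exI[of _ "?P _"]) auto
qed

text \<open>Invariance under right multiplication by arcs makes \<open>S\<close> the full preimage
  of its image in the Grassmannian, so this image is closed and contains the orbit closure by
  minimality. Upper bounds on the closure are thereby reduced to conditions on matrices.\<close>

lemma Gr_closure_subset:
  assumes "loop_closed m S" "\<And>g p. g \<in> S \<Longrightarrow> p \<in> arc_group m \<Longrightarrow> g * p \<in> S"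
    and "\<And>h. h \<in> arc_group m \<Longrightarrow> h * t_pow m lam \<in> S"
    and "g \<in> carrier (SL m)" "g <#\<^bsub>SL m\<^esub> arc_group m \<in> Gr_orbit_closure m lam"
  shows "g \<in> S"
proof -
  let ?q = "\<lambda>g. g <#\<^bsub>SL m\<^esub> arc_group m"
  have S: "S \<subseteq> carrier (SL m)" using assms(1) by (simp add: loop_closed_def)
  have *: "g \<in> S" if "g \<in> carrier (SL m)" "?q g \<in> ?q ` S" for g
    using that assms(2) arc_coset_eqD[OF _ that(1)] by blast
  have "?q ` S \<subseteq> Gr m" using S by (auto simp: Gr_def LCOSETS_def)
  moreover have "{g \<in> carrier (SL m). ?q g \<in> ?q ` S} = S" using * S by blast
  ultimately have "Gr_closed m (?q ` S)" using assms(1) unfolding Gr_closed_def by auto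
  moreover have "Gr_orbit m lam \<subseteq> ?q ` S" using assms(3) by (auto simp: Gr_orbit_def)
  ultimately have "Gr_orbit_closure m lam \<subseteq> ?q ` S"
    unfolding Gr_orbit_closure_def by (intro hull_minimal)
  then show ?thesis using * assms(4,5) by blast
qed

text \<open>A Laurent series depending algebraically on a matrix with poles of order at most
  \<open>N\<close>. The lower bound on the exponents is uniform in g, because then each coefficient
  of a product is one fixed polynomial in finitely many coefficients of the factors.\<close>

definition polynomial_coefficients ::
  "nat \<Rightarrow> nat \<Rightarrow> (complex fls mat \<Rightarrow> complex fls) \<Rightarrow> bool" where
  "polynomial_coefficients m N F \<longleftrightarrow>
     (\<exists>b. \<forall>g\<in>pole_bounded m N. \<forall>k<b. fls_nth (F g) k = 0) \<and>
     (\<forall>k. \<exists>q\<in>polynomials_in (loop_coordinates m). \<forall>g\<in>pole_bounded m N. q g = fls_nth (F g) k)"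

lemma polynomial_coefficients_entry:
  assumes "i < m" "j < m"
  shows "polynomial_coefficients m N (\<lambda>g. g $$ (i, j))"
  unfolding polynomial_coefficients_def
proof (intro conjI allI exI ballI impI)
  fix k show "\<exists>q\<in>polynomials_in (loop_coordinates m). \<forall>g\<in>pole_bounded m N. q g = fls_nth (g $$ (i, j)) k"
    by (rule bexI[of _ "\<lambda>g. fls_nth (g $$ (i, j)) k"])
      (use assms in \<open>auto intro!: polynomials_in.gen simp: loop_coordinates_def\<close>)
next
  fix g and k :: int assume "g \<in> pole_bounded m N" "k < - int N"
  then show "fls_nth (g $$ (i, j)) k = 0" using assms by (auto simp: pole_bounded_def)
qed

lemma polynomial_coefficients_const: "polynomial_coefficients m N (\<lambda>g. c)"
  unfolding polynomial_coefficients_def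
proof (intro conjI allI)
  show "\<exists>b. \<forall>g\<in>pole_bounded m N. \<forall>k<b. fls_nth c k = 0"
    by (rule exI[of _ "fls_subdegree c"]) auto
  show "\<exists>q\<in>polynomials_in (loop_coordinates m). \<forall>g\<in>pole_bounded m N. q g = fls_nth c k" for k
    by (rule bexI[OF _ polynomials_in.const]) auto
qed

lemma polynomial_coefficients_add:
  assumes "polynomial_coefficients m N F" "polynomial_coefficients m N G"
  shows "polynomial_coefficients m N (\<lambda>g. F g + G g)"
proof -
  obtain b where b: "\<forall>g\<in>pole_bounded m N. \<forall>k<b. fls_nth (F g) k = 0"
    using assms(1) by (auto simp: polynomial_coefficients_def)
  obtain c where c: "\<forall>g\<in>pole_bounded m N. \<forall>k<c. fls_nth (G g) k = 0"
    using assms(2) by (auto simp: polynomial_coefficients_def)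
  have "\<exists>q\<in>polynomials_in (loop_coordinates m). \<forall>g\<in>pole_bounded m N. q g = fls_nth (F g + G g) k" for k
  proof -
    obtain p q where "p \<in> polynomials_in (loop_coordinates m)" "\<forall>g\<in>pole_bounded m N. p g = fls_nth (F g) k"
      "q \<in> polynomials_in (loop_coordinates m)" "\<forall>g\<in>pole_bounded m N. q g = fls_nth (G g) k"
      using assms unfolding polynomial_coefficients_def by blast
    then show ?thesis by (intro bexI[OF _ polynomials_in.add[of p _ q]]) auto
  qed
  moreover have "\<forall>g\<in>pole_bounded m N. \<forall>k<min b c. fls_nth (F g + G g) k = 0" using b c by auto
  ultimately show ?thesis unfolding polynomial_coefficients_def by blast
qed

lemma polynomial_coefficients_mult:
  assumes "polynomial_coefficients m N F" "polynomial_coefficients m N G"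
  shows "polynomial_coefficients m N (\<lambda>g. F g * G g)"
proof -
  obtain b where b: "\<forall>g\<in>pole_bounded m N. \<forall>k<b. fls_nth (F g) k = 0"
    using assms(1) by (auto simp: polynomial_coefficients_def)
  obtain c where c: "\<forall>g\<in>pole_bounded m N. \<forall>k<c. fls_nth (G g) k = 0"
    using assms(2) by (auto simp: polynomial_coefficients_def)
  obtain p where p: "p k \<in> polynomials_in (loop_coordinates m)" "\<forall>g\<in>pole_bounded m N. p k g = fls_nth (F g) k" for k
    using assms(1) unfolding polynomial_coefficients_def by metis
  obtain q where q: "q k \<in> polynomials_in (loop_coordinates m)" "\<forall>g\<in>pole_bounded m N. q k g = fls_nth (G g) k" for k
    using assms(2) unfolding polynomial_coefficients_def by metis
  have "\<exists>q\<in>polynomials_in (loop_coordinates m). \<forall>g\<in>pole_bounded m N. q g = fls_nth (F g * G g) k" for k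
  proof (rule bexI)
    show "(\<lambda>g. \<Sum>i\<in>{b..k - c}. p i g * q (k - i) g) \<in> polynomials_in (loop_coordinates m)"
      by (intro polynomials_in_sum polynomials_in.mult p q) auto
    show "\<forall>g\<in>pole_bounded m N. (\<Sum>i\<in>{b..k - c}. p i g * q (k - i) g) = fls_nth (F g * G g) k"
    proof
      fix g assume g: "g \<in> pole_bounded m N"
      have "{i. fls_nth (F g) i * fls_nth (G g) (k - i) \<noteq> 0} \<subseteq> {b..k - c}"
      proof
        fix i assume "i \<in> {i. fls_nth (F g) i * fls_nth (G g) (k - i) \<noteq> 0}"
        then have "\<not> i < b" "\<not> k - i < c" using b c g by auto
        then show "i \<in> {b..k - c}" by auto
      qed
      then show "(\<Sum>i\<in>{b..k - c}. p i g * q (k - i) g) = fls_nth (F g * G g) k"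
        using p(2) q(2) g by (simp add: fls_times_nth_finite[of "{b..k - c}"])
    qed
  qed
  moreover have "\<forall>g\<in>pole_bounded m N. \<forall>k<b + c. fls_nth (F g * G g) k = 0"
    using b c fls_times_nth_eq_0 by (metis (no_types, lifting))
  ultimately show ?thesis unfolding polynomial_coefficients_def by blast
qed

lemma polynomial_coefficients_sum:
  "(\<And>s. s \<in> S \<Longrightarrow> polynomial_coefficients m N (F s)) \<Longrightarrow> polynomial_coefficients m N (\<lambda>g. \<Sum>s\<in>S. F s g)"
  by (induction S rule: infinite_finite_induct)
    (auto intro: polynomial_coefficients_const polynomial_coefficients_add)

lemma polynomial_coefficients_prod:
  "(\<And>s. s \<in> S \<Longrightarrow> polynomial_coefficients m N (F s)) \<Longrightarrow> polynomial_coefficients m N (\<lambda>g. \<Prod>s\<in>S. F s g)"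
  by (induction S rule: infinite_finite_induct)
    (auto intro: polynomial_coefficients_const polynomial_coefficients_mult)

lemma polynomial_coefficients_cong:
  assumes "polynomial_coefficients m N F" "\<And>g. g \<in> pole_bounded m N \<Longrightarrow> F g = G g"
  shows "polynomial_coefficients m N G"
  using assms unfolding polynomial_coefficients_def by (metis (no_types, lifting))

text \<open>Up to sign an entry of the adjugate is a minor, hence by the Leibniz formula a sum of
  products of entries.\<close>

lemma polynomial_coefficients_adj_mat:
  assumes "i < m" "j < m"
  shows "polynomial_coefficients m N (\<lambda>g. adj_mat g $$ (i, j))"
proof (rule polynomial_coefficients_cong)
  \<comment> \<open>The shifts skip row j and column i, so this is the entry (r, s) of
    \<open>mat_delete g j i\<close>.\<close>
  let ?e = "\<lambda>g r s. g $$ (if r < j then r else Suc r, if s < i then s else Suc s)"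
  let ?F = "\<lambda>g::complex fls mat. (-1) ^ (j + i) *
    (\<Sum>p | p permutes {0..<m - 1}. signof p * (\<Prod>r=0..<m - 1. ?e g r (p r)))"
  have row: "(if r < j then r else Suc r) < m" if "r \<in> {0..<m - 1}" for r
    using that by auto
  have col: "(if p r < i then p r else Suc (p r)) < m"
    if "p \<in> {p. p permutes {0..<m - 1}}" "r \<in> {0..<m - 1}" for p r
  proof -
    have "p r \<in> {0..<m - 1}" using permutes_in_image[of p "{0..<m - 1}" r] that by blast
    then show ?thesis by auto
  qed
  show "polynomial_coefficients m N ?F"
    by (intro polynomial_coefficients_mult polynomial_coefficients_sum polynomial_coefficients_prod
        polynomial_coefficients_const polynomial_coefficients_entry row col)
  fix g assume "g \<in> pole_bounded m N"
  then have g: "g \<in> carrier_mat m m" by (auto simp: pole_bounded_def)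
  have "p r < m - 1" if "p permutes {0..<m - 1}" "r < m - 1" for p r
    using permutes_in_image[OF that(1), of r] that(2) by auto
  then have "det (mat_delete g j i) =
      (\<Sum>p | p permutes {0..<m - 1}. signof p * (\<Prod>r=0..<m - 1. ?e g r (p r)))"
    using g unfolding det_def'[OF mat_delete_carrier[OF g]]
    by (intro sum.cong prod.cong arg_cong2[of _ _ _ _ "(*)"]) (auto simp: mat_delete_def)
  then show "?F g = adj_mat g $$ (i, j)"
    using g assms by (simp add: adj_mat_def cofactor_def)
qed

section \<open>Pole bounds and torus stability of the orbit closure\<close>

lemma loop_closed_pole_bounded: "loop_closed m (pole_bounded m K)"
  unfolding loop_closed_iff
proof (intro conjI allI ballI)
  show "pole_bounded m K \<subseteq> carrier (SL m)" by (auto simp: pole_bounded_def)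
  fix N g assume "g \<in> pole_bounded m N - pole_bounded m K"
  then obtain i j k where ijk: "i < m" "j < m" "k < - int K" "fls_nth (g $$ (i, j)) k \<noteq> 0"
    by (auto simp: pole_bounded_def)
  show "\<exists>q\<in>polynomials_in (loop_coordinates m). (\<forall>z\<in>pole_bounded m K \<inter> pole_bounded m N. q z = 0) \<and> q g \<noteq> 0"
    by (rule bexI[of _ "\<lambda>g. fls_nth (g $$ (i, j)) k"])
      (use ijk in \<open>auto intro!: polynomials_in.gen simp: loop_coordinates_def pole_bounded_def\<close>)
qed

text \<open>The coefficients of the adjugate are polynomial functions on each
  \<open>pole_bounded m N\<close>, so a forbidden pole of the inverse is detected by a polynomial in
  the coordinates of the matrix itself.\<close>

lemma loop_closed_adj_pole_bounded:
  "loop_closed m {g \<in> carrier (SL m). adj_mat g \<in> pole_bounded m K}" (is "loop_closed m ?Z")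
  unfolding loop_closed_iff
proof (intro conjI allI ballI)
  fix N g assume g: "g \<in> pole_bounded m N - ?Z"
  then have "g \<in> carrier (SL m)" by (auto simp: pole_bounded_def)
  then have "adj_mat g \<in> carrier (SL m)" "adj_mat g \<notin> pole_bounded m K"
    using g SL_adj_mat(1) by blast+
  then obtain i j k where ijk: "i < m" "j < m" "k < - int K" "fls_nth (adj_mat g $$ (i, j)) k \<noteq> 0"
    by (auto simp: pole_bounded_def)
  obtain q where "q \<in> polynomials_in (loop_coordinates m)"
    "\<forall>g\<in>pole_bounded m N. q g = fls_nth (adj_mat g $$ (i, j)) k"
    using polynomial_coefficients_adj_mat[OF ijk(1,2)] unfolding polynomial_coefficients_def by blast
  then show "\<exists>q\<in>polynomials_in (loop_coordinates m). (\<forall>z\<in>?Z \<inter> pole_bounded m N. q z = 0) \<and> q g \<noteq> 0"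
    using ijk g by (intro bexI[of _ q]) (auto simp: pole_bounded_def)
qed auto

lemma pole_bounded_mult:
  assumes "g \<in> pole_bounded m K" "h \<in> pole_bounded m L"
  shows "g * h \<in> pole_bounded m (K + L)"
proof -
  have c: "g \<in> carrier_mat m m" "h \<in> carrier_mat m m" using assms by (auto simp: pole_bounded_def)
  have "fls_nth ((g * h) $$ (i, j)) k = 0" if "i < m" "j < m" "k < - int (K + L)" for i j k
  proof -
    have "fls_nth (g $$ (i, r) * h $$ (r, j)) k = 0" if "r < m" for r
      by (rule fls_times_nth_eq_0[of "- int K" _ "- int L"])
        (use assms \<open>r < m\<close> \<open>i < m\<close> \<open>j < m\<close> \<open>k < _\<close> in \<open>auto simp: pole_bounded_def\<close>)
    then show ?thesis using that by (simp add: mat_mult_entry[OF c] fls_sum_nth del: index_mult_mat)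
  qed
  moreover have "g * h \<in> carrier (SL m)"
    by (rule SL_mult_closed) (use assms in \<open>auto simp: pole_bounded_def\<close>)
  ultimately show ?thesis unfolding pole_bounded_def by blast
qed

lemma arc_group_pole_bounded: "h \<in> arc_group m \<Longrightarrow> h \<in> pole_bounded m 0"
  using arc_group_subset arc_group_nth by (fastforce simp: pole_bounded_def)

lemma t_pow_pole_bounded:
  assumes "(\<Sum>k=1..m. \<nu> k) = 0" "\<And>k. k \<in> {1..m} \<Longrightarrow> - int K \<le> \<nu> k"
  shows "t_pow m \<nu> \<in> pole_bounded m K"
proof -
  have "- int K \<le> \<nu> (i + 1)" if "i < m" for i using assms(2)[of "i + 1"] that by auto
  then show ?thesis
    using t_pow_SL[OF assms(1)] by (force simp: pole_bounded_def t_pow_index simp del: SL_simps(1))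
qed

lemma adj_mat_t_pow:
  assumes "(\<Sum>k=1..m. \<nu> k) = 0"
  shows "adj_mat (t_pow m \<nu>) = t_pow m (\<lambda>k. - \<nu> k)"
proof (rule SL_inverse_unique[OF t_pow_SL[OF assms], symmetric])
  have "(t_pow m (\<lambda>k. - \<nu> k) * t_pow m \<nu>) $$ (i, j) = 1\<^sub>m m $$ (i, j)" if "i < m" "j < m" for i j
    using that by (auto simp: mult_t_pow_index[OF t_pow_carrier that] t_pow_index power_int_minus
        simp del: index_mult_mat fls_X_power_int)
  then show "t_pow m (\<lambda>k. - \<nu> k) * t_pow m \<nu> = 1\<^sub>m m"
    by (intro eq_matI) (auto simp del: index_mult_mat(1), auto simp: t_pow_def)
qed simp

text \<open>Multiplication by arcs on either side creates no poles. The pole bound of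
  \<open>t_pow m lam\<close> therefore holds on the orbit, is invariant on the right and passes to
  the closure.\<close>

lemma closure_pole_bounded:
  assumes "(\<Sum>k=1..m. lam k) = 0" "\<And>k. k \<in> {1..m} \<Longrightarrow> - int K \<le> lam k"
    and "g \<in> carrier (SL m)" "g <#\<^bsub>SL m\<^esub> arc_group m \<in> Gr_orbit_closure m lam"
  shows "g \<in> pole_bounded m K"
proof (rule Gr_closure_subset[OF loop_closed_pole_bounded _ _ assms(3,4)])
  show "g * p \<in> pole_bounded m K" if "g \<in> pole_bounded m K" "p \<in> arc_group m" for g p
    using pole_bounded_mult[OF that(1) arc_group_pole_bounded[OF that(2)]] by simp
  show "h * t_pow m lam \<in> pole_bounded m K" if "h \<in> arc_group m" for h
    using pole_bounded_mult[OF arc_group_pole_bounded[OF that] t_pow_pole_bounded[OF assms(1,2)]] by simp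
qed

text \<open>Inversion turns the upper bound on the coweight into a pole bound for
  \<open>t_pow m (\<lambda>k. - lam k)\<close>, and right multiplication by an arc into left
  multiplication of the inverse.\<close>

lemma closure_adj_pole_bounded:
  assumes "(\<Sum>k=1..m. lam k) = 0" "\<And>k. k \<in> {1..m} \<Longrightarrow> lam k \<le> int K"
    and "g \<in> carrier (SL m)" "g <#\<^bsub>SL m\<^esub> arc_group m \<in> Gr_orbit_closure m lam"
  shows "adj_mat g \<in> pole_bounded m K"
proof -
  have *: "t_pow m (\<lambda>k. - lam k) \<in> pole_bounded m K"
    by (rule t_pow_pole_bounded) (use assms(1,2) in \<open>auto simp: sum_negf\<close>)
  have "g \<in> {g \<in> carrier (SL m). adj_mat g \<in> pole_bounded m K}"
  proof (rule Gr_closure_subset[OF loop_closed_adj_pole_bounded _ _ assms(3,4)])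
    fix g p assume g: "g \<in> {g \<in> carrier (SL m). adj_mat g \<in> pole_bounded m K}" and p: "p \<in> arc_group m"
    have "p \<in> carrier (SL m)" using p arc_group_subset by blast
    then show "g * p \<in> {g \<in> carrier (SL m). adj_mat g \<in> pole_bounded m K}"
      using g pole_bounded_mult[OF arc_group_pole_bounded[OF arc_group_adj_mat[OF p]]]
        SL_mult_closed[of g m p] by (simp add: SL_adj_mat_mult[of g m p] del: SL_simps(1))
  next
    fix h assume h: "h \<in> arc_group m"
    have "h \<in> carrier (SL m)" using h arc_group_subset by blast
    then show "h * t_pow m lam \<in> {g \<in> carrier (SL m). adj_mat g \<in> pole_bounded m K}"
      using pole_bounded_mult[OF * arc_group_pole_bounded[OF arc_group_adj_mat[OF h]]] t_pow_SL[OF assms(1)]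
        SL_mult_closed[of h m "t_pow m lam"]
      by (simp add: SL_adj_mat_mult[of h m "t_pow m lam"] adj_mat_t_pow[OF assms(1)] del: SL_simps(1))
  qed
  then show ?thesis by simp
qed

text \<open>Left translation by a constant torus element preserves the orbit. Hence the preimage
  under it of any closed \<open>Z\<close> containing the orbit is again closed and contains the
  orbit, and so contains the closure.\<close>

lemma closure_torus_stable:
  assumes "(\<Sum>k=1..m. lam k) = 0"
    and \<tau>: "\<tau> \<in> torus m"
    and g: "g \<in> carrier (SL m)" "g <#\<^bsub>SL m\<^esub> arc_group m \<in> Gr_orbit_closure m lam"
  shows "(map_mat fls_const \<tau> * g) <#\<^bsub>SL m\<^esub> arc_group m \<in> Gr_orbit_closure m lam"
proof -
  define D where "D = map_mat fls_const \<tau>"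
  have "D \<in> arc_group m"
  proof (rule arc_groupI)
    show "map_mat fps_const \<tau> \<in> carrier (SL m)"
    proof -
      interpret comm_ring_hom "fps_const :: complex \<Rightarrow> _" by unfold_locales auto
      show ?thesis using hom_SL[of \<tau> m] \<tau> by (simp add: torus_def)
    qed
    show "D = map_mat fps_to_fls (map_mat fps_const \<tau>)" by (auto simp: D_def)
  qed
  then have DS: "D \<in> carrier (SL m)" using arc_group_subset by blast
  have Dentry: "(D * g) $$ (i, j) = fls_const (\<tau> $$ (i, i)) * g $$ (i, j)"
    if "g \<in> carrier_mat m m" "i < m" "j < m" for g i j
  proof -
    have d: "D \<in> carrier_mat m m" "\<tau> \<in> carrier_mat m m" "diagonal_mat \<tau>" using DS \<tau> by (auto simp: torus_def)
    have "(D * g) $$ (i, j) = (\<Sum>k<m. if k = i then fls_const (\<tau> $$ (i, i)) * g $$ (i, j) else 0)"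
      unfolding mat_mult_entry[OF d(1) that]
      by (rule sum.cong) (use d that in \<open>auto simp: D_def diagonal_mat_def\<close>)
    then show ?thesis using that by simp
  qed
  have "(D * g) <#\<^bsub>SL m\<^esub> arc_group m \<in> Z" if Z: "Gr_closed m Z" "Gr_orbit m lam \<subseteq> Z" for Z
  proof -
    define S where "S = {g \<in> carrier (SL m). (D * g) <#\<^bsub>SL m\<^esub> arc_group m \<in> Z}"
    let ?Y = "{g \<in> carrier (SL m). g <#\<^bsub>SL m\<^esub> arc_group m \<in> Z}"
    have Y: "loop_closed m ?Y" using Z(1) by (simp add: Gr_closed_def)
    have Dpb: "D * g \<in> pole_bounded m N" if "g \<in> pole_bounded m N" for g N
      using pole_bounded_mult[OF arc_group_pole_bounded[OF \<open>D \<in> arc_group m\<close>] that] by simp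
    \<comment> \<open>A constant diagonal matrix scales each row by a number, so a coordinate pulls
      back to a scalar multiple of itself.\<close>
    have pull: "\<exists>q\<in>polynomials_in (loop_coordinates m). \<forall>g\<in>carrier (SL m). q g = p (D * g)"
      if "p \<in> polynomials_in (loop_coordinates m)" for p
      using that
    proof induction
      case (const c) show ?case by (rule bexI[OF _ polynomials_in.const]) auto
    next
      case (gen f)
      then obtain i j k where f: "f = (\<lambda>g. fls_nth (g $$ (i, j)) k)" "i < m" "j < m"
        by (auto simp: loop_coordinates_def)
      show ?case
        by (rule bexI[OF _ polynomials_in.mult[OF polynomials_in.const polynomials_in.gen[OF gen]]])
          (use f Dentry in auto)
    next
      case (add f g)
      then obtain p q where "p \<in> polynomials_in (loop_coordinates m)" "\<forall>g\<in>carrier (SL m). p g = f (D * g)"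
        "q \<in> polynomials_in (loop_coordinates m)" "\<forall>x\<in>carrier (SL m). q x = g (D * x)" by blast
      then show ?case by (intro bexI[OF _ polynomials_in.add[of p _ q]]) auto
    next
      case (mult f g)
      then obtain p q where "p \<in> polynomials_in (loop_coordinates m)" "\<forall>g\<in>carrier (SL m). p g = f (D * g)"
        "q \<in> polynomials_in (loop_coordinates m)" "\<forall>x\<in>carrier (SL m). q x = g (D * x)" by blast
      then show ?case by (intro bexI[OF _ polynomials_in.mult[of p _ q]]) auto
    qed
    have "loop_closed m S"
      unfolding loop_closed_iff
    proof (intro conjI allI ballI)
      fix N g assume g: "g \<in> pole_bounded m N - S"
      then have "D * g \<in> pole_bounded m N - ?Y" using Dpb by (auto simp: S_def pole_bounded_def)
      then obtain q where q: "q \<in> polynomials_in (loop_coordinates m)"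
        "\<forall>z\<in>?Y \<inter> pole_bounded m N. q z = 0" "q (D * g) \<noteq> 0"
        using Y unfolding loop_closed_iff by blast
      obtain q' where q': "q' \<in> polynomials_in (loop_coordinates m)" "\<forall>g\<in>carrier (SL m). q' g = q (D * g)"
        using pull[OF q(1)] by blast
      have "q' g \<noteq> 0" using q' q(3) g by (simp add: pole_bounded_def)
      moreover have "q' z = 0" if "z \<in> S \<inter> pole_bounded m N" for z
      proof -
        have "D * z \<in> ?Y \<inter> pole_bounded m N"
          using that Dpb SL_mult_closed[OF DS, of z] by (simp add: S_def del: SL_simps(1))
        then show ?thesis using q(2) q' that by (auto simp: S_def)
      qed
      ultimately show "\<exists>q\<in>polynomials_in (loop_coordinates m). (\<forall>z\<in>S \<inter> pole_bounded m N. q z = 0) \<and> q g \<noteq> 0"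
        using q' by blast
    qed (auto simp: S_def)
    then have "g \<in> S"
    proof (rule Gr_closure_subset[OF _ _ _ g])
      fix x p assume x: "x \<in> S" and p: "p \<in> arc_group m"
      have c: "x \<in> carrier (SL m)" "p \<in> carrier (SL m)" using x p arc_group_subset by (auto simp: S_def)
      have "D * (x * p) = D * x * p" using DS c by (simp add: assoc_mult_mat[of _ m m _ m _ m])
      then show "x * p \<in> S"
        using x arc_coset_mult[OF SL_mult_closed[OF DS c(1)] p] SL_mult_closed[OF c]
        by (simp add: S_def del: SL_simps(1))
    next
      fix h assume h: "h \<in> arc_group m"
      then have hc: "h \<in> carrier (SL m)" using arc_group_subset by blast
      have "D * (h * t_pow m lam) = D * h * t_pow m lam"
        using DS hc t_pow_carrier[of m lam] by (simp add: assoc_mult_mat[of _ m m _ m _ m])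
      then have "(D * (h * t_pow m lam)) <#\<^bsub>SL m\<^esub> arc_group m \<in> Gr_orbit m lam"
        using arc_group_mult[OF \<open>D \<in> arc_group m\<close> h] by (auto simp: Gr_orbit_def)
      then show "h * t_pow m lam \<in> S"
        using Z(2) SL_mult_closed[OF hc t_pow_SL[OF assms(1)]] by (auto simp: S_def)
    qed
    then show ?thesis by (simp add: S_def)
  qed
  then show ?thesis unfolding Gr_orbit_closure_def hull_def D_def by blast
qed

section \<open>Degenerations in the orbit closure\<close>

lemma addrow_mat_index:
  "i < m \<Longrightarrow> j < m \<Longrightarrow> addrow_mat m a k l $$ (i, j) = (if i = k \<and> j = l then a else 0) + (if i = j then 1 else 0)"
  by (simp add: addrow_mat_def)

lemma mult_addrow_mat_index:
  assumes "A \<in> carrier_mat m m" "i < m" "j < m" "k < m" "l < m"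
  shows "(A * addrow_mat m a k l) $$ (i, j) = A $$ (i, j) + (if j = l then A $$ (i, k) * a else 0)"
    and "(addrow_mat m a k l * A) $$ (i, j) = A $$ (i, j) + (if i = k then a * A $$ (l, j) else 0)"
proof -
  have "(A * addrow_mat m a k l) $$ (i, j) =
      (\<Sum>r<m. (if r = j then A $$ (i, j) else 0) + (if r = k then if j = l then A $$ (i, k) * a else 0 else 0))"
    unfolding mat_mult_entry[OF assms(1) addrow_mat_carrier assms(2,3)]
    by (rule sum.cong) (use assms in \<open>auto simp: addrow_mat_index algebra_simps\<close>)
  then show "(A * addrow_mat m a k l) $$ (i, j) = A $$ (i, j) + (if j = l then A $$ (i, k) * a else 0)"
    using assms by (simp add: sum.distrib)
  have "(addrow_mat m a k l * A) $$ (i, j) =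
      (\<Sum>r<m. (if r = i then A $$ (i, j) else 0) + (if r = l then if i = k then a * A $$ (l, j) else 0 else 0))"
    unfolding mat_mult_entry[OF addrow_mat_carrier assms(1,2,3)]
    by (rule sum.cong) (use assms in \<open>auto simp: addrow_mat_index algebra_simps\<close>)
  then show "(addrow_mat m a k l * A) $$ (i, j) = A $$ (i, j) + (if i = k then a * A $$ (l, j) else 0)"
    using assms by (simp add: sum.distrib)
qed

lemma addrow_mat_SL: "k \<noteq> l \<Longrightarrow> addrow_mat m a k l \<in> carrier (SL m)"
  by (simp add: det_addrow_mat)

lemma addrow_mat_arc_group: "k \<noteq> l \<Longrightarrow> addrow_mat m (fps_to_fls f) k l \<in> arc_group m"
  by (rule arc_groupI[OF addrow_mat_SL[of k l m f]]) (auto simp: addrow_mat_def)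

text \<open>All points of the line obey one pole bound, and a polynomial in the coordinates
  restricts to a polynomial in s. If it vanishes for all nonzero s, it has infinitely many roots and
  also vanishes at 0.\<close>

lemma linear_curve_closed:
  assumes Z: "loop_closed m Z"
    and \<gamma>: "\<And>s. \<gamma> s \<in> carrier (SL m)"
    and lin: "\<And>s i j. i < m \<Longrightarrow> j < m \<Longrightarrow> \<gamma> s $$ (i, j) = A i j + fls_const s * B i j"
    and ne: "\<And>s. s \<noteq> 0 \<Longrightarrow> \<gamma> s \<in> Z"
  shows "\<gamma> 0 \<in> Z"
proof (rule ccontr)
  assume notin: "\<gamma> 0 \<notin> Z"
  \<comment> \<open>The sum of the pole orders of both coefficients bounds the poles for every s at
    once; \<open>nat\<close> gives 0 for a series without pole.\<close>
  let ?S = "(\<lambda>(i, j). nat (- fls_subdegree (A i j)) + nat (- fls_subdegree (B i j))) ` ({..<m} \<times> {..<m})"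
  have "finite ?S" by simp
  then obtain N where "\<forall>x\<in>?S. x \<le> N" using finite_nat_set_iff_bounded_le by blast
  then have N: "nat (- fls_subdegree (A i j)) + nat (- fls_subdegree (B i j)) \<le> N" if "i < m" "j < m" for i j
    using that by auto
  have "fls_nth (\<gamma> s $$ (i, j)) k = 0" if "i < m" "j < m" "k < - int N" for s i j k
  proof -
    have "k < fls_subdegree (A i j)" "k < fls_subdegree (B i j)" using N[OF that(1,2)] that(3) by auto
    then show ?thesis using lin[OF that(1,2)] by simp
  qed
  then have pb: "\<gamma> s \<in> pole_bounded m N" for s using \<gamma> by (simp add: pole_bounded_def)
  then obtain q where q: "q \<in> polynomials_in (loop_coordinates m)" "\<forall>z\<in>Z \<inter> pole_bounded m N. q z = 0" "q (\<gamma> 0) \<noteq> 0"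
    using Z notin unfolding loop_closed_iff by blast
  have "\<exists>r. \<forall>s. q (\<gamma> s) = poly r s" using q(1)
  proof induction
    case (const c) show ?case by (rule exI[of _ "[:c:]"]) simp
  next
    case (gen f)
    then obtain i j k where "f = (\<lambda>g. fls_nth (g $$ (i, j)) k)" "i < m" "j < m" by (auto simp: loop_coordinates_def)
    then show ?case by (intro exI[of _ "[:fls_nth (A i j) k, fls_nth (B i j) k:]"]) (simp add: lin)
  next
    case (add f g)
    then obtain p r where "\<forall>s. f (\<gamma> s) = poly p s" "\<forall>s. g (\<gamma> s) = poly r s" by blast
    then show ?case by (intro exI[of _ "p + r"]) simp
  next
    case (mult f g)
    then obtain p r where "\<forall>s. f (\<gamma> s) = poly p s" "\<forall>s. g (\<gamma> s) = poly r s" by blast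
    then show ?case by (intro exI[of _ "p * r"]) simp
  qed
  then obtain r where r: "q (\<gamma> s) = poly r s" for s by blast
  have "poly r s = 0" if "s \<noteq> 0" for s using q(2) ne[OF that] pb[of s] r[of s] by auto
  then have "- {0} \<subseteq> {s. poly r s = 0}" by auto
  moreover have "infinite (- {0::complex})" using infinite_UNIV_char_0 by (simp add: Compl_eq_Diff_UNIV)
  ultimately have "r = 0" using poly_roots_finite finite_subset by blast
  then show False using q(3) r by simp
qed

text \<open>Subtraction of c times the coroot of the pair (i, j). Matrix positions start at 0 and
  the entries of coweights at 1, whence the shifts.\<close>

definition coweight_move :: "(nat \<Rightarrow> int) \<Rightarrow> nat \<Rightarrow> nat \<Rightarrow> int \<Rightarrow> nat \<Rightarrow> int" where
  "coweight_move \<nu> i j c = \<nu>(i + 1 := \<nu> (i + 1) - c, j + 1 := \<nu> (j + 1) + c)"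

lemma sum_coweight_move:
  assumes "i < m" "j < m" "i \<noteq> j"
  shows "(\<Sum>k=1..m. coweight_move \<nu> i j c k) = (\<Sum>k=1..m. \<nu> k)"
proof -
  have "coweight_move \<nu> i j c k = \<nu> k + ((if k = j + 1 then c else 0) - (if k = i + 1 then c else 0))" for k
    using assms by (auto simp: coweight_move_def)
  then show ?thesis using assms by (simp add: sum.distrib sum_subtractf)
qed

text \<open>In the rows and columns \<open>i\<close>, \<open>j\<close> this is the product of 2 by 2 matrices, written row by row,
  \<open>(1, 0; s/u, 1) = (1, u/s; 0, 1) (u, 0; 0, 1/u) (0, -1/s; s, u)\<close> with \<open>u = t\<^sup>c\<close>, multiplied
  from the left by the diagonal matrix \<open>t_pow\<close>.\<close>

lemma t_pow_addrow_mat_factor: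
  fixes s :: complex
  assumes "i < m" "j < m" "i \<noteq> j" "s \<noteq> 0"
  shows "t_pow m (coweight_move \<nu> i j c) * addrow_mat m (fls_const s * fls_X powi (- c)) j i =
    addrow_mat m (fls_const (1 / s) * fls_X powi (\<nu> (i + 1) - \<nu> (j + 1) - c)) i j * t_pow m \<nu>
      * addrow_mat m (fls_const (- 1 / s)) i j * addrow_mat m (fls_const s) j i
      * addrow_mat m (fls_const (1 / s) * (fls_X powi c - 1)) i j" (is "?L = ?R")
proof (rule eq_matI)
  fix p q assume "p < dim_row ?R" "q < dim_col ?R"
  then have pq: "p < m" "q < m" by (auto simp: addrow_mat_def)
  \<comment> \<open>With the powers of t and the scalar named, the equality is checked entry by
    entry as rational arithmetic in four symbols.\<close>
  define u x y \<sigma> :: "complex fls" where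
    "u = fls_X powi c" "x = fls_X powi \<nu> (Suc i)" "y = fls_X powi \<nu> (Suc j)" "\<sigma> = fls_const s"
  have nz: "u \<noteq> 0" "y \<noteq> 0" "\<sigma> \<noteq> 0"
    using assms(4) by (auto simp: u_x_y_\<sigma>_def simp del: fls_X_power_int)
  have pw: "fls_X powi (- c) = inverse u" "fls_X powi (\<nu> (Suc i) - c) = x / u"
    "fls_X powi (\<nu> (Suc j) + c) = y * u" "fls_X powi (\<nu> (Suc i) - \<nu> (Suc j) - c) = x / (y * u)"
    by (simp_all add: u_x_y_\<sigma>_def power_int_minus power_int_diff power_int_add field_simps del: fls_X_power_int)
  have sg: "fls_const (1 / s) = inverse \<sigma>" "fls_const (- 1 / s) = - inverse \<sigma>"
    by (simp_all add: u_x_y_\<sigma>_def fls_inverse_const divide_inverse)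
  have c: "addrow_mat m b k l \<in> carrier_mat m m" "t_pow m \<nu>' \<in> carrier_mat m m"
    "A \<in> carrier_mat m m \<Longrightarrow> B \<in> carrier_mat m m \<Longrightarrow> A * B \<in> carrier_mat m m"
    for b :: "complex fls" and k l \<nu>' and A B :: "complex fls mat" by auto
  show "?L $$ (p, q) = ?R $$ (p, q)"
    unfolding sg u_x_y_\<sigma>_def(1,4)[symmetric]
    using nz pq assms
    by (simp add: mult_addrow_mat_index c t_pow_index addrow_mat_index coweight_move_def pw
          u_x_y_\<sigma>_def(2,3)[symmetric] del: index_mult_mat fls_X_power_int)
      (auto simp: field_simps)
qed (auto simp: addrow_mat_def t_pow_def)

lemma mult_assoc_regroup:
  fixes h :: "'a::semiring_0 mat"
  assumes "h \<in> carrier_mat m m" "a \<in> carrier_mat m m" "b \<in> carrier_mat m m" "c \<in> carrier_mat m m"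
    "d \<in> carrier_mat m m" "e \<in> carrier_mat m m"
  shows "h * (a * b * c * d * e) = h * a * b * (c * d * e)"
  using assms by (simp add: assoc_mult_mat[of _ m m _ m _ m])

text \<open>The condition is imposed on the whole orbit and not only on the point of
  \<open>\<nu>\<close>, because a degeneration multiplies by an arc from the left; in this form
  moves can be iterated.\<close>

definition Gr_stratum_in :: "nat \<Rightarrow> complex fls mat set set \<Rightarrow> (nat \<Rightarrow> int) \<Rightarrow> bool" where
  "Gr_stratum_in m Z \<nu> \<longleftrightarrow> (\<forall>h\<in>arc_group m. (h * t_pow m \<nu>) <#\<^bsub>SL m\<^esub> arc_group m \<in> Z)"

lemma fls_X_powi_nonneg: "c \<ge> 0 \<Longrightarrow> fls_X powi c = fps_to_fls (fps_X ^ nat c :: complex fps)"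
  by (simp add: power_int_def fps_to_fls_power fps_X_to_fls del: fls_X_power_int)

text \<open>For nonzero s the factorisation keeps the curve in the orbit of \<open>\<nu>\<close>:
  the left factor contains t to the power \<open>\<nu> (i + 1) - \<nu> (j + 1) - c\<close> and a
  right factor contains t to the power \<open>c\<close>, so the two inequalities place them in the
  arc group. At s = 0 the curve passes through the moved coweight. All values of s are kept in the
  conclusion, since for a move to the zero coweight the curve itself is wanted.\<close>

lemma orbit_move_curve:
  assumes Z: "Gr_closed m Z" and \<nu>: "(\<Sum>k=1..m. \<nu> k) = 0" "Gr_stratum_in m Z \<nu>"
    and ij: "i < m" "j < m" "i \<noteq> j" and c: "0 \<le> c" "c \<le> \<nu> (i + 1) - \<nu> (j + 1)"
    and h: "h \<in> arc_group m"
  shows "(h * (t_pow m (coweight_move \<nu> i j c) * addrow_mat m (fls_const s * fls_X powi (- c)) j i))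
    <#\<^bsub>SL m\<^esub> arc_group m \<in> Z"
proof -
  let ?t = "t_pow m (coweight_move \<nu> i j c)"
  let ?E = "\<lambda>s. addrow_mat m (fls_const s * fls_X powi (- c)) j i"
  define \<gamma> where "\<gamma> s = h * (?t * ?E s)" for s
  have hS: "h \<in> carrier (SL m)" using h arc_group_subset by blast
  have hc: "h \<in> carrier_mat m m" using hS by simp
  have tS: "?t \<in> carrier (SL m)" using t_pow_SL \<nu>(1) sum_coweight_move[OF ij] by metis
  have \<gamma>S: "\<gamma> s \<in> carrier (SL m)" for s
    unfolding \<gamma>_def by (intro SL_mult_closed hS tS addrow_mat_SL) (use ij in auto)
  have ne: "\<gamma> s <#\<^bsub>SL m\<^esub> arc_group m \<in> Z" if "s \<noteq> 0" for s
  proof -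
    let ?W = "addrow_mat m (fls_const (1 / s) * fls_X powi (\<nu> (i + 1) - \<nu> (j + 1) - c)) i j"
    let ?K1 = "addrow_mat m (fls_const (- 1 / s)) i j"
    let ?K2 = "addrow_mat m (fls_const s) j i"
    let ?K3 = "addrow_mat m (fls_const (1 / s) * (fls_X powi c - 1)) i j"
    have ca: "fls_const x = fps_to_fls (fps_const x)" for x :: complex by simp
    have W: "?W \<in> arc_group m"
      using addrow_mat_arc_group[OF ij(3), of m "fps_const (1 / s) * fps_X ^ nat (\<nu> (i + 1) - \<nu> (j + 1) - c)"] c
      by (simp add: fls_X_powi_nonneg fls_times_fps_to_fls del: fls_X_power_int)
    have K1: "?K1 \<in> arc_group m" unfolding ca using addrow_mat_arc_group ij by blast
    have K2: "?K2 \<in> arc_group m" unfolding ca using addrow_mat_arc_group ij by metis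
    have K3: "?K3 \<in> arc_group m"
      using addrow_mat_arc_group[OF ij(3), of m "fps_const (1 / s) * (fps_X ^ nat c - 1)"] c
      by (simp add: fls_X_powi_nonneg fls_times_fps_to_fls del: fls_X_power_int)
    have K: "?K1 * ?K2 * ?K3 \<in> arc_group m" by (intro arc_group_mult K1 K2 K3)
    have cr: "?W \<in> carrier_mat m m" "?K1 \<in> carrier_mat m m" "?K2 \<in> carrier_mat m m" "?K3 \<in> carrier_mat m m"
      "t_pow m \<nu> \<in> carrier_mat m m" by simp_all
    have "\<gamma> s = h * (?W * t_pow m \<nu> * ?K1 * ?K2 * ?K3)"
      unfolding \<gamma>_def t_pow_addrow_mat_factor[OF ij that] ..
    also have "\<dots> = h * ?W * t_pow m \<nu> * (?K1 * ?K2 * ?K3)"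
      by (rule mult_assoc_regroup[OF hc cr(1,5,2,3,4)])
    finally have "\<gamma> s <#\<^bsub>SL m\<^esub> arc_group m = (h * ?W * t_pow m \<nu>) <#\<^bsub>SL m\<^esub> arc_group m"
      using arc_coset_mult[OF SL_mult_closed[OF SL_mult_closed[OF hS] t_pow_SL[OF \<nu>(1)]] K, of ?W]
        W arc_group_subset by auto
    moreover have "h * ?W \<in> arc_group m" by (rule arc_group_mult[OF h W])
    ultimately show ?thesis using \<nu>(2) unfolding Gr_stratum_in_def by simp
  qed
  have "\<gamma> 0 \<in> {g \<in> carrier (SL m). g <#\<^bsub>SL m\<^esub> arc_group m \<in> Z}"
  proof (rule linear_curve_closed)
    show "loop_closed m {g \<in> carrier (SL m). g <#\<^bsub>SL m\<^esub> arc_group m \<in> Z}"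
      using Z by (simp add: Gr_closed_def)
    show "\<gamma> s \<in> {g \<in> carrier (SL m). g <#\<^bsub>SL m\<^esub> arc_group m \<in> Z}" if "s \<noteq> 0" for s
      using ne[OF that] \<gamma>S by blast
    \<comment> \<open>Only column i varies with s, and it does so linearly, by a multiple of column
      j.\<close>
    show "\<gamma> s $$ (p, q) = (h * ?t) $$ (p, q) + fls_const s *
      (if q = i then (h * ?t) $$ (p, j) * fls_X powi (- c) else 0)" if "p < m" "q < m" for s p q
    proof -
      have "\<gamma> s = h * ?t * ?E s" unfolding \<gamma>_def using hc by (simp add: assoc_mult_mat[of _ m m _ m _ m])
      then show ?thesis
        using mult_addrow_mat_index(1)[OF mult_carrier_mat[OF hc t_pow_carrier] that ij(2,1)] by simp
    qed
  qed (rule \<gamma>S)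
  then show ?thesis using ne[of s] by (cases "s = 0") (auto simp: \<gamma>_def)
qed

lemma orbit_move:
  assumes "Gr_closed m Z" "(\<Sum>k=1..m. \<nu> k) = 0" "Gr_stratum_in m Z \<nu>"
    and "i < m" "j < m" "i \<noteq> j" "0 \<le> c" "c \<le> \<nu> (i + 1) - \<nu> (j + 1)"
  shows "Gr_stratum_in m Z (coweight_move \<nu> i j c)"
proof -
  have e: "addrow_mat m (fls_const 0 * fls_X powi (- c)) j i = 1\<^sub>m m"
    by (rule eq_matI) (auto simp: addrow_mat_def)
  have "t_pow m (coweight_move \<nu> i j c) * addrow_mat m (fls_const 0 * fls_X powi (- c)) j i =
      t_pow m (coweight_move \<nu> i j c)"
    unfolding e by (rule right_mult_one_mat[OF t_pow_carrier])
  then show ?thesis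
    using orbit_move_curve[OF assms, of _ 0] unfolding Gr_stratum_in_def by simp
qed

lemma Gr_stratum_in_cong:
  assumes "Gr_stratum_in m Z \<nu>" "\<And>k. k \<in> {1..m} \<Longrightarrow> \<nu> k = \<nu>' k"
  shows "Gr_stratum_in m Z \<nu>'"
proof -
  have "t_pow m \<nu> = t_pow m \<nu>'" unfolding t_pow_def using assms(2) by (intro cong_mat) auto
  then show ?thesis using assms(1) by (simp add: Gr_stratum_in_def)
qed

text \<open>When b vanishes at 0 and m, this is the coweight with partial sums b, which are also its
  coefficients in the simple coroots. At k = 0 the truncated subtraction gives 0.\<close>

definition coweight_of_sums :: "(nat \<Rightarrow> int) \<Rightarrow> nat \<Rightarrow> int" where
  "coweight_of_sums b k = b k - b (k - 1)"

lemma sum_coweight_of_sums: "(\<Sum>k=1..m. coweight_of_sums b k) = b m - b 0"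
  by (induction m) (auto simp: coweight_of_sums_def)

text \<open>As long as some partial sum exceeds \<open>l\<close>, it can be decreased by 1 at the first position
  where the partial sums are maximal.\<close>

lemma orbit_chain:
  assumes Z: "Gr_closed m Z" and "0 \<le> l" "b 0 = 0" "b m = 0" "\<And>k. k \<in> {1..<m} \<Longrightarrow> l \<le> b k"
    and "Gr_stratum_in m Z (coweight_of_sums b)"
  shows "Gr_stratum_in m Z (coweight_of_sums (\<lambda>k. if 1 \<le> k \<and> k < m then l else 0))"
  using assms(2-)
proof (induction "nat (\<Sum>k=1..<m. b k - l)" arbitrary: b rule: less_induct)
  case less
  show ?case
  proof (cases "\<forall>k\<in>{1..<m}. b k = l")
    case True
    then have "b k = (if 1 \<le> k \<and> k < m then l else 0)" if "k \<le> m" for k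
      using that less.prems(2,3) by (cases "k = 0"; cases "k = m") auto
    from this[of k for k] this[of "k - 1" for k] show ?thesis
      by (intro Gr_stratum_in_cong[OF less.prems(5)]) (auto simp: coweight_of_sums_def)
  next
    case False
    define M where "M = Max (b ` {1..<m})"
    have M: "b k \<le> M" if "k \<in> {1..<m}" for k using that by (simp add: M_def)
    obtain k0 where k0: "k0 \<in> {1..<m}" "b k0 \<noteq> l" using False by blast
    then have "l < M" using M[of k0] less.prems(4)[of k0] by simp
    have "M \<in> b ` {1..<m}" unfolding M_def by (rule Max_in) (use k0 in auto)
    then obtain k' where k': "k' \<in> {1..<m} \<and> b k' = M" by blast
    define k where "k = (LEAST k. k \<in> {1..<m} \<and> b k = M)"
    have k: "k \<in> {1..<m}" "b k = M" using LeastI[of "\<lambda>k. k \<in> {1..<m} \<and> b k = M", OF k'] by (simp_all add: k_def)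
    have "b (k - 1) < M"
    proof (cases "k = 1")
      case True then show ?thesis using less.prems(1,2) \<open>l < M\<close> by simp
    next
      case False
      then have 1: "k - 1 \<in> {1..<m}" using k by auto
      have "k - 1 < k" using k by auto
      then have "\<not> (k - 1 \<in> {1..<m} \<and> b (k - 1) = M)"
        unfolding k_def by (rule not_less_Least)
      with 1 have "k - 1 \<in> {1..<m}" "b (k - 1) \<noteq> M" by auto
      then show ?thesis using M[of "k - 1"] by simp
    qed
    moreover have "b (k + 1) \<le> M"
      using M[of "k + 1"] k less.prems(1,3) \<open>l < M\<close> by (cases "k + 1 = m") auto
    \<comment> \<open>Since the positive maximum is first reached at k, entry k is at least 1, while
      entry k + 1 is at most 0. So a move by 1 is allowed; it subtracts the k-th simple coroot and
      lowers \<open>b k\<close> alone.\<close>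
    ultimately have c: "1 \<le> coweight_of_sums b (k - 1 + 1) - coweight_of_sums b (k + 1)"
      using k by (simp add: coweight_of_sums_def)
    let ?b = "b(k := b k - 1)"
    have eq: "coweight_move (coweight_of_sums b) (k - 1) k 1 = coweight_of_sums ?b"
    proof
      fix r show "coweight_move (coweight_of_sums b) (k - 1) k 1 r = coweight_of_sums ?b r"
        using k by (cases "r = k"; cases "r = k + 1"; cases r) (auto simp: coweight_move_def coweight_of_sums_def)
    qed
    have "Gr_stratum_in m Z (coweight_of_sums ?b)"
      unfolding eq[symmetric]
      by (rule orbit_move[OF Z]) (use less.prems k c in \<open>auto simp: sum_coweight_of_sums[simplified]\<close>)
    moreover have "(\<Sum>r=1..<m. ?b r - l) < (\<Sum>r=1..<m. b r - l)"
      by (rule sum_strict_mono_ex1) (use k in auto)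
    moreover have "0 \<le> (\<Sum>r=1..<m. ?b r - l)"
      by (rule sum_nonneg) (use less.prems(4) k \<open>l < M\<close> in auto)
    ultimately show ?thesis
      by (intro less.hyps[of ?b]) (use less.prems k \<open>l < M\<close> in auto)
  qed
qed

definition root_coweight :: "nat \<Rightarrow> nat \<Rightarrow> int \<Rightarrow> nat \<Rightarrow> int" where
  "root_coweight p q l k = (if k = p + 1 then l else if k = q + 1 then - l else 0)"

lemma sum_root_coweight: "p < m \<Longrightarrow> q < m \<Longrightarrow> p \<noteq> q \<Longrightarrow> (\<Sum>k=1..m. root_coweight p q l k) = 0"
proof -
  assume a: "p < m" "q < m" "p \<noteq> q"
  have "root_coweight p q l k = (if k = p + 1 then l else 0) - (if k = q + 1 then l else 0)" for k
    using a by (auto simp: root_coweight_def)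
  then show ?thesis using a by (simp add: sum_subtractf)
qed

text \<open>A move by the full difference of two entries exchanges them. Exchanges with a zero entry
  relocate l or -l, and a move by 2 l exchanges these two.\<close>

lemma root_orbit_move:
  assumes Z: "Gr_closed m Z" and "0 \<le> l" and pq: "p < m" "q < m" "p \<noteq> q"
    and P: "Gr_stratum_in m Z (root_coweight p q l)"
  shows "p' < m \<Longrightarrow> p' \<noteq> q \<Longrightarrow> Gr_stratum_in m Z (root_coweight p' q l)"
    and "q' < m \<Longrightarrow> q' \<noteq> p \<Longrightarrow> Gr_stratum_in m Z (root_coweight p q' l)"
    and "Gr_stratum_in m Z (root_coweight q p l)"
proof -
  note move = orbit_move[OF Z sum_root_coweight[OF pq] P]
  show "Gr_stratum_in m Z (root_coweight p' q l)" if "p' < m" "p' \<noteq> q"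
  proof (cases "p' = p")
    case False
    have "coweight_move (root_coweight p q l) p p' l = root_coweight p' q l"
      using that pq False by (auto simp: coweight_move_def root_coweight_def)
    then show ?thesis using move[of p p' l] that pq False assms(2) by (simp add: root_coweight_def)
  qed (use P in simp)
  show "Gr_stratum_in m Z (root_coweight p q' l)" if "q' < m" "q' \<noteq> p"
  proof (cases "q' = q")
    case False
    have "coweight_move (root_coweight p q l) q' q l = root_coweight p q' l"
      using that pq False by (auto simp: coweight_move_def root_coweight_def)
    then show ?thesis using move[of q' q l] that pq False assms(2) by (simp add: root_coweight_def)
  qed (use P in simp)
  have "coweight_move (root_coweight p q l) p q (2 * l) = root_coweight q p l"
    using pq by (auto simp: coweight_move_def root_coweight_def)
  then show "Gr_stratum_in m Z (root_coweight q p l)"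
    using move[of p q "2 * l"] pq assms(2) by (simp add: root_coweight_def)
qed

text \<open>The line is itself a degeneration curve: the move by l from l (e_j - e_i) stops at the
  zero coweight, half way to the exchanged one, and its curve is 1 + s E_ij t^-l.\<close>

lemma addrow_mat_in_closure:
  assumes b: "b 0 = 0" "b m = 0" "\<And>k. k \<in> {1..<m} \<Longrightarrow> l \<le> b k" and "0 \<le> l"
    and ij: "i < m" "j < m" "i \<noteq> j"
  shows "addrow_mat m (fls_const s * fls_X powi (- l)) i j <#\<^bsub>SL m\<^esub> arc_group m
    \<in> Gr_orbit_closure m (coweight_of_sums b)"
proof -
  have "addrow_mat m (fls_const s * fls_X powi (- l)) i j <#\<^bsub>SL m\<^esub> arc_group m \<in> Z"
    if Z: "Gr_closed m Z" "Gr_orbit m (coweight_of_sums b) \<subseteq> Z" for Z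
  proof -
    have "Gr_stratum_in m Z (coweight_of_sums b)"
      using Z(2) by (auto simp: Gr_orbit_def Gr_stratum_in_def)
    then have "Gr_stratum_in m Z (coweight_of_sums (\<lambda>k. if 1 \<le> k \<and> k < m then l else 0))"
      by (intro orbit_chain[OF Z(1) assms(4) b(1,2)] b(3))
    \<comment> \<open>When all partial sums strictly between the ends equal l, only the entry l at
      the first and -l at the last position remain.\<close>
    then have P: "Gr_stratum_in m Z (root_coweight 0 (m - 1) l)"
      by (rule Gr_stratum_in_cong) (use ij in \<open>auto simp: coweight_of_sums_def root_coweight_def\<close>)
    have m: "0 < m" "m - 1 < m" "0 \<noteq> m - 1" using ij by auto
    note mv = root_orbit_move[OF Z(1) assms(4)]
    have "Gr_stratum_in m Z (root_coweight j i l)"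
    \<comment> \<open>Relocating l from position 0 to j must avoid m - 1, where -l sits. If j is m -
      1, the exchange of l and -l has already put l there.\<close>
    proof (cases "j = m - 1")
      case False
      then have "Gr_stratum_in m Z (root_coweight j (m - 1) l)" using mv(1)[OF m P] ij by blast
      then show ?thesis using mv(2)[OF ij(2) m(2) False] ij by blast
    next
      case True
      have "Gr_stratum_in m Z (root_coweight (m - 1) 0 l)" by (rule mv(3)[OF m P])
      then show ?thesis using mv(2)[OF m(2,1) m(3)[symmetric]] ij True by blast
    qed
    from orbit_move_curve[OF Z(1) sum_root_coweight[OF ij(2,1) ij(3)[symmetric]] this ij(2,1) ij(3)[symmetric],
        of l "1\<^sub>m m" s]
    have "(1\<^sub>m m * (t_pow m (coweight_move (root_coweight j i l) j i l) *
      addrow_mat m (fls_const s * fls_X powi (- l)) i j)) <#\<^bsub>SL m\<^esub> arc_group m \<in> Z"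
      using arc_group_one assms(4) ij by (simp add: root_coweight_def del: fls_X_power_int)
    moreover have "coweight_move (root_coweight j i l) j i l = (\<lambda>_. 0)"
      using ij by (auto simp: coweight_move_def root_coweight_def)
    moreover have "t_pow m (\<lambda>_. 0) = 1\<^sub>m m" by (rule eq_matI) (auto simp: t_pow_def)
    ultimately show ?thesis by simp
  qed
  then show ?thesis unfolding Gr_orbit_closure_def hull_def by blast
qed

section \<open>Points of the slice\<close>

definition laurent_poly :: "'a::zero fls \<Rightarrow> bool" where
  "laurent_poly f \<longleftrightarrow> finite {k. fls_nth f k \<noteq> 0}"

lemma laurent_polyI: "{k. fls_nth f k \<noteq> 0} \<subseteq> S \<Longrightarrow> finite S \<Longrightarrow> laurent_poly f"
  unfolding laurent_poly_def by (rule finite_subset)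

text \<open>Finite support bounds the reversed coefficients from below, so \<open>Abs_fls\<close>
  returns a series that really has them.\<close>

lemma fls_flip_nth:
  assumes "laurent_poly f"
  shows "fls_nth (fls_flip f) k = fls_nth f (- k)"
proof -
  have "finite {k. fls_nth f k \<noteq> 0}" using assms by (simp add: laurent_poly_def)
  then obtain B where B: "\<forall>k\<in>{k. fls_nth f k \<noteq> 0}. k \<le> B" using bdd_above_finite unfolding bdd_above_def by blast
  have "fls_nth f (- k) = 0" if "k < - B" for k using B that by force
  then show ?thesis unfolding fls_flip_def by (intro nth_Abs_fls_lower_bound[of "- B"]) auto
qed

lemma laurent_poly_const: "laurent_poly (fls_const c)"
  by (rule laurent_polyI[where S = "{0}"]) auto

lemma laurent_poly_X_powi: "laurent_poly (fls_X powi k :: complex fls)"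
  by (rule laurent_polyI[where S = "{k}"]) auto

lemma laurent_poly_fps_of_poly: "laurent_poly (fps_to_fls (fps_of_poly p))"
proof (rule laurent_polyI[where S = "int ` {..degree p}"])
  show "{k. fls_nth (fps_to_fls (fps_of_poly p)) k \<noteq> 0} \<subseteq> int ` {..degree p}"
  proof
    fix k assume "k \<in> {k. fls_nth (fps_to_fls (fps_of_poly p)) k \<noteq> 0}"
    then have "0 \<le> k" "coeff p (nat k) \<noteq> 0" by (auto split: if_splits)
    then show "k \<in> int ` {..degree p}" using le_degree by (intro image_eqI[of _ _ "nat k"]) auto
  qed
qed simp

lemma laurent_poly_add:
  fixes f g :: "'a::comm_ring_1 fls"
  assumes "laurent_poly f" "laurent_poly g"
  shows "laurent_poly (f + g)"
  by (rule laurent_polyI[where S = "{k. fls_nth f k \<noteq> 0} \<union> {k. fls_nth g k \<noteq> 0}"])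
    (use assms in \<open>auto simp: laurent_poly_def\<close>)

lemma laurent_poly_mult:
  fixes f g :: "'a::comm_ring_1 fls"
  assumes "laurent_poly f" "laurent_poly g"
  shows "laurent_poly (f * g)"
proof -
  let ?S = "\<lambda>f::'a fls. {k. fls_nth f k \<noteq> 0}"
  show ?thesis
  proof (rule laurent_polyI[where S = "(\<lambda>(i, j). i + j) ` (?S f \<times> ?S g)"])
    show "?S (f * g) \<subseteq> (\<lambda>(i, j). i + j) ` (?S f \<times> ?S g)"
    proof
      fix n assume "n \<in> ?S (f * g)"
      then have "(\<Sum>i\<in>?S f. fls_nth f i * fls_nth g (n - i)) \<noteq> 0"
        by (subst (asm) mem_Collect_eq, subst (asm) fls_times_nth_finite[of "?S f"])
          (use assms(1) in \<open>auto simp: laurent_poly_def\<close>)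
      then obtain i where "fls_nth f i * fls_nth g (n - i) \<noteq> 0" by (meson sum.neutral)
      then have "fls_nth f i \<noteq> 0" "fls_nth g (n - i) \<noteq> 0" by auto
      then show "n \<in> (\<lambda>(i, j). i + j) ` (?S f \<times> ?S g)" by (intro image_eqI[of _ _ "(i, n - i)"]) auto
    qed
  qed (use assms in \<open>auto simp: laurent_poly_def\<close>)
qed

lemma laurent_poly_sum:
  fixes f :: "'b \<Rightarrow> 'a::comm_ring_1 fls"
  shows "(\<And>s. s \<in> S \<Longrightarrow> laurent_poly (f s)) \<Longrightarrow> laurent_poly (sum f S)"
  by (induction S rule: infinite_finite_induct) (auto intro: laurent_poly_add laurent_poly_const[of 0, simplified])

lemma laurent_poly_prod:
  fixes f :: "'b \<Rightarrow> 'a::comm_ring_1 fls"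
  shows "(\<And>s. s \<in> S \<Longrightarrow> laurent_poly (f s)) \<Longrightarrow> laurent_poly (prod f S)"
  by (induction S rule: infinite_finite_induct) (auto intro: laurent_poly_mult laurent_poly_const[of 1, simplified])

text \<open>For a Laurent polynomial the convolution is a finite sum over its support, and negating
  the indices carries one expansion into the other.\<close>

lemma fls_flip_mult:
  assumes "laurent_poly f" "laurent_poly g"
  shows "fls_flip (f * g) = fls_flip f * fls_flip g"
proof (rule fls_eqI)
  fix n
  let ?S = "{k. fls_nth f k \<noteq> 0}"
  have fin: "finite ?S" using assms(1) by (simp add: laurent_poly_def)
  have "fls_nth (fls_flip (f * g)) n = fls_nth (f * g) (- n)"
    by (rule fls_flip_nth[OF laurent_poly_mult[OF assms]])
  also have "\<dots> = (\<Sum>i\<in>?S. fls_nth f i * fls_nth g (- n - i))"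
    by (rule fls_times_nth_finite[OF fin]) auto
  also have "\<dots> = (\<Sum>i\<in>uminus ` ?S. fls_nth (fls_flip f) i * fls_nth (fls_flip g) (n - i))"
    by (simp add: sum.reindex fls_flip_nth assms minus_diff_commute)
  also have "\<dots> = fls_nth (fls_flip f * fls_flip g) n"
  proof (rule fls_times_nth_finite[symmetric])
    show "{i. fls_nth (fls_flip f) i * fls_nth (fls_flip g) (n - i) \<noteq> 0} \<subseteq> uminus ` ?S"
    proof
      fix i assume "i \<in> {i. fls_nth (fls_flip f) i * fls_nth (fls_flip g) (n - i) \<noteq> 0}"
      then show "i \<in> uminus ` ?S" by (intro image_eqI[of _ _ "- i"]) (auto simp: fls_flip_nth assms)
    qed
  qed (use fin in simp)
  finally show "fls_nth (fls_flip (f * g)) n = fls_nth (fls_flip f * fls_flip g) n" .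
qed

lemma fls_flip_sum:
  assumes "\<And>s. s \<in> S \<Longrightarrow> laurent_poly (f s)"
  shows "fls_flip (sum f S) = (\<Sum>s\<in>S. fls_flip (f s))"
  by (rule fls_eqI) (simp add: fls_flip_nth laurent_poly_sum assms fls_sum_nth)

lemma fls_flip_const [simp]: "fls_flip (fls_const c) = fls_const c"
  by (rule fls_eqI) (simp add: fls_flip_nth laurent_poly_const)

lemma fls_flip_0_1 [simp]: "fls_flip 0 = 0" "fls_flip 1 = 1"
  using fls_flip_const[of 0] fls_flip_const[of 1] by simp_all

definition laurent_poly_mat :: "nat \<Rightarrow> complex fls mat \<Rightarrow> bool" where
  "laurent_poly_mat m g \<longleftrightarrow> g \<in> carrier_mat m m \<and> (\<forall>i<m. \<forall>j<m. laurent_poly (g $$ (i, j)))"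

lemma laurent_poly_group_iff: "g \<in> laurent_poly_group m \<longleftrightarrow> g \<in> carrier (SL m) \<and> laurent_poly_mat m g"
  by (auto simp: laurent_poly_group_def laurent_poly_mat_def laurent_poly_def)

lemma laurent_poly_mat_mult:
  assumes "laurent_poly_mat m g" "laurent_poly_mat m h"
  shows "laurent_poly_mat m (g * h)"
    and "map_mat fls_flip (g * h) = map_mat fls_flip g * map_mat fls_flip h"
proof -
  have c: "g \<in> carrier_mat m m" "h \<in> carrier_mat m m" using assms by (auto simp: laurent_poly_mat_def)
  have l: "laurent_poly (g $$ (i, k))" "laurent_poly (h $$ (i, k))" if "i < m" "k < m" for i k
    using that assms by (auto simp: laurent_poly_mat_def)
  show "laurent_poly_mat m (g * h)"
    using c l by (auto simp: laurent_poly_mat_def mat_mult_entry[OF c] simp del: index_mult_mat(1)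
        intro!: laurent_poly_sum laurent_poly_mult)
  show "map_mat fls_flip (g * h) = map_mat fls_flip g * map_mat fls_flip h"
  proof (rule eq_matI)
    fix i j assume "i < dim_row (map_mat fls_flip g * map_mat fls_flip h)" "j < dim_col (map_mat fls_flip g * map_mat fls_flip h)"
    then have ij: "i < m" "j < m" using c by auto
    have "map_mat fls_flip (g * h) $$ (i, j) = fls_flip ((g * h) $$ (i, j))" using c ij by simp
    also have "\<dots> = (\<Sum>k<m. fls_flip (g $$ (i, k)) * fls_flip (h $$ (k, j)))"
      unfolding mat_mult_entry[OF c ij] using l ij
      by (subst fls_flip_sum) (auto intro!: sum.cong laurent_poly_mult fls_flip_mult)
    also have "\<dots> = (\<Sum>k<m. map_mat fls_flip g $$ (i, k) * map_mat fls_flip h $$ (k, j))"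
      using c ij by (intro sum.cong) auto
    also have "\<dots> = (map_mat fls_flip g * map_mat fls_flip h) $$ (i, j)"
      by (rule mat_mult_entry[symmetric]) (use c ij in auto)
    finally show "map_mat fls_flip (g * h) $$ (i, j) = (map_mat fls_flip g * map_mat fls_flip h) $$ (i, j)" .
  qed (use c in auto)
qed

lemma laurent_poly_of_int: "laurent_poly (of_int k :: complex fls)"
  using laurent_poly_const[of "of_int k :: complex"] by (simp add: fls_of_int)

lemma laurent_poly_mat_adj_mat:
  assumes "laurent_poly_mat m g"
  shows "laurent_poly_mat m (adj_mat g)"
proof -
  have g: "g \<in> carrier_mat m m" using assms by (simp add: laurent_poly_mat_def)
  have "laurent_poly (det (mat_delete g j i))" if "i < m" "j < m" for i j
    unfolding det_def'[OF mat_delete_carrier[OF g]]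
  proof (intro laurent_poly_sum laurent_poly_mult laurent_poly_prod laurent_poly_of_int)
    fix p r assume "p \<in> {p. p permutes {0..<m - 1}}" "r \<in> {0..<m - 1}"
    then have "p r \<in> {0..<m - 1}" "r \<in> {0..<m - 1}" using permutes_in_image[of p "{0..<m - 1}" r] by blast+
    then show "laurent_poly (mat_delete g j i $$ (r, p r))"
      using assms that unfolding laurent_poly_mat_def mat_delete_def by auto
  qed
  moreover have "laurent_poly ((- 1 :: complex fls) ^ k)" for k
    using laurent_poly_of_int[of "(-1) ^ k"] by simp
  ultimately show ?thesis
    using g by (auto simp: laurent_poly_mat_def adj_mat_def cofactor_def intro!: laurent_poly_mult)
qed

lemma fps_of_poly_hom: "comm_ring_hom (fps_of_poly :: complex poly \<Rightarrow> _)"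
  by unfold_locales (auto simp: fps_of_poly_add fps_of_poly_mult)

lemma neg_loop_group_iff:
  "M \<in> neg_loop_group m \<longleftrightarrow> M \<in> carrier (SL m) \<and> map_mat (\<lambda>f. fps_nth f 0) M = 1\<^sub>m m"
  by (auto simp: neg_loop_group_def kernel_def)

text \<open>The representative \<open>h\<close> of the definition can be multiplied by an element of \<open>G[t]\<close> so that
  it becomes \<open>M\<close> itself.\<close>

lemma slice_iff:
  "M \<in> slice m lam \<longleftrightarrow> M \<in> neg_loop_group m \<and>
     (\<exists>g\<in>laurent_poly_group m. g <#\<^bsub>SL m\<^esub> arc_group m \<in> Gr_orbit_closure m lam \<and>
        map_mat fps_to_fls M = map_mat fls_flip g)" (is "?L \<longleftrightarrow> ?R")
proof
  assume ?R then show ?L unfolding slice_def by (auto simp del: SL_simps)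
next
  assume ?L
  then obtain h where M: "M \<in> neg_loop_group m" and h: "h \<in> laurent_poly_group m"
    and cl: "h <#\<^bsub>SL m\<^esub> arc_group m \<in> Gr_orbit_closure m lam"
    and eq: "map_mat fps_to_fls M <#\<^bsub>SL m\<^esub> poly_group m = map_mat fls_flip h <#\<^bsub>SL m\<^esub> poly_group m"
    unfolding slice_def by blast
  have Mc: "M \<in> carrier_mat m m" using M by (simp add: neg_loop_group_iff)
  have hS: "h \<in> carrier (SL m)" "laurent_poly_mat m h" using h by (auto simp: laurent_poly_group_iff)
  have "1\<^sub>m m \<in> poly_group m"
    unfolding poly_group_def by (rule image_eqI[of _ _ "1\<^sub>m m"]) (auto intro!: eq_matI)
  then have "map_mat fps_to_fls M \<in> map_mat fps_to_fls M <#\<^bsub>SL m\<^esub> poly_group m"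
    unfolding l_coset_SL by (rule rev_image_eqI) (use Mc in simp)
  then obtain P where P: "P \<in> carrier (SL m)"
    "map_mat fps_to_fls M = map_mat fls_flip h * map_mat (\<lambda>p. fls_flip (fps_to_fls (fps_of_poly p))) P"
    unfolding eq unfolding l_coset_SL poly_group_def by auto
  \<comment> \<open>The coset equality gives \<open>P\<close> in \<open>G[t]\<close> such that M is
    h P expanded in t^-1. Read in t, the same polynomial matrix is an arc, so h P represents the
    same point of the Grassmannian as h.\<close>
  define Q where "Q = map_mat fps_to_fls (map_mat fps_of_poly P)"
  have Q: "Q \<in> arc_group m" unfolding Q_def
    by (rule arc_groupI[OF comm_ring_hom.hom_SL[OF fps_of_poly_hom P(1)] refl])
  have lQ: "laurent_poly_mat m Q"
    using P(1) by (auto simp: Q_def laurent_poly_mat_def laurent_poly_fps_of_poly)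
  have QS: "Q \<in> carrier (SL m)" using Q arc_group_subset by blast
  have "map_mat fls_flip (h * Q) = map_mat fps_to_fls M"
    unfolding laurent_poly_mat_mult(2)[OF hS(2) lQ] P(2) by (rule arg_cong[of _ _ "(*) _"]) (auto simp: Q_def)
  moreover have "h * Q \<in> laurent_poly_group m"
    using laurent_poly_mat_mult(1)[OF hS(2) lQ] SL_mult_closed[OF hS(1) QS] by (simp add: laurent_poly_group_iff)
  moreover have "(h * Q) <#\<^bsub>SL m\<^esub> arc_group m \<in> Gr_orbit_closure m lam"
    using cl arc_coset_mult[OF hS(1) Q] by simp
  ultimately show ?R using M by auto
qed

text \<open>The exchange of expansions is multiplicative on Laurent polynomials, so it carries the
  inverse to a left inverse. In this way a pole bound on the inverse of g becomes a degree bound on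
  the inverse of M.\<close>

lemma flip_adj_mat:
  assumes "g \<in> laurent_poly_group m" "map_mat fls_flip g \<in> carrier (SL m)"
  shows "map_mat fls_flip (adj_mat g) = adj_mat (map_mat fls_flip g)"
proof (rule SL_inverse_unique[OF assms(2)])
  have g: "g \<in> carrier (SL m)" "laurent_poly_mat m g" using assms by (auto simp: laurent_poly_group_iff)
  show "map_mat fls_flip (adj_mat g) \<in> carrier_mat m m" using SL_adj_mat(1)[OF g(1)] by simp
  show "map_mat fls_flip (adj_mat g) * map_mat fls_flip g = 1\<^sub>m m"
    unfolding laurent_poly_mat_mult(2)[OF laurent_poly_mat_adj_mat[OF g(2)] g(2), symmetric]
      SL_adj_mat(3)[OF g(1)] by (rule eq_matI) auto
qed

text \<open>The coefficients of M at powers of t^-1 are those of a loop in the closure, so its pole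
  bound in t is a degree bound in t^-1.\<close>

lemma slice_nth_eq_0:
  assumes "(\<Sum>k=1..m. lam k) = 0" "\<And>k. k \<in> {1..m} \<Longrightarrow> - int K \<le> lam k"
    and "M \<in> slice m lam" "i < m" "j < m" "K < l"
  shows "fps_nth (M $$ (i, j)) l = 0"
proof -
  obtain g where g: "g \<in> laurent_poly_group m" "g <#\<^bsub>SL m\<^esub> arc_group m \<in> Gr_orbit_closure m lam"
    "map_mat fps_to_fls M = map_mat fls_flip g" and M: "M \<in> neg_loop_group m"
    using assms(3) unfolding slice_iff by blast
  have gS: "g \<in> carrier (SL m)" "laurent_poly_mat m g" using g by (auto simp: laurent_poly_group_iff)
  have "map_mat fps_to_fls M $$ (i, j) = map_mat fls_flip g $$ (i, j)" by (simp only: g(3))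
  then have "fps_to_fls (M $$ (i, j)) = fls_flip (g $$ (i, j))"
    using M gS(1) assms(4,5) by (auto simp: neg_loop_group_iff)
  then have "fls_nth (fps_to_fls (M $$ (i, j))) (int l) = fls_nth (g $$ (i, j)) (- int l)"
    using fls_flip_nth[of "g $$ (i, j)"] gS(2) assms(4,5) by (simp add: laurent_poly_mat_def)
  moreover have "fls_nth (g $$ (i, j)) (- int l) = 0"
    using closure_pole_bounded[OF assms(1,2) gS(1) g(2)] assms(4-6) by (simp add: pole_bounded_def)
  ultimately show ?thesis by simp
qed

lemma slice_adj_mat_nth_eq_0:
  assumes "(\<Sum>k=1..m. lam k) = 0" "\<And>k. k \<in> {1..m} \<Longrightarrow> lam k \<le> int K"
    and "M \<in> slice m lam" "i < m" "j < m" "K < l"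
  shows "fps_nth (adj_mat M $$ (i, j)) l = 0"
proof -
  obtain g where g: "g \<in> laurent_poly_group m" "g <#\<^bsub>SL m\<^esub> arc_group m \<in> Gr_orbit_closure m lam"
    "map_mat fps_to_fls M = map_mat fls_flip g" and M: "M \<in> neg_loop_group m"
    using assms(3) unfolding slice_iff by blast
  have gS: "g \<in> carrier (SL m)" "laurent_poly_mat m g" using g by (auto simp: laurent_poly_group_iff)
  have MS: "M \<in> carrier (SL m)" using M by (simp add: neg_loop_group_iff)
  have *: "map_mat fps_to_fls (adj_mat M) = map_mat fls_flip (adj_mat g)"
    using flip_adj_mat[OF g(1)] comm_ring_hom.hom_SL[OF fps_to_fls_hom MS]
      comm_ring_hom.hom_adj_mat[OF fps_to_fls_hom MS] g(3) by metis
  have "map_mat fps_to_fls (adj_mat M) $$ (i, j) = map_mat fls_flip (adj_mat g) $$ (i, j)" by (simp only: *)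
  then have "fps_to_fls (adj_mat M $$ (i, j)) = fls_flip (adj_mat g $$ (i, j))"
    using SL_adj_mat(1)[OF MS] SL_adj_mat(1)[OF gS(1)] assms(4,5) by auto
  then have "fls_nth (fps_to_fls (adj_mat M $$ (i, j))) (int l) = fls_nth (adj_mat g $$ (i, j)) (- int l)"
    using fls_flip_nth[of "adj_mat g $$ (i, j)"] laurent_poly_mat_adj_mat[OF gS(2)] assms(4,5)
    by (simp add: laurent_poly_mat_def)
  moreover have "fls_nth (adj_mat g $$ (i, j)) (- int l) = 0"
    using closure_adj_pole_bounded[OF assms(1,2) gS(1) g(2)] assms(4-6) by (simp add: pole_bounded_def)
  ultimately show ?thesis by simp
qed

section \<open>Conjugation by the torus\<close>

lemma torus_adj_mat:
  assumes "\<tau> \<in> torus m"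
  shows "adj_mat \<tau> \<in> torus m" and "i < m \<Longrightarrow> \<tau> $$ (i, i) \<noteq> 0"
    and "i < m \<Longrightarrow> adj_mat \<tau> $$ (i, i) = inverse (\<tau> $$ (i, i))"
    and "inv\<^bsub>SL m\<^esub> \<tau> = adj_mat \<tau>" "adj_mat (adj_mat \<tau>) = \<tau>"
proof -
  have \<tau>: "\<tau> \<in> carrier (SL m)" "diagonal_mat \<tau>" using assms by (auto simp: torus_def)
  have c: "\<tau> \<in> carrier_mat m m" "adj_mat \<tau> \<in> carrier_mat m m" using \<tau>(1) SL_adj_mat(1)[OF \<tau>(1)] by auto
  have e: "\<tau> $$ (i, i) * adj_mat \<tau> $$ (i, j) = (if i = j then 1 else 0)" if "i < m" "j < m" for i j
  proof -
    have "(\<tau> * adj_mat \<tau>) $$ (i, j) = (\<Sum>k<m. if k = i then \<tau> $$ (i, i) * adj_mat \<tau> $$ (i, j) else 0)"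
      unfolding mat_mult_entry[OF c that]
      by (rule sum.cong) (use \<tau>(2) c that in \<open>auto simp: diagonal_mat_def\<close>)
    then show ?thesis using SL_adj_mat(2)[OF \<tau>(1)] that by simp
  qed
  show nz: "\<tau> $$ (i, i) \<noteq> 0" if "i < m" for i using e[OF that that] by auto
  show "adj_mat \<tau> $$ (i, i) = inverse (\<tau> $$ (i, i))" if "i < m" for i
    using e[OF that that] nz[OF that] by (simp add: field_simps)
  have "adj_mat \<tau> $$ (i, j) = 0" if "i < m" "j < m" "i \<noteq> j" for i j
    using e[OF that(1,2)] nz[OF that(1)] that(3) by simp
  then show "adj_mat \<tau> \<in> torus m"
    using SL_adj_mat(1)[OF \<tau>(1)] c by (auto simp: torus_def diagonal_mat_def)
  show "inv\<^bsub>SL m\<^esub> \<tau> = adj_mat \<tau>" by (rule SL_inv_eq_adj_mat[OF \<tau>(1)])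
  show "adj_mat (adj_mat \<tau>) = \<tau>"
    using SL_inverse_unique[OF SL_adj_mat(1)[OF \<tau>(1)] c(1) SL_adj_mat(2)[OF \<tau>(1)]] by simp
qed

lemma diagonal_conj_index:
  assumes "A \<in> carrier_mat m m" "D \<in> carrier_mat m m" "E \<in> carrier_mat m m"
    "diagonal_mat D" "diagonal_mat E" "i < m" "j < m"
  shows "(D * A * E) $$ (i, j) = D $$ (i, i) * A $$ (i, j) * E $$ (j, j)"
proof -
  have DA: "D * A \<in> carrier_mat m m" using assms by simp
  have "(D * A * E) $$ (i, j) = (\<Sum>k<m. if k = j then (D * A) $$ (i, j) * E $$ (j, j) else 0)"
    unfolding mat_mult_entry[OF DA assms(3,6,7)]
    by (rule sum.cong) (use assms in \<open>auto simp: diagonal_mat_def simp del: index_mult_mat(1)\<close>)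
  moreover have "(D * A) $$ (i, j) = (\<Sum>k<m. if k = i then D $$ (i, i) * A $$ (i, j) else 0)"
    unfolding mat_mult_entry[OF assms(2,1,6,7)]
    by (rule sum.cong) (use assms in \<open>auto simp: diagonal_mat_def\<close>)
  ultimately show ?thesis using assms by simp
qed

lemma fps_const_hom: "comm_ring_hom (fps_const :: complex \<Rightarrow> _)"
  by unfold_locales auto

lemma torus_conj_index:
  assumes "\<tau> \<in> torus m" "M \<in> carrier_mat m m" "i < m" "j < m"
  shows "torus_conj m \<tau> M $$ (i, j) = fps_const (\<tau> $$ (i, i) * inverse (\<tau> $$ (j, j))) * M $$ (i, j)"
proof -
  have "\<tau> \<in> carrier_mat m m" "adj_mat \<tau> \<in> carrier_mat m m" "diagonal_mat \<tau>" "diagonal_mat (adj_mat \<tau>)"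
    using assms(1) torus_adj_mat(1)[OF assms(1)] by (auto simp: torus_def)
  then show ?thesis unfolding torus_conj_def torus_adj_mat(4)[OF assms(1)]
    using assms torus_adj_mat(3)[OF assms(1)]
    by (subst diagonal_conj_index[of _ m]) (auto simp: diagonal_mat_def algebra_simps simp flip: fps_const_mult)
qed

text \<open>Of the two factors of the conjugation, the left one preserves the closure and the right
  one is an arc, which disappears in the coset. Both are constant and hence the same in either
  expansion.\<close>

lemma slice_torus_stable:
  assumes "(\<Sum>k=1..m. lam k) = 0" "\<tau> \<in> torus m" "M \<in> slice m lam"
  shows "torus_conj m \<tau> M \<in> slice m lam"
proof -
  obtain g where g: "g \<in> laurent_poly_group m" "g <#\<^bsub>SL m\<^esub> arc_group m \<in> Gr_orbit_closure m lam"
    "map_mat fps_to_fls M = map_mat fls_flip g" and M: "M \<in> neg_loop_group m"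
    using assms(3) unfolding slice_iff by blast
  have gS: "g \<in> carrier (SL m)" "laurent_poly_mat m g" using g by (auto simp: laurent_poly_group_iff)
  have MS: "M \<in> carrier (SL m)" using M by (simp add: neg_loop_group_iff)
  have \<tau>: "\<tau> \<in> carrier (SL m)" "adj_mat \<tau> \<in> carrier (SL m)"
    using assms(2) torus_adj_mat(1)[OF assms(2)] by (auto simp: torus_def)
  let ?C = "map_mat fls_const"
  let ?g = "?C \<tau> * g * ?C (adj_mat \<tau>)"
  have CS: "?C \<tau> \<in> carrier (SL m)" "?C (adj_mat \<tau>) \<in> carrier (SL m)"
    by (intro comm_ring_hom.hom_SL[OF fls_const_hom] \<tau>)+
  have CA: "?C (adj_mat \<tau>) \<in> arc_group m"
    by (rule arc_groupI[OF comm_ring_hom.hom_SL[OF fps_const_hom \<tau>(2)]]) auto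
  have lC: "laurent_poly_mat m (?C \<tau>)" "laurent_poly_mat m (?C (adj_mat \<tau>))"
    using \<tau> by (auto simp: laurent_poly_mat_def laurent_poly_const)
  have fC: "map_mat fls_flip (?C A) = map_mat fps_to_fls (map_mat fps_const A)" for A
    by (rule eq_matI) auto
  have "map_mat fls_flip ?g = map_mat fls_flip (?C \<tau>) * map_mat fls_flip g * map_mat fls_flip (?C (adj_mat \<tau>))"
    unfolding laurent_poly_mat_mult(2)[OF laurent_poly_mat_mult(1)[OF lC(1) gS(2)] lC(2)]
      laurent_poly_mat_mult(2)[OF lC(1) gS(2)] ..
  also have "\<dots> = map_mat fps_to_fls (torus_conj m \<tau> M)"
  proof -
    interpret comm_ring_hom "fps_to_fls :: complex fps \<Rightarrow> _" by (rule fps_to_fls_hom)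
    have c: "map_mat fps_const \<tau> \<in> carrier_mat m m" "M \<in> carrier_mat m m"
      "map_mat fps_const (adj_mat \<tau>) \<in> carrier_mat m m" using \<tau> MS by auto
    show ?thesis unfolding torus_conj_def torus_adj_mat(4)[OF assms(2)] fC g(3)[symmetric]
      mat_hom_mult[OF mult_carrier_mat[OF c(1,2)] c(3)] mat_hom_mult[OF c(1,2)] ..
  qed
  finally have eq: "map_mat fps_to_fls (torus_conj m \<tau> M) = map_mat fls_flip ?g" ..
  have "?g \<in> laurent_poly_group m"
    unfolding laurent_poly_group_iff by (intro conjI SL_mult_closed CS gS laurent_poly_mat_mult(1) lC)
  moreover have "?g <#\<^bsub>SL m\<^esub> arc_group m \<in> Gr_orbit_closure m lam"
    using arc_coset_mult[OF SL_mult_closed[OF CS(1) gS(1)] CA]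
      closure_torus_stable[OF assms(1,2) gS(1) g(2)] by simp
  moreover have "torus_conj m \<tau> M \<in> neg_loop_group m"
    unfolding neg_loop_group_iff
  proof
    show "torus_conj m \<tau> M \<in> carrier (SL m)"
      unfolding torus_conj_def torus_adj_mat(4)[OF assms(2)]
      by (intro SL_mult_closed MS comm_ring_hom.hom_SL[OF fps_const_hom] \<tau>)
    then have c: "torus_conj m \<tau> M \<in> carrier_mat m m" by simp
    show "map_mat (\<lambda>f. fps_nth f 0) (torus_conj m \<tau> M) = 1\<^sub>m m"
    proof (rule eq_matI)
      fix i j assume "i < dim_row (1\<^sub>m m :: complex mat)" "j < dim_col (1\<^sub>m m :: complex mat)"
      then have ij: "i < m" "j < m" by auto
      have "fps_nth (M $$ (i, j)) 0 = map_mat (\<lambda>f. fps_nth f 0) M $$ (i, j)" using MS ij by auto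
      also have "\<dots> = (1\<^sub>m m :: complex mat) $$ (i, j)" using M by (simp add: neg_loop_group_iff)
      finally show "map_mat (\<lambda>f. fps_nth f 0) (torus_conj m \<tau> M) $$ (i, j) = 1\<^sub>m m $$ (i, j)"
        using c ij MS torus_adj_mat(2)[OF assms(2)] by (auto simp: torus_conj_index[OF assms(2)])
    qed (use c in auto)
  qed
  ultimately show ?thesis unfolding slice_iff using eq by blast
qed

text \<open>The variable of the power series is t^-1, so the line carries the exponent l here and -l
  as a loop in t. That l is at least 1 keeps the constant term equal to the identity.\<close>

lemma addrow_mat_in_slice:
  assumes b: "b 0 = 0" "b m = 0" "\<And>k. k \<in> {1..<m} \<Longrightarrow> int l \<le> b k"
    and ij: "i < m" "j < m" "i \<noteq> j" and "1 \<le> l"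
  shows "addrow_mat m (fps_const s * fps_X ^ l) i j \<in> slice m (coweight_of_sums b)"
proof -
  let ?M = "addrow_mat m (fps_const s * fps_X ^ l) i j"
  let ?g = "addrow_mat m (fls_const s * fls_X powi (- int l)) i j"
  have lp: "laurent_poly (fls_const s * fls_X powi (- int l))"
    by (intro laurent_poly_mult laurent_poly_const laurent_poly_X_powi)
  have "laurent_poly_mat m ?g"
    unfolding laurent_poly_mat_def
    using lp laurent_poly_const[of 0] laurent_poly_const[of 1] ij
    by (auto simp: addrow_mat_index simp del: fls_X_power_int)
  then have "?g \<in> laurent_poly_group m" using addrow_mat_SL[OF ij(3)] by (simp add: laurent_poly_group_iff)
  moreover have "?g <#\<^bsub>SL m\<^esub> arc_group m \<in> Gr_orbit_closure m (coweight_of_sums b)"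
    by (rule addrow_mat_in_closure) (use b ij in auto)
  moreover have "?M \<in> neg_loop_group m"
    unfolding neg_loop_group_iff using addrow_mat_SL[OF ij(3)] \<open>1 \<le> l\<close>
    by (auto intro!: eq_matI simp: addrow_mat_index)
  moreover have "map_mat fps_to_fls ?M = map_mat fls_flip ?g"
  proof (rule eq_matI)
    have "fps_to_fls (fps_const s * fps_X ^ l) = fls_flip (fls_const s * fls_X powi (- int l))"
      by (rule fls_eqI) (use lp \<open>1 \<le> l\<close> in \<open>auto simp: fls_flip_nth\<close>)
    then show "map_mat fps_to_fls ?M $$ (p, q) = map_mat fls_flip ?g $$ (p, q)"
      if "p < dim_row (map_mat fls_flip ?g)" "q < dim_col (map_mat fls_flip ?g)" for p q
      using that ij by (auto simp: addrow_mat_index addrow_mat_def simp del: fls_X_power_int)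
  qed (auto simp: addrow_mat_def)
  ultimately show ?thesis unfolding slice_iff by blast
qed

text \<open>The chain of moves with target l = 0 ends at the zero coweight, so the base point lies
  in the closure.\<close>

lemma one_in_slice:
  assumes "b 0 = 0" "b m = 0" "\<And>k. k \<in> {1..<m} \<Longrightarrow> 0 \<le> b k"
  shows "1\<^sub>m m \<in> slice m (coweight_of_sums b)"
proof -
  let ?lam = "coweight_of_sums b"
  have "1\<^sub>m m <#\<^bsub>SL m\<^esub> arc_group m \<in> Z" if Z: "Gr_closed m Z" "Gr_orbit m ?lam \<subseteq> Z" for Z
  proof -
    have "Gr_stratum_in m Z ?lam"
      using Z(2) by (auto simp: Gr_orbit_def Gr_stratum_in_def)
    then have "Gr_stratum_in m Z (coweight_of_sums (\<lambda>k. if 1 \<le> k \<and> k < m then 0 else 0))"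
      using assms by (intro orbit_chain[OF Z(1), of 0 b]) auto
    then have "Gr_stratum_in m Z (\<lambda>_. 0)"
      by (rule Gr_stratum_in_cong) (auto simp: coweight_of_sums_def)
    moreover have "t_pow m (\<lambda>_. 0) = 1\<^sub>m m" by (rule eq_matI) (auto simp: t_pow_def)
    ultimately show ?thesis unfolding Gr_stratum_in_def using arc_group_one[of m] by fastforce
  qed
  then have "1\<^sub>m m <#\<^bsub>SL m\<^esub> arc_group m \<in> Gr_orbit_closure m ?lam"
    unfolding Gr_orbit_closure_def hull_def by blast
  moreover have "(1\<^sub>m m :: complex fls mat) \<in> laurent_poly_group m"
    using laurent_poly_const[of 0] laurent_poly_const[of 1] by (auto simp: laurent_poly_group_iff laurent_poly_mat_def)
  moreover have "map_mat fps_to_fls (1\<^sub>m m) = map_mat fls_flip (1\<^sub>m m)" by (rule eq_matI) auto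
  moreover have "1\<^sub>m m \<in> neg_loop_group m" by (auto simp: neg_loop_group_iff intro!: eq_matI)
  ultimately show ?thesis unfolding slice_iff by blast
qed

section \<open>The cotangent space of a function algebra at a point\<close>

lemma function_algebra_idealI:
  assumes "I \<subseteq> carrier (function_algebra W F)" "(\<lambda>x\<in>W. 0) \<in> I"
    and add: "\<And>f g. f \<in> I \<Longrightarrow> g \<in> I \<Longrightarrow> (\<lambda>x\<in>W. f x + g x) \<in> I"
    and mult: "\<And>f g. f \<in> carrier (function_algebra W F) \<Longrightarrow> g \<in> I \<Longrightarrow> (\<lambda>x\<in>W. f x * g x) \<in> I"
  shows "ideal I (function_algebra W F)"
proof -
  let ?A = "function_algebra W F"
  interpret cring ?A by (rule function_algebra_cring)
  show ?thesis
  proof (rule idealI)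
    show "subgroup I (add_monoid ?A)"
    proof (rule add.subgroupI)
      fix f assume f: "f \<in> I"
      have fA: "f \<in> carrier ?A" using f assms(1) by blast
      have "\<ominus>\<^bsub>?A\<^esub> f = (\<lambda>x\<in>W. - f x)"
        by (intro minus_equality fA function_algebra_closed(5)[OF fA fA]) auto
      also have "\<dots> = (\<lambda>x\<in>W. (\<lambda>x\<in>W. - 1) x * f x)" by auto
      also have "\<dots> \<in> I" by (rule mult[OF function_algebra_const f])
      finally show "\<ominus>\<^bsub>?A\<^esub> f \<in> I" .
    qed (use assms in auto)
    fix f g assume f: "f \<in> I" and g: "g \<in> carrier ?A"
    show "g \<otimes>\<^bsub>?A\<^esub> f \<in> I" using mult[OF g f] by simp
    then show "f \<otimes>\<^bsub>?A\<^esub> g \<in> I" using m_comm[of f g] f g assms(1) by auto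
  qed (rule ring_axioms)
qed

lemma function_algebra_idealD:
  assumes "ideal I (function_algebra W F)"
  shows "I \<subseteq> carrier (function_algebra W F)" "(\<lambda>x\<in>W. 0) \<in> I"
    and "f \<in> I \<Longrightarrow> g \<in> I \<Longrightarrow> (\<lambda>x\<in>W. f x + g x) \<in> I"
    and "f \<in> carrier (function_algebra W F) \<Longrightarrow> g \<in> I \<Longrightarrow> (\<lambda>x\<in>W. f x * g x) \<in> I"
    and "g \<in> I \<Longrightarrow> (\<lambda>x\<in>W. c * g x) \<in> I"
    and "f \<in> I \<Longrightarrow> g \<in> I \<Longrightarrow> (\<lambda>x\<in>W. f x - g x) \<in> I"
proof -
  interpret ideal I "function_algebra W F" by (rule assms)
  show "I \<subseteq> carrier (function_algebra W F)" "(\<lambda>x\<in>W. 0) \<in> I"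
    using a_subset additive_subgroup.zero_closed[OF ideal.axioms(1)[OF assms]] by auto
  show add: "(\<lambda>x\<in>W. f x + g x) \<in> I" if "f \<in> I" "g \<in> I" for f g
    using additive_subgroup.a_closed[OF ideal.axioms(1)[OF assms] that] by simp
  show mult: "(\<lambda>x\<in>W. f x * g x) \<in> I" if "f \<in> carrier (function_algebra W F)" "g \<in> I" for f g
    using I_l_closed[OF that(2,1)] by simp
  show smult: "(\<lambda>x\<in>W. c * g x) \<in> I" if "g \<in> I" for g c
  proof -
    have "(\<lambda>x\<in>W. (\<lambda>x\<in>W. c) x * g x) = (\<lambda>x\<in>W. c * g x)" by auto
    then show ?thesis using mult[OF function_algebra_const that] by metis
  qed
  show "(\<lambda>x\<in>W. f x - g x) \<in> I" if "f \<in> I" "g \<in> I"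
  proof -
    have "(\<lambda>x\<in>W. f x + (\<lambda>x\<in>W. -1 * g x) x) = (\<lambda>x\<in>W. f x - g x)" by auto
    then show ?thesis using add[OF that(1) smult[OF that(2), of "-1"]] by metis
  qed
qed

lemma function_algebra_ideal_sum:
  assumes "ideal I (function_algebra W F)" "\<And>s. s \<in> S \<Longrightarrow> g s \<in> I"
  shows "(\<lambda>x\<in>W. \<Sum>s\<in>S. g s x) \<in> I"
  using assms(2)
proof (induction S rule: infinite_finite_induct)
  case (insert s S)
  have "(\<lambda>x\<in>W. \<Sum>s\<in>insert s S. g s x) = (\<lambda>x\<in>W. g s x + (\<lambda>x\<in>W. \<Sum>s\<in>S. g s x) x)"
    using insert.hyps by auto
  then show ?case using function_algebra_idealD(3)[OF assms(1)] insert by (metis insertCI)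
qed (use function_algebra_idealD(2)[OF assms(1)] in auto)

locale pointed_function_algebra =
  fixes W :: "'x set" and F :: "('x \<Rightarrow> complex) set" and p :: 'x
  assumes p: "p \<in> W"
begin

abbreviation "A \<equiv> function_algebra W F"

definition "mI = {f \<in> carrier A. f p = 0}"

abbreviation "mI2 \<equiv> ideal_prod A mI mI"

definition "cls f = mI2 +>\<^bsub>A\<^esub> f"

abbreviation "V \<equiv> conormal_module A mI"

lemma mI_ideal: "ideal mI A"
  by (rule function_algebra_idealI)
    (use p function_algebra_closed function_algebra_const in \<open>auto simp: mI_def\<close>)

lemma mI2_ideal: "ideal mI2 A"
  using cring.axioms(1)[OF function_algebra_cring] ring.ideal_prod_is_ideal mI_ideal by blast

lemma mI_carrier: "f \<in> mI \<Longrightarrow> f \<in> carrier A"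
  by (simp add: mI_def)

lemma cls_eq_iff:
  assumes "f \<in> carrier A" "g \<in> carrier A"
  shows "cls f = cls g \<longleftrightarrow> (\<lambda>x\<in>W. f x - g x) \<in> mI2"
  using ring.quotient_eq_iff_same_a_r_cos[OF cring.axioms(1)[OF function_algebra_cring] mI2_ideal assms]
    function_algebra_minus[OF assms] by (simp add: cls_def)

lemma cls_zero: "f \<in> mI2 \<Longrightarrow> cls f = mI2"
proof -
  interpret ideal mI2 A by (rule mI2_ideal)
  show "f \<in> mI2 \<Longrightarrow> cls f = mI2" by (simp add: cls_def a_rcos_const)
qed

lemma cls_self: "f \<in> carrier A \<Longrightarrow> f \<in> cls f"
proof -
  interpret ideal mI2 A by (rule mI2_ideal)
  show "f \<in> carrier A \<Longrightarrow> f \<in> cls f" by (simp add: cls_def a_rcos_self)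
qed

lemma mem_cls_iff:
  assumes "f \<in> carrier A"
  shows "g \<in> cls f \<longleftrightarrow> g \<in> carrier A \<and> (\<lambda>x\<in>W. g x - f x) \<in> mI2"
proof -
  interpret ideal mI2 A by (rule mI2_ideal)
  have "g \<in> cls f \<longleftrightarrow> g \<in> carrier A \<and> cls g = cls f"
    using a_elemrcos_carrier[OF assms] a_repr_independence'[OF _ assms] cls_self unfolding cls_def by metis
  then show ?thesis using cls_eq_iff assms by blast
qed

lemma V_simps:
  "carrier V = cls ` mI" "zero V = mI2" "add V = set_add A"
  "smult V = (\<lambda>c X. \<Union>f\<in>X. cls (c \<odot>\<^bsub>A\<^esub> f))"
  by (simp_all add: conormal_module_def Let_def cls_def)

lemma V_zero: "zero V = cls (\<lambda>x\<in>W. 0)"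
  using cls_zero[OF function_algebra_idealD(2)[OF mI2_ideal]] by (simp add: V_simps)

lemma V_add:
  assumes "f \<in> mI" "g \<in> mI"
  shows "cls f \<oplus>\<^bsub>V\<^esub> cls g = cls (\<lambda>x\<in>W. f x + g x)"
proof -
  interpret ideal mI2 A by (rule mI2_ideal)
  show ?thesis using a_rcos_sum[of f g] mI_carrier assms by (simp add: V_simps cls_def)
qed

text \<open>The product is defined as a union of cosets over all representatives; these cosets
  coincide because \<open>mI2\<close> is stable under scalars.\<close>

lemma V_smult:
  assumes "f \<in> mI"
  shows "c \<odot>\<^bsub>V\<^esub> cls f = cls (\<lambda>x\<in>W. c * f x)"
proof -
  have "cls (\<lambda>x\<in>W. c * g x) = cls (\<lambda>x\<in>W. c * f x)" if g: "g \<in> cls f" for g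
  proof -
    have gA: "g \<in> carrier A" "(\<lambda>x\<in>W. g x - f x) \<in> mI2" using g mem_cls_iff[OF mI_carrier[OF assms]] by auto
    have "(\<lambda>x\<in>W. c * (\<lambda>x\<in>W. g x - f x) x) = (\<lambda>x\<in>W. (\<lambda>x\<in>W. c * g x) x - (\<lambda>x\<in>W. c * f x) x)"
      by (auto simp: algebra_simps)
    then have "(\<lambda>x\<in>W. (\<lambda>x\<in>W. c * g x) x - (\<lambda>x\<in>W. c * f x) x) \<in> mI2"
      using function_algebra_idealD(5)[OF mI2_ideal gA(2), of c] by metis
    then show ?thesis
      using cls_eq_iff function_algebra_closed(3)[OF gA(1) gA(1)]
        function_algebra_closed(3)[OF mI_carrier[OF assms] mI_carrier[OF assms]] by blast
  qed
  then have "(\<Union>g\<in>cls f. cls (\<lambda>x\<in>W. c * g x)) = (\<Union>g\<in>cls f. cls (\<lambda>x\<in>W. c * f x))"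
    by (intro SUP_cong) auto
  moreover have "cls f \<noteq> {}" using cls_self[OF mI_carrier[OF assms]] by blast
  ultimately show ?thesis by (simp add: V_simps(4))
qed

lemma mI_closed:
  assumes "f \<in> mI" "g \<in> mI"
  shows "(\<lambda>x\<in>W. f x + g x) \<in> mI" "(\<lambda>x\<in>W. c * f x) \<in> mI" "(\<lambda>x\<in>W. 0) \<in> mI"
    "(\<lambda>x\<in>W. f x - g x) \<in> mI"
  using function_algebra_idealD[OF mI_ideal] assms by auto

lemma V_vectorspace: "vectorspace class_ring V"
proof -
  have grp: "abelian_group V"
  proof (rule abelian_groupI)
    fix X assume "X \<in> carrier V"
    then obtain f where f: "f \<in> mI" "X = cls f" by (auto simp: V_simps)
    show "\<zero>\<^bsub>V\<^esub> \<oplus>\<^bsub>V\<^esub> X = X"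
      using f V_add[OF mI_closed(3)[OF f(1,1)] f(1)] function_algebra_extensional[OF mI_carrier[OF f(1)]]
      unfolding V_zero by (auto cong: restrict_cong)
    show "\<exists>Y\<in>carrier V. Y \<oplus>\<^bsub>V\<^esub> X = \<zero>\<^bsub>V\<^esub>"
    proof
      have n: "(\<lambda>x\<in>W. - 1 * f x) \<in> mI" by (rule mI_closed(2)[OF f(1,1)])
      then show "cls (\<lambda>x\<in>W. - 1 * f x) \<in> carrier V" unfolding V_simps(1) by (rule imageI)
      have "(\<lambda>x\<in>W. (\<lambda>x\<in>W. - 1 * f x) x + f x) = (\<lambda>x\<in>W. 0)" by auto
      then show "cls (\<lambda>x\<in>W. - 1 * f x) \<oplus>\<^bsub>V\<^esub> X = \<zero>\<^bsub>V\<^esub>"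
        unfolding f(2) V_add[OF n f(1)] V_zero by (rule arg_cong)
    qed
  next
    fix X Y assume "X \<in> carrier V" "Y \<in> carrier V"
    then obtain f g where fg: "f \<in> mI" "X = cls f" "g \<in> mI" "Y = cls g" by (auto simp: V_simps)
    show "X \<oplus>\<^bsub>V\<^esub> Y \<in> carrier V" using fg V_add mI_closed by (auto simp: V_simps(1))
    show "X \<oplus>\<^bsub>V\<^esub> Y = Y \<oplus>\<^bsub>V\<^esub> X" using fg V_add by (auto simp: add.commute)
    fix Z assume "Z \<in> carrier V"
    then obtain h where h: "h \<in> mI" "Z = cls h" by (auto simp: V_simps)
    have "(\<lambda>x\<in>W. (\<lambda>x\<in>W. f x + g x) x + h x) = (\<lambda>x\<in>W. f x + (\<lambda>x\<in>W. g x + h x) x)" by auto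
    then show "X \<oplus>\<^bsub>V\<^esub> Y \<oplus>\<^bsub>V\<^esub> Z = X \<oplus>\<^bsub>V\<^esub> (Y \<oplus>\<^bsub>V\<^esub> Z)"
      unfolding fg h V_add[OF fg(1,3)] V_add[OF fg(3) h(1)] V_add[OF mI_closed(1)[OF fg(1,3)] h(1)]
        V_add[OF fg(1) mI_closed(1)[OF fg(3) h(1)]] by (rule arg_cong)
  next
    show "\<zero>\<^bsub>V\<^esub> \<in> carrier V" using function_algebra_idealD(2)[OF mI_ideal] unfolding V_zero by (simp add: V_simps)
  qed
  have "module class_ring V"
  proof (rule moduleI)
    fix c X assume "X \<in> carrier V"
    then obtain f where f: "f \<in> mI" "X = cls f" by (auto simp: V_simps)
    note cl = mI_closed[OF f(1,1)]
    show "c \<odot>\<^bsub>V\<^esub> X \<in> carrier V" using f cl V_smult by (auto simp: V_simps(1))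
    show "\<one>\<^bsub>class_ring\<^esub> \<odot>\<^bsub>V\<^esub> X = X"
      using f V_smult[OF f(1), of 1] function_algebra_extensional[OF mI_carrier[OF f(1)]]
      by (auto cong: restrict_cong)
    fix d
    have "(\<lambda>x\<in>W. (c + d) * f x) = (\<lambda>x\<in>W. (\<lambda>x\<in>W. c * f x) x + (\<lambda>x\<in>W. d * f x) x)"
      by (auto simp: algebra_simps)
    then show "(c \<oplus>\<^bsub>class_ring\<^esub> d) \<odot>\<^bsub>V\<^esub> X = c \<odot>\<^bsub>V\<^esub> X \<oplus>\<^bsub>V\<^esub> d \<odot>\<^bsub>V\<^esub> X"
      using f V_smult[OF f(1)] V_add[OF cl(2) cl(2)] by simp
    have "(\<lambda>x\<in>W. c * d * f x) = (\<lambda>x\<in>W. c * (\<lambda>x\<in>W. d * f x) x)" by auto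
    then show "(c \<otimes>\<^bsub>class_ring\<^esub> d) \<odot>\<^bsub>V\<^esub> X = c \<odot>\<^bsub>V\<^esub> (d \<odot>\<^bsub>V\<^esub> X)"
      using f V_smult[OF f(1)] V_smult[OF cl(2)] by simp
    fix Y assume "Y \<in> carrier V"
    then obtain g where g: "g \<in> mI" "Y = cls g" by (auto simp: V_simps)
    have "(\<lambda>x\<in>W. c * (\<lambda>x\<in>W. f x + g x) x) = (\<lambda>x\<in>W. (\<lambda>x\<in>W. c * f x) x + (\<lambda>x\<in>W. c * g x) x)"
      by (auto simp: algebra_simps)
    then show "c \<odot>\<^bsub>V\<^esub> (X \<oplus>\<^bsub>V\<^esub> Y) = c \<odot>\<^bsub>V\<^esub> X \<oplus>\<^bsub>V\<^esub> c \<odot>\<^bsub>V\<^esub> Y"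
      using f g V_smult V_add mI_closed by simp
  qed (use grp class_field field.axioms fieldE in \<open>auto intro: class_cring.cring_axioms\<close>)
  then show ?thesis by (intro vectorspace.intro class_field)
qed

sublocale V: vectorspace class_ring V
  by (rule V_vectorspace)

text \<open>Coefficients belong to classes and not to indices; injectivity turns the sum over the
  set of classes into a sum over \<open>X\<close>.\<close>

lemma V_lincomb:
  assumes "finite X" "\<And>i. i \<in> X \<Longrightarrow> f i \<in> mI" "inj_on (\<lambda>i. cls (f i)) X"
  shows "V.lincomb a ((\<lambda>i. cls (f i)) ` X) = cls (\<lambda>x\<in>W. \<Sum>i\<in>X. a (cls (f i)) * f i x)"
proof -
  have f: "(\<lambda>i. a (cls (f i)) \<odot>\<^bsub>V\<^esub> cls (f i)) \<in> X \<rightarrow> carrier V"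
    using assms(2) V.smult_closed by (auto simp: V_simps(1))
  have "V.lincomb a ((\<lambda>i. cls (f i)) ` X) = finsum V (\<lambda>i. a (cls (f i)) \<odot>\<^bsub>V\<^esub> cls (f i)) X"
    unfolding V.lincomb_def by (rule V.finsum_reindex) (use assms(2,3) V.smult_closed in \<open>auto simp: V_simps(1)\<close>)
  also have "\<dots> = cls (\<lambda>x\<in>W. \<Sum>i\<in>X. a (cls (f i)) * f i x)"
    using assms(1,2) f
  proof (induction X)
    case empty show ?case by (simp add: V_zero restrict_def)
  next
    case (insert i X)
    have i: "(\<lambda>x\<in>W. a (cls (f i)) * f i x) \<in> mI" using mI_closed(2) insert.prems(1) by blast
    have X: "(\<lambda>x\<in>W. \<Sum>i\<in>X. a (cls (f i)) * f i x) \<in> mI"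
    proof -
      have "(\<lambda>x\<in>W. \<Sum>i\<in>X. (\<lambda>x\<in>W. a (cls (f i)) * f i x) x) \<in> mI"
        by (rule function_algebra_ideal_sum[OF mI_ideal]) (use mI_closed(2) insert.prems(1) in blast)
      then show ?thesis by (simp cong: restrict_cong)
    qed
    have "finsum V (\<lambda>i. a (cls (f i)) \<odot>\<^bsub>V\<^esub> cls (f i)) (insert i X) =
        a (cls (f i)) \<odot>\<^bsub>V\<^esub> cls (f i) \<oplus>\<^bsub>V\<^esub> finsum V (\<lambda>i. a (cls (f i)) \<odot>\<^bsub>V\<^esub> cls (f i)) X"
      by (rule V.finsum_insert) (use insert in auto)
    also have "\<dots> = cls (\<lambda>x\<in>W. a (cls (f i)) * f i x) \<oplus>\<^bsub>V\<^esub> cls (\<lambda>x\<in>W. \<Sum>i\<in>X. a (cls (f i)) * f i x)"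
    proof -
      have "finsum V (\<lambda>i. a (cls (f i)) \<odot>\<^bsub>V\<^esub> cls (f i)) X = cls (\<lambda>x\<in>W. \<Sum>i\<in>X. a (cls (f i)) * f i x)"
        using insert by (simp add: restrict_def)
      moreover have "a (cls (f i)) \<odot>\<^bsub>V\<^esub> cls (f i) = cls (\<lambda>x\<in>W. a (cls (f i)) * f i x)"
        by (rule V_smult) (use insert.prems in blast)
      ultimately show ?thesis by (simp only:)
    qed
    finally show ?case unfolding V_add[OF i X] using insert.hyps by (simp add: restrict_def cong: if_cong)
  qed
  finally show ?thesis .
qed

text \<open>In a relation with nonzero coefficient at i, all other terms and \<open>mI2\<close> lie
  in the ideal \<open>K\<close>, which would force f i into \<open>K\<close>. With \<open>K\<close>
  the kernel of a tangent vector on the maximal ideal, these ideals play the part of a dual family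
  of functionals.\<close>

lemma cls_separated:
  assumes "finite X" "\<And>i. i \<in> X \<Longrightarrow> f i \<in> mI"
    and sep: "\<And>i. i \<in> X \<Longrightarrow> \<exists>K. ideal K A \<and> mI2 \<subseteq> K \<and> (\<forall>j\<in>X - {i}. f j \<in> K) \<and> f i \<notin> K"
  shows "\<And>i. i \<in> X \<Longrightarrow> cls (f i) \<noteq> \<zero>\<^bsub>V\<^esub>" "inj_on (\<lambda>i. cls (f i)) X"
    and "V.lin_indpt ((\<lambda>i. cls (f i)) ` X)"
proof -
  show "cls (f i) \<noteq> \<zero>\<^bsub>V\<^esub>" if "i \<in> X" for i
    using sep[OF that] cls_self[OF mI_carrier[OF assms(2)[OF that]]] by (auto simp: V_simps)
  show inj: "inj_on (\<lambda>i. cls (f i)) X"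
  proof (rule inj_onI, rule ccontr)
    fix i j assume ij: "i \<in> X" "j \<in> X" "cls (f i) = cls (f j)" "i \<noteq> j"
    obtain K where K: "ideal K A" "mI2 \<subseteq> K" "f j \<in> K" "f i \<notin> K" using sep[OF ij(1)] ij by blast
    have fA: "f i \<in> carrier A" "f j \<in> carrier A" using assms(2) ij mI_carrier by auto
    have "(\<lambda>x\<in>W. f i x - f j x) \<in> K" using K(2) ij(3) cls_eq_iff[OF fA] by blast
    then have "(\<lambda>x\<in>W. (\<lambda>x\<in>W. f i x - f j x) x + f j x) \<in> K"
      using function_algebra_idealD(3)[OF K(1)] K(3) by blast
    moreover have "(\<lambda>x\<in>W. (\<lambda>x\<in>W. f i x - f j x) x + f j x) = f i"
      using function_algebra_extensional[OF fA(1)] by (simp cong: restrict_cong)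
    ultimately show False using K(4) by simp
  qed
  show "V.lin_indpt ((\<lambda>i. cls (f i)) ` X)"
  proof (rule V.finite_lin_indpt2)
    show "(\<lambda>i. cls (f i)) ` X \<subseteq> carrier V" using assms(2) by (auto simp: V_simps(1))
    fix a assume "V.lincomb a ((\<lambda>i. cls (f i)) ` X) = \<zero>\<^bsub>V\<^esub>"
    then have "cls (\<lambda>x\<in>W. \<Sum>i\<in>X. a (cls (f i)) * f i x) = mI2"
      using V_lincomb[OF assms(1,2) inj] by (simp add: V_simps)
    moreover have "(\<lambda>x\<in>W. \<Sum>i\<in>X. a (cls (f i)) * f i x) \<in> mI"
    proof -
      have "(\<lambda>x\<in>W. \<Sum>i\<in>X. (\<lambda>x\<in>W. a (cls (f i)) * f i x) x) \<in> mI"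
        by (rule function_algebra_ideal_sum[OF mI_ideal]) (use mI_closed(2) assms(2) in blast)
      then show ?thesis by (simp cong: restrict_cong)
    qed
    ultimately have sum: "(\<lambda>x\<in>W. \<Sum>i\<in>X. a (cls (f i)) * f i x) \<in> mI2" using cls_self mI_carrier by metis
    have "a (cls (f i)) = 0" if i: "i \<in> X" for i
    proof (rule ccontr)
      assume nz: "a (cls (f i)) \<noteq> 0"
      obtain K where K: "ideal K A" "mI2 \<subseteq> K" "\<forall>j\<in>X - {i}. f j \<in> K" "f i \<notin> K" using sep[OF i] by blast
      note kd = function_algebra_idealD[OF K(1)]
      have "(\<lambda>x\<in>W. \<Sum>j\<in>X - {i}. (\<lambda>x\<in>W. a (cls (f j)) * f j x) x) \<in> K"
        by (rule function_algebra_ideal_sum[OF K(1)]) (use kd(5) K(3) in blast)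
      then have "(\<lambda>x\<in>W. (\<lambda>x\<in>W. \<Sum>i\<in>X. a (cls (f i)) * f i x) x
          - (\<lambda>x\<in>W. \<Sum>j\<in>X - {i}. (\<lambda>x\<in>W. a (cls (f j)) * f j x) x) x) \<in> K" (is "?d \<in> K")
        using kd(6) sum K(2) by blast
      then have "(\<lambda>x\<in>W. inverse (a (cls (f i))) * ?d x) \<in> K" by (rule kd(5))
      also have "(\<lambda>x\<in>W. inverse (a (cls (f i))) * ?d x) = restrict (f i) W"
        using nz by (intro restrict_ext) (simp add: sum.remove[OF assms(1) i])
      also have "\<dots> = f i" using function_algebra_extensional mI_carrier assms(2) i by blast
      finally show False using K(4) by simp
    qed
    then show "\<forall>v\<in>(\<lambda>i. cls (f i)) ` X. a v = \<zero>\<^bsub>class_ring\<^esub>" by auto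
  qed (use assms(1) in simp)
qed

text \<open>For f in the maximal ideal, g f and g(p) f agree modulo \<open>mI2\<close>. Passing from
  \<open>T\<close> to the ideal it generates therefore adds only linear combinations to the
  classes.\<close>

lemma genideal_cls_in_span:
  assumes "T \<subseteq> mI" "f \<in> Idl\<^bsub>A\<^esub> T"
  shows "f \<in> mI" "cls f \<in> V.span (cls ` T)"
proof -
  let ?S = "V.span (cls ` T)"
  let ?U = "{f \<in> mI. cls f \<in> ?S}"
  have sub: "cls ` T \<subseteq> carrier V" using assms(1) by (auto simp: V_simps)
  interpret S: submodule class_ring ?S V by (rule V.span_is_submodule[OF sub])
  have "ideal ?U A"
  proof (rule function_algebra_idealI)
    show "?U \<subseteq> carrier A" using mI_carrier by blast
    show "(\<lambda>x\<in>W. 0) \<in> ?U" using S.zero_closed mI_closed(3) function_algebra_idealD(2)[OF mI_ideal] V_zero by auto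
    show "(\<lambda>x\<in>W. f x + g x) \<in> ?U" if "f \<in> ?U" "g \<in> ?U" for f g
    proof -
      have "cls (\<lambda>x\<in>W. f x + g x) = cls f \<oplus>\<^bsub>V\<^esub> cls g" using that V_add by simp
      also have "\<dots> \<in> ?S" using that S.m_closed by blast
      finally show ?thesis using that mI_closed(1) by blast
    qed
    fix g f assume g: "g \<in> carrier A" and f: "f \<in> ?U"
    have fm: "f \<in> mI" using f by simp
    have "(\<lambda>x\<in>W. g x - (\<lambda>x\<in>W. g p) x) \<in> carrier A"
      by (rule function_algebra_closed(4)[OF g function_algebra_const])
    then have "(\<lambda>x\<in>W. g x - (\<lambda>x\<in>W. g p) x) \<in> mI" using p by (simp add: mI_def)
    then have "(\<lambda>x\<in>W. g x - (\<lambda>x\<in>W. g p) x) \<otimes>\<^bsub>A\<^esub> f \<in> mI2" by (rule ideal_prod.prod[OF _ fm])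
    also have "(\<lambda>x\<in>W. g x - (\<lambda>x\<in>W. g p) x) \<otimes>\<^bsub>A\<^esub> f = (\<lambda>x\<in>W. (\<lambda>x\<in>W. g x * f x) x - (\<lambda>x\<in>W. g p * f x) x)"
      by (auto simp: algebra_simps)
    finally have "cls (\<lambda>x\<in>W. g x * f x) = cls (\<lambda>x\<in>W. g p * f x)"
      using cls_eq_iff function_algebra_closed(2)[OF g mI_carrier[OF fm]]
        mI_carrier[OF mI_closed(2)[OF fm fm]] by blast
    also have "\<dots> = g p \<odot>\<^bsub>V\<^esub> cls f" by (rule V_smult[OF fm, symmetric])
    also have "\<dots> \<in> ?S" using f S.smult_closed by simp
    finally show "(\<lambda>x\<in>W. g x * f x) \<in> ?U" using function_algebra_idealD(4)[OF mI_ideal g fm] by simp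
  qed
  moreover have "T \<subseteq> ?U" using assms(1) V.in_own_span[OF sub] by auto
  ultimately have "Idl\<^bsub>A\<^esub> T \<subseteq> ?U"
    by (intro ring.genideal_minimal[OF cring.axioms(1)[OF function_algebra_cring]])
  then show "f \<in> mI" "cls f \<in> ?S" using assms(2) by auto
qed

end

section \<open>The torus ideal of the slice\<close>

text \<open>As the constant term of \<open>P\<close> is the identity, the coefficient of degree l in
  P Q = 1 expresses that of Q by lower ones. The range starting at r = 1 makes this a recursion on
  l.\<close>

lemma fps_mat_right_inverse_nth:
  fixes P Q :: "'a::comm_ring_1 fps mat"
  assumes PQ: "P * Q = 1\<^sub>m m" and P: "P \<in> carrier_mat m m" "map_mat (\<lambda>f. fps_nth f 0) P = 1\<^sub>m m"
    and Q: "Q \<in> carrier_mat m m" and ij: "i < m" "j < m"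
  shows "fps_nth (Q $$ (i, j)) l = (if i = j \<and> l = 0 then 1 else 0)
    - (\<Sum>k<m. \<Sum>r=1..l. fps_nth (P $$ (i, k)) r * fps_nth (Q $$ (k, j)) (l - r))"
proof -
  have P0: "fps_nth (P $$ (i, k)) 0 = (if i = k then 1 else 0)" if "k < m" for k
  proof -
    have "fps_nth (P $$ (i, k)) 0 = map_mat (\<lambda>f. fps_nth f 0) P $$ (i, k)" using P(1) ij that by simp
    then show ?thesis unfolding P(2) using ij that by simp
  qed
  have "fps_nth ((P * Q) $$ (i, j)) l =
      (\<Sum>k<m. \<Sum>r=0..l. fps_nth (P $$ (i, k)) r * fps_nth (Q $$ (k, j)) (l - r))"
    unfolding mat_mult_entry[OF P(1) Q ij] by (simp add: fps_sum_nth fps_mult_nth)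
  also have "\<dots> = (\<Sum>k<m. (if k = i then fps_nth (Q $$ (i, j)) l else 0)
      + (\<Sum>r=1..l. fps_nth (P $$ (i, k)) r * fps_nth (Q $$ (k, j)) (l - r)))"
    by (rule sum.cong) (auto simp: sum.atLeast_Suc_atMost P0)
  also have "\<dots> = fps_nth (Q $$ (i, j)) l
      + (\<Sum>k<m. \<Sum>r=1..l. fps_nth (P $$ (i, k)) r * fps_nth (Q $$ (k, j)) (l - r))"
    using ij by (simp add: sum.distrib)
  finally have "fps_nth ((P * Q) $$ (i, j)) l = fps_nth (Q $$ (i, j)) l
      + (\<Sum>k<m. \<Sum>r=1..l. fps_nth (P $$ (i, k)) r * fps_nth (Q $$ (k, j)) (l - r))" .
  moreover have "fps_nth ((P * Q) $$ (i, j)) l = (if i = j \<and> l = 0 then 1 else 0)"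
    unfolding PQ using ij by (simp add: fps_one_nth)
  ultimately show ?thesis by (simp add: algebra_simps)
qed

text \<open>Modulo \<open>J\<close> the matrix \<open>P\<close> is diagonal up to degree
  \<open>L\<close>, hence so is its inverse. In a term P_ik Q_kj with i /= j, either k = i and the
  second factor is covered by induction on the degree, or the first factor lies in \<open>J\<close>.
  Membership in the algebra is proved along with this, because \<open>J\<close> absorbs only factors
  from the algebra.\<close>

lemma function_algebra_offdiagonal_inverse:
  fixes P Q :: "nat \<Rightarrow> nat \<Rightarrow> nat \<Rightarrow> 'x \<Rightarrow> complex"
  assumes J: "ideal J (function_algebra W F)"
    and PA: "\<And>i j r. i < m \<Longrightarrow> j < m \<Longrightarrow> P i j r \<in> carrier (function_algebra W F)"
    and PJ: "\<And>i j r. i < m \<Longrightarrow> j < m \<Longrightarrow> i \<noteq> j \<Longrightarrow> 1 \<le> r \<Longrightarrow> r \<le> L \<Longrightarrow> P i j r \<in> J"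
    and Q: "\<And>i j l. i < m \<Longrightarrow> j < m \<Longrightarrow> Q i j l = (\<lambda>x\<in>W. (if i = j \<and> l = 0 then 1 else 0)
      - (\<Sum>k<m. \<Sum>r=1..l. P i k r x * Q k j (l - r) x))"
    and ij: "i < m" "j < m"
  shows "Q i j l \<in> carrier (function_algebra W F) \<and> (i \<noteq> j \<longrightarrow> l \<le> L \<longrightarrow> Q i j l \<in> J)"
  using ij
proof (induction l arbitrary: i j rule: less_induct)
  case (less l)
  let ?A = "function_algebra W F"
  have AA: "ideal (carrier ?A) ?A"
    using ring.oneideal[OF cring.axioms(1)[OF function_algebra_cring]] .
  have sums: "(\<lambda>x\<in>W. \<Sum>k<m. \<Sum>r=1..l. P i k r x * Q k j (l - r) x) \<in> I"
    if I: "ideal I ?A" and mem: "\<And>k r. k < m \<Longrightarrow> 1 \<le> r \<Longrightarrow> r \<le> l \<Longrightarrow> (\<lambda>x\<in>W. P i k r x * Q k j (l - r) x) \<in> I" for I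
  proof -
    have "(\<lambda>x\<in>W. \<Sum>k<m. (\<lambda>x\<in>W. \<Sum>r=1..l. (\<lambda>x\<in>W. P i k r x * Q k j (l - r) x) x) x) \<in> I"
      by (intro function_algebra_ideal_sum[OF I] mem) auto
    then show ?thesis by (simp cong: restrict_cong)
  qed
  have QA: "Q k j (l - r) \<in> carrier ?A" if "k < m" "1 \<le> r" "r \<le> l" for k r
    using less.IH[of "l - r" k j] that less.prems by simp
  have s1: "(\<lambda>x\<in>W. \<Sum>k<m. \<Sum>r=1..l. P i k r x * Q k j (l - r) x) \<in> carrier ?A" (is "?s \<in> _")
    by (rule sums[OF AA]) (intro function_algebra_closed(2) PA QA less.prems)
  have e: "Q i j l = (\<lambda>x\<in>W. (\<lambda>x\<in>W. if i = j \<and> l = 0 then 1 else 0) x - ?s x)"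
    by (subst Q[OF less.prems]) (intro restrict_ext, simp)
  have "Q i j l \<in> carrier ?A"
    by (subst e) (rule function_algebra_closed(4)[OF function_algebra_const s1])
  moreover have "Q i j l \<in> J" if "i \<noteq> j" "l \<le> L"
  proof -
    have "?s \<in> J"
    proof (rule sums[OF J])
      fix k r assume kr: "k < m" "1 \<le> r" "r \<le> l"
      show "(\<lambda>x\<in>W. P i k r x * Q k j (l - r) x) \<in> J"
      proof (cases "k = i")
        case True
        then have "Q k j (l - r) \<in> J" using less.IH[of "l - r" i j] kr less.prems that by simp
        then show ?thesis using function_algebra_idealD(4)[OF J PA[OF less.prems(1) kr(1)]] by blast
      next
        case False
        then have "P i k r \<in> J" using PJ[OF less.prems(1) kr(1)] kr that by simp
        then have "(\<lambda>x\<in>W. Q k j (l - r) x * P i k r x) \<in> J"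
          using function_algebra_idealD(4)[OF J QA[OF kr]] by blast
        then show ?thesis by (simp add: mult.commute)
      qed
    qed
    then have "(\<lambda>x\<in>W. (\<lambda>x\<in>W. 0) x - ?s x) \<in> J"
      using function_algebra_idealD(2,6)[OF J] by blast
    then show ?thesis using that by (subst e) simp
  qed
  ultimately show ?case by blast
qed

lemma finite_offdiag_index: "finite (offdiag_index m d)"
  by (rule finite_subset[of _ "{1..m} \<times> {1..m} \<times> {..nat d}"]) (auto simp: offdiag_index_def)

text \<open>\<open>b k\<close> are the coefficients of the coweight in the simple coroots, with \<open>b 0 = b m = 0\<close>.\<close>

locale slice_bounds =
  fixes m :: nat and b :: "nat \<Rightarrow> int" and d :: int
  assumes b0: "b 0 = 0" and bm: "b m = 0" and d0: "0 \<le> d"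
    and db: "\<And>k. k \<in> {1..<m} \<Longrightarrow> d \<le> b k"
    and bound: "(\<forall>k\<in>{1..m}. coweight_of_sums b k \<le> d) \<or> (\<forall>k\<in>{1..m}. - d \<le> coweight_of_sums b k)"
begin

abbreviation "lam \<equiv> coweight_of_sums b"
abbreviation "S \<equiv> slice m lam"
abbreviation "X \<equiv> offdiag_index m d"
abbreviation "\<Delta> \<equiv> slice_Delta m lam"

lemma sum_lam: "(\<Sum>k=1..m. lam k) = 0"
  using b0 bm by (simp only: sum_coweight_of_sums)

lemma one_in_S: "1\<^sub>m m \<in> S"
  using one_in_slice[OF b0 bm] db d0 by fastforce

sublocale pointed_function_algebra S "neg_loop_coordinates m" "1\<^sub>m m"
  by unfold_locales (rule one_in_S)

lemma slice_ring_eq: "slice_ring m lam = A"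
  by (simp add: slice_ring_def)

lemma slice_max_ideal_eq: "slice_max_ideal m lam = mI"
  by (simp add: slice_max_ideal_def mI_def slice_ring_eq)

lemma slice_cotangent_eq: "slice_cotangent m lam = V"
  by (simp add: slice_cotangent_def slice_max_ideal_eq slice_ring_eq)

lemma cotangent_class_eq: "cotangent_class m lam = cls"
  by (intro ext) (simp add: cotangent_class_def cls_def slice_max_ideal_eq slice_ring_eq)

lemma A_ring: "ring A"
  by (rule cring.axioms(1)[OF function_algebra_cring])

lemma S_carrier: "M \<in> S \<Longrightarrow> M \<in> carrier (SL m)" "M \<in> S \<Longrightarrow> map_mat (\<lambda>f. fps_nth f 0) M = 1\<^sub>m m"
  unfolding slice_iff neg_loop_group_iff by blast+

lemma Delta_in_mI:
  assumes "i \<in> {1..m}" "j \<in> {1..m}" "1 \<le> l"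
  shows "restrict (Delta i j l) S \<in> mI"
proof -
  have "Delta i j l \<in> neg_loop_coordinates m" using assms by (auto simp: neg_loop_coordinates_def)
  then have "restrict (Delta i j l) S \<in> carrier A"
    by (intro function_algebra_carrierI[OF polynomials_in.gen]) auto
  moreover have "Delta i j l (1\<^sub>m m) = 0" using assms by (auto simp: Delta_def)
  ultimately show ?thesis using p by (simp add: mI_def)
qed

lemma \<Delta>_in_mI: "x \<in> X \<Longrightarrow> \<Delta> x \<in> mI"
  using Delta_in_mI by (auto simp: offdiag_index_def slice_Delta_def)

section \<open>Tangent vectors at the identity\<close>

definition curve :: "nat \<times> nat \<times> nat \<Rightarrow> complex \<Rightarrow> complex fps mat" where
  "curve = (\<lambda>(i, j, l) s. addrow_mat m (fps_const s * fps_X ^ l) (i - 1) (j - 1))"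

text \<open>The functions in the maximal ideal that the tangent vector of the curve kills; these are
  the separating ideals for \<open>cls_separated\<close>.\<close>

definition second_order :: "nat \<times> nat \<times> nat \<Rightarrow> (complex fps mat \<Rightarrow> complex) set" where
  "second_order x = {f \<in> mI. ((\<lambda>s. f (curve x s)) has_field_derivative 0) (at 0)}"

lemma curve_in_S: "x \<in> X \<Longrightarrow> curve x s \<in> S"
proof -
  assume "x \<in> X"
  then obtain i j l where x: "x = (i, j, l)" "i \<in> {1..m}" "j \<in> {1..m}" "i \<noteq> j" "1 \<le> l" "int l \<le> d"
    by (auto simp: offdiag_index_def)
  then show ?thesis unfolding x(1) curve_def prod.case
    by (intro addrow_mat_in_slice) (use b0 bm db in fastforce)+
qed

lemma curve_0: "curve x 0 = 1\<^sub>m m"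
  by (rule eq_matI) (auto simp: curve_def addrow_mat_def split: prod.splits)

text \<open>The coordinates are dual to the curves: along each curve a single coordinate moves, with
  velocity 1. Degrees from 1 on do not see the constant entries of the identity.\<close>

lemma Delta_curve:
  assumes "(i, j, l) \<in> X" "i' \<in> {1..m}" "j' \<in> {1..m}" "1 \<le> l'"
  shows "Delta i' j' l' (curve (i, j, l) s) = (if (i', j', l') = (i, j, l) then s else 0)"
proof -
  have e: "(i' - 1 = i - 1) = (i' = i)" "(j' - 1 = j - 1) = (j' = j)" "(i' - 1 = j' - 1) = (i' = j')"
    and lt: "i' - 1 < m" "j' - 1 < m"
    using assms(1-3) unfolding offdiag_index_def by (simp_all; linarith)+
  have "curve (i, j, l) s $$ (i' - 1, j' - 1) =
      (if i' = i \<and> j' = j then fps_const s * fps_X ^ l else 0) + (if i' = j' then 1 else 0)"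
    unfolding curve_def prod.case addrow_mat_index[OF lt] e ..
  then have "Delta i' j' l' (curve (i, j, l) s) =
      fps_nth ((if i' = i \<and> j' = j then fps_const s * fps_X ^ l else 0) + (if i' = j' then 1 else 0)) l'"
    by (simp only: Delta_def)
  also have "\<dots> = (if i' = i \<and> j' = j then s * (if l' = l then 1 else 0) else 0)"
    using assms(4) by (cases "i' = i \<and> j' = j"; cases "i' = j'") auto
  finally show ?thesis by simp
qed

lemma curve_differentiable:
  assumes "x \<in> X" "f \<in> carrier A"
  shows "\<exists>D. ((\<lambda>s. f (curve x s)) has_field_derivative D) (at 0)"
proof -
  obtain P where P: "P \<in> polynomials_in (neg_loop_coordinates m)" "f = restrict P S"
    using assms(2) by (auto simp: function_algebra_carrier)
  have "\<exists>D. ((\<lambda>s. P (curve x s)) has_field_derivative D) (at 0)"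
    using P(1)
  proof induction
    case (const c) show ?case by (rule exI[of _ 0]) simp
  next
    case (gen g)
    then obtain i' j' l' where g: "g = Delta i' j' l'" "i' \<in> {1..m}" "j' \<in> {1..m}" "1 \<le> l'"
      by (auto simp: neg_loop_coordinates_def)
    obtain i j l where x: "x = (i, j, l)" by (cases x)
    show ?case
    proof (cases "(i', j', l') = (i, j, l)")
      case True
      then have "(\<lambda>s. g (curve x s)) = (\<lambda>s. s)"
        using Delta_curve[OF assms(1)[unfolded x] g(2-4)] unfolding g(1) x by auto
      then show ?thesis using DERIV_ident by metis
    next
      case False
      then have "(\<lambda>s. g (curve x s)) = (\<lambda>s. 0)"
        using Delta_curve[OF assms(1)[unfolded x] g(2-4)] unfolding g(1) x by auto
      then show ?thesis using DERIV_const by metis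
    qed
  next
    case (add f g) then show ?case using DERIV_add by blast
  next
    case (mult f g) then show ?case using DERIV_mult by blast
  qed
  then show ?thesis using P(2) curve_in_S[OF assms(1)] by simp
qed

text \<open>As g vanishes at the identity, the derivative of f g there is f(1) times that of g. The
  alternatives in the last hypothesis cover products inside the maximal ideal and multiples of an
  element of \<open>second_order x\<close>.\<close>

lemma second_order_product:
  assumes "x \<in> X" "f \<in> carrier A" "g \<in> carrier A" "g (1\<^sub>m m) = 0"
    and "f (1\<^sub>m m) = 0 \<or> g \<in> second_order x"
  shows "(\<lambda>M\<in>S. f M * g M) \<in> second_order x"
proof -
  obtain D E where D: "((\<lambda>s. f (curve x s)) has_field_derivative D) (at 0)"
    "((\<lambda>s. g (curve x s)) has_field_derivative E) (at 0)"
    using curve_differentiable assms by blast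
  have z: "f (1\<^sub>m m) * E = 0"
    using assms(5) D(2) by (auto simp: second_order_def dest: DERIV_unique)
  have "((\<lambda>s. f (curve x s) * g (curve x s)) has_field_derivative 0) (at 0)"
  proof -
    have "D * g (curve x 0) + E * f (curve x 0) = 0" using z assms(4) by (auto simp: curve_0)
    then show ?thesis using DERIV_mult[OF D] by (simp only:)
  qed
  then have "((\<lambda>s. (\<lambda>M\<in>S. f M * g M) (curve x s)) has_field_derivative 0) (at 0)"
    using curve_in_S[OF assms(1)] by simp
  then show ?thesis
    using function_algebra_closed(2)[OF assms(2,3)] assms(4) p by (simp add: second_order_def mI_def)
qed

lemma second_order_ideal:
  assumes "x \<in> X"
  shows "ideal (second_order x) A"
proof (rule function_algebra_idealI)
  show "second_order x \<subseteq> carrier A" by (auto simp: second_order_def mI_def)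
  show "(\<lambda>M\<in>S. 0) \<in> second_order x"
    using function_algebra_idealD(2)[OF mI_ideal] curve_in_S[OF assms] by (simp add: second_order_def)
  show "(\<lambda>M\<in>S. f M + g M) \<in> second_order x" if "f \<in> second_order x" "g \<in> second_order x" for f g
    using that mI_closed(1) curve_in_S[OF assms] DERIV_add[of "\<lambda>s. f (curve x s)" 0 0 UNIV "\<lambda>s. g (curve x s)" 0]
    by (simp add: second_order_def)
  show "(\<lambda>M\<in>S. f M * g M) \<in> second_order x" if "f \<in> carrier A" "g \<in> second_order x" for f g
    by (rule second_order_product[OF assms that(1)]) (use that in \<open>auto simp: second_order_def mI_def\<close>)
qed

lemma mI2_second_order:
  assumes "x \<in> X"
  shows "mI2 \<subseteq> second_order x"
proof
  fix f assume "f \<in> mI2"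
  then show "f \<in> second_order x"
  proof induction
    case (prod f g)
    then show ?case using second_order_product[OF assms, of f g] by (auto simp: mI_def restrict_def)
  next
    case (sum f g)
    then show ?case using function_algebra_idealD(3)[OF second_order_ideal[OF assms]] by (simp add: restrict_def)
  qed
qed

lemma \<Delta>_second_order:
  assumes "x \<in> X" "y \<in> X"
  shows "\<Delta> y \<in> second_order x \<longleftrightarrow> y \<noteq> x"
proof -
  obtain i j l where x: "x = (i, j, l)" by (cases x)
  obtain i' j' l' where y: "y = (i', j', l')" by (cases y)
  have c: "\<Delta> y (curve x s) = (if y = x then s else 0)" for s
    using curve_in_S[OF assms(1), of s] Delta_curve[OF assms(1)[unfolded x], of i' j' l' s] assms(2)
    by (auto simp: x y slice_Delta_def offdiag_index_def)
  have "\<not> ((\<lambda>s::complex. s) has_field_derivative 0) (at 0)"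
    using DERIV_unique[OF DERIV_ident] zero_neq_one by metis
  moreover have "((\<lambda>s. if y = x then s else 0) has_field_derivative 0) (at (0::complex))" if "y \<noteq> x"
    using that DERIV_const by simp
  ultimately have "((\<lambda>s. \<Delta> y (curve x s)) has_field_derivative 0) (at 0) \<longleftrightarrow> y \<noteq> x"
    unfolding c by (cases "y = x") auto
  then show ?thesis using \<Delta>_in_mI[OF assms(2)] by (simp add: second_order_def)
qed

section \<open>The ideal of the off-diagonal coefficients\<close>

abbreviation "J \<equiv> Idl\<^bsub>A\<^esub> (\<Delta> ` X)"

lemma J_ideal: "ideal J A"
  by (rule ring.genideal_ideal[OF A_ring]) (use \<Delta>_in_mI mI_carrier in blast)

lemma \<Delta>_in_J: "x \<in> X \<Longrightarrow> \<Delta> x \<in> J"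
  using ring.genideal_self[OF A_ring, of "\<Delta> ` X"] \<Delta>_in_mI mI_carrier by blast

text \<open>The generators of \<open>J\<close> stop at degree d, whereas the torus acts trivially
  modulo \<open>J\<close> only if off-diagonal coefficients of every degree lie in
  \<open>J\<close>.\<close>

lemma Delta_in_J:
  assumes ij: "i \<in> {1..m}" "j \<in> {1..m}" "i \<noteq> j" "1 \<le> l"
  shows "restrict (Delta i j l) S \<in> J"
proof -
  \<comment> \<open>Positions start at 0 here, and degree 0 is included because the recursion
    between M and its inverse runs through it.\<close>
  define Mc where "Mc i j l = (\<lambda>M\<in>S. fps_nth (M $$ (i, j)) l)" for i j l
  define Bc where "Bc i j l = (\<lambda>M\<in>S. fps_nth (adj_mat M $$ (i, j)) l)" for i j l
  have Mc: "Mc i j l = restrict (Delta (i + 1) (j + 1) l) S" for i j l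
    by (auto simp: Mc_def Delta_def)
  have small: "Mc i j l \<in> J" if "i < m" "j < m" "i \<noteq> j" "1 \<le> l" "l \<le> nat d" for i j l
    using \<Delta>_in_J[of "(i + 1, j + 1, l)"] that by (auto simp: Mc slice_Delta_def offdiag_index_def)
  have zero: "(\<lambda>M\<in>S. 0) \<in> J" by (rule function_algebra_idealD(2)[OF J_ideal])
  have all: "Mc i j l \<in> J" if ij: "i < m" "j < m" "i \<noteq> j" and l: "1 \<le> l" for i j l
    using bound
  proof
    assume "\<forall>k\<in>{1..m}. - d \<le> lam k"
    then have "Mc i j l = (\<lambda>M\<in>S. 0)" if "nat d < l"
      unfolding Mc_def using slice_nth_eq_0[OF sum_lam, of "nat d" _ i j l] ij d0 that by (intro restrict_ext) auto
    then show ?thesis using small ij l zero by (cases "l \<le> nat d") auto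
  next
    assume up: "\<forall>k\<in>{1..m}. lam k \<le> d"
    have adj: "adj_mat M \<in> carrier (SL m)" "M * adj_mat M = 1\<^sub>m m" "adj_mat M * M = 1\<^sub>m m" if "M \<in> S" for M
      using SL_adj_mat S_carrier(1)[OF that] by blast+
    have B: "Bc i j l = (\<lambda>M\<in>S. (if i = j \<and> l = 0 then 1 else 0)
      - (\<Sum>k<m. \<Sum>r=1..l. Mc i k r M * Bc k j (l - r) M))" if "i < m" "j < m" for i j l
      unfolding Bc_def
    proof (rule restrict_ext)
      fix M assume M: "M \<in> S"
      show "fps_nth (adj_mat M $$ (i, j)) l = (if i = j \<and> l = 0 then 1 else 0)
        - (\<Sum>k<m. \<Sum>r=1..l. Mc i k r M * (\<lambda>M\<in>S. fps_nth (adj_mat M $$ (k, j)) (l - r)) M)"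
        using fps_mat_right_inverse_nth[OF adj(2)[OF M] _ S_carrier(2)[OF M] _ that, of l]
          S_carrier(1)[OF M] adj(1)[OF M] M by (simp add: Mc_def)
    qed
    have B0: "map_mat (\<lambda>f. fps_nth f 0) (adj_mat M) = 1\<^sub>m m" if "M \<in> S" for M
    proof (rule eq_matI)
      fix i j assume "i < dim_row (1\<^sub>m m :: complex mat)" "j < dim_col (1\<^sub>m m :: complex mat)"
      then have ij: "i < m" "j < m" by auto
      have "fps_nth (adj_mat M $$ (i, j)) 0 = (if i = j then 1 else 0)"
        using fps_mat_right_inverse_nth[OF adj(2)[OF that] _ S_carrier(2)[OF that] _ ij, of 0]
          S_carrier(1)[OF that] adj(1)[OF that] by simp
      then show "map_mat (\<lambda>f. fps_nth f 0) (adj_mat M) $$ (i, j) = 1\<^sub>m m $$ (i, j)"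
        using ij adj(1)[OF that] by auto
    qed (use adj(1)[OF that] in auto)
    have M: "Mc i j l = (\<lambda>M\<in>S. (if i = j \<and> l = 0 then 1 else 0)
      - (\<Sum>k<m. \<Sum>r=1..l. Bc i k r M * Mc k j (l - r) M))" if "i < m" "j < m" for i j l
      unfolding Mc_def
    proof (rule restrict_ext)
      fix M assume M: "M \<in> S"
      show "fps_nth (M $$ (i, j)) l = (if i = j \<and> l = 0 then 1 else 0)
        - (\<Sum>k<m. \<Sum>r=1..l. Bc i k r M * (\<lambda>M\<in>S. fps_nth (M $$ (k, j)) (l - r)) M)"
        using fps_mat_right_inverse_nth[OF adj(3)[OF M] _ B0[OF M] _ that, of l]
          S_carrier(1)[OF M] adj(1)[OF M] M by (simp add: Bc_def)
    qed
    have McA: "Mc i j r \<in> carrier A" if "i < m" "j < m" for i j r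
    proof (cases "r = 0")
      case False
      then show ?thesis using mI_carrier[OF Delta_in_mI[of "i + 1" "j + 1" r]] that by (simp add: Mc)
    next
      case True
      \<comment> \<open>Degree 0 is not among the coordinates; the recursion, whose sums are empty
        there, shows that it is constant.\<close>
      have "Mc i j r = (\<lambda>M\<in>S. if i = j then 1 else 0)"
        using M[OF that, of r] True by simp
      then show ?thesis using function_algebra_const[where c = "if i = j then 1 else 0"] by (simp only:)
    qed
    \<comment> \<open>From M to its inverse: the off-diagonal coefficients of M are so far known to
      lie in \<open>J\<close> up to degree d, and the conclusion reaches the same degree.\<close>
    have BA: "Bc i j l \<in> carrier A \<and> (i \<noteq> j \<longrightarrow> l \<le> nat d \<longrightarrow> Bc i j l \<in> J)" if "i < m" "j < m" for i j l
      by (rule function_algebra_offdiagonal_inverse[OF J_ideal McA small B that])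
    have BJ: "Bc i j r \<in> J" if "i < m" "j < m" "i \<noteq> j" for i j r
    proof (cases "r \<le> nat d")
      case False
      then have "Bc i j r = (\<lambda>M\<in>S. 0)"
        unfolding Bc_def using slice_adj_mat_nth_eq_0[OF sum_lam, of "nat d" _ i j r] up that d0
        by (intro restrict_ext) auto
      then show ?thesis using zero by simp
    qed (use BA that in blast)
    \<comment> \<open>Back to M: the inverse is now diagonal modulo \<open>J\<close> in all degrees,
      so the degree bound may be l itself.\<close>
    have "Mc i j l \<in> carrier A \<and> (i \<noteq> j \<longrightarrow> l \<le> l \<longrightarrow> Mc i j l \<in> J)"
      by (rule function_algebra_offdiagonal_inverse[OF J_ideal _ _ M ij(1,2)]) (use BA BJ in auto)
    then show ?thesis using ij by simp
  qed
  have "i - 1 < m" "j - 1 < m" "i - 1 \<noteq> j - 1" using ij by auto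
  then show ?thesis using all[of "i - 1" "j - 1" l] ij by (simp add: Mc)
qed

section \<open>The torus action on the coordinate ring\<close>

lemma torus_conj_S: "\<tau> \<in> torus m \<Longrightarrow> M \<in> S \<Longrightarrow> torus_conj m \<tau> M \<in> S"
  by (rule slice_torus_stable[OF sum_lam])

lemma Delta_torus_conj:
  assumes "\<tau> \<in> torus m" "M \<in> S" "i \<in> {1..m}" "j \<in> {1..m}"
  shows "Delta i j l (torus_conj m \<tau> M) = \<tau> $$ (i - 1, i - 1) * inverse (\<tau> $$ (j - 1, j - 1)) * Delta i j l M"
proof -
  have "i - 1 < m" "j - 1 < m" "M \<in> carrier_mat m m" using assms S_carrier(1) by auto
  then show ?thesis by (simp add: Delta_def torus_conj_index[OF assms(1)])
qed

abbreviation "act \<equiv> slice_ring_action m lam"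

lemma act_eq: "\<tau> \<in> torus m \<Longrightarrow> act \<tau> f = (\<lambda>M\<in>S. f (torus_conj m (adj_mat \<tau>) M))"
  by (simp add: slice_ring_action_def torus_adj_mat(4))

text \<open>Generators of nontrivial weight lie in \<open>J\<close> and the others are invariant, so the torus acts
  trivially on the quotient by \<open>J\<close>.\<close>

lemma act_trivial_mod_J:
  assumes \<tau>: "\<tau> \<in> torus m" and f: "f \<in> carrier A"
  shows "act \<tau> f \<in> carrier A" "(\<lambda>M\<in>S. act \<tau> f M - f M) \<in> J"
proof -
  let ?c = "torus_conj m (adj_mat \<tau>)"
  note \<tau>' = torus_adj_mat(1)[OF \<tau>]
  obtain P where P: "P \<in> polynomials_in (neg_loop_coordinates m)" "f = restrict P S"
    using f by (auto simp: function_algebra_carrier)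
  have "(\<lambda>M\<in>S. P (?c M)) \<in> carrier A \<and> (\<lambda>M\<in>S. P (?c M) - P M) \<in> J"
    using P(1)
  proof induction
    case (const c)
    show ?case using function_algebra_const[where c = c] function_algebra_idealD(2)[OF J_ideal] by (simp add: restrict_def)
  next
    case (gen g)
    then obtain i j l where g: "g = Delta i j l" "i \<in> {1..m}" "j \<in> {1..m}" "1 \<le> l"
      by (auto simp: neg_loop_coordinates_def)
    let ?k = "adj_mat \<tau> $$ (i - 1, i - 1) * inverse (adj_mat \<tau> $$ (j - 1, j - 1))"
    have r: "restrict g S \<in> carrier A" using mI_carrier[OF Delta_in_mI[OF g(2-4)]] g(1) by simp
    have e: "(\<lambda>M\<in>S. g (?c M)) = (\<lambda>M\<in>S. ?k * restrict g S M)"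
      "(\<lambda>M\<in>S. g (?c M) - g M) = (\<lambda>M\<in>S. (?k - 1) * restrict g S M)"
      by (auto simp: g(1) Delta_torus_conj[OF \<tau>' _ g(2,3)] algebra_simps)
    have "(\<lambda>M\<in>S. (?k - 1) * restrict g S M) \<in> J"
    proof (cases "i = j")
      case True
      have "adj_mat \<tau> $$ (i - 1, i - 1) \<noteq> 0" by (rule torus_adj_mat(2)[OF \<tau>']) (use g(2) in auto)
      then have "?k - 1 = 0" using True by simp
      then show ?thesis using function_algebra_idealD(2)[OF J_ideal] by (simp cong: restrict_cong)
    next
      case False
      then show ?thesis using function_algebra_idealD(5)[OF J_ideal Delta_in_J[OF g(2,3) False g(4)]] g(1) by blast
    qed
    then show ?case unfolding e using function_algebra_closed(3)[OF r r] by blast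
  next
    case (add f g)
    have 1: "(\<lambda>M\<in>S. f (?c M) + g (?c M)) = (\<lambda>M\<in>S. (\<lambda>M\<in>S. f (?c M)) M + (\<lambda>M\<in>S. g (?c M)) M)"
      and 2: "(\<lambda>M\<in>S. f (?c M) + g (?c M) - (f M + g M)) =
        (\<lambda>M\<in>S. (\<lambda>M\<in>S. f (?c M) - f M) M + (\<lambda>M\<in>S. g (?c M) - g M) M)" by auto
    show ?case
      unfolding 1 2 by (intro conjI function_algebra_closed(1) function_algebra_idealD(3)[OF J_ideal])
        (use add.IH in blast)+
  next
    case (mult f g)
    have f: "restrict f S \<in> carrier A" by (rule function_algebra_carrierI[OF mult.hyps(1) refl])
    have e: "(\<lambda>M\<in>S. f (?c M) * g (?c M)) = (\<lambda>M\<in>S. (\<lambda>M\<in>S. f (?c M)) M * (\<lambda>M\<in>S. g (?c M)) M)" by auto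
    have 1: "(\<lambda>M\<in>S. f (?c M) * g (?c M)) \<in> carrier A"
      unfolding e by (rule function_algebra_closed(2)) (use mult.IH in blast)+
    \<comment> \<open>A difference of products splits as g' (f' - f) + f (g' - g), where primes mark
      composition with the conjugation; both differences lie in \<open>J\<close> by
      induction.\<close>
    have "(\<lambda>M\<in>S. f (?c M) * g (?c M) - f M * g M) =
      (\<lambda>M\<in>S. (\<lambda>M\<in>S. (\<lambda>M\<in>S. g (?c M)) M * (\<lambda>M\<in>S. f (?c M) - f M) M) M
        + (\<lambda>M\<in>S. restrict f S M * (\<lambda>M\<in>S. g (?c M) - g M) M) M)" by (auto simp: algebra_simps)
    also have "\<dots> \<in> J"
      by (intro function_algebra_idealD(3,4)[OF J_ideal] f) (use mult.IH in auto)
    finally show ?case using 1 by blast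
  qed
  moreover have "act \<tau> f = (\<lambda>M\<in>S. P (?c M))"
    unfolding act_eq[OF \<tau>] P(2) by (intro restrict_ext) (simp add: torus_conj_S[OF \<tau>'])
  moreover have "(\<lambda>M\<in>S. (\<lambda>M\<in>S. P (?c M)) M - restrict P S M) = (\<lambda>M\<in>S. P (?c M) - P M)" by auto
  ultimately show "act \<tau> f \<in> carrier A" "(\<lambda>M\<in>S. act \<tau> f M - f M) \<in> J" unfolding P(2) by simp_all
qed

lemma torus_ideal_subset: "slice_torus_ideal m lam \<subseteq> J"
  unfolding slice_torus_ideal_def slice_ring_eq
proof (rule ring.genideal_minimal[OF A_ring J_ideal], rule subsetI)
  fix f assume "f \<in> nontrivial_weight_vectors m A act"
  then obtain \<mu> where \<mu>: "nontrivial_weight m \<mu>" and f: "f \<in> carrier A"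
    and w: "\<forall>\<tau>\<in>torus m. act \<tau> f = torus_char m \<mu> \<tau> \<odot>\<^bsub>A\<^esub> f"
    by (auto simp: nontrivial_weight_vectors_def weight_space_def)
  obtain \<tau> where \<tau>: "\<tau> \<in> torus m" "torus_char m \<mu> \<tau> \<noteq> 1" using \<mu> by (auto simp: nontrivial_weight_def)
  let ?c = "torus_char m \<mu> \<tau>"
  \<comment> \<open>The weight condition turns the difference into (c - 1) f, and c - 1 is
    invertible by the choice of \<open>\<tau>\<close>.\<close>
  have "(\<lambda>M\<in>S. inverse (?c - 1) * (\<lambda>M\<in>S. act \<tau> f M - f M) M) \<in> J"
    by (rule function_algebra_idealD(5)[OF J_ideal act_trivial_mod_J(2)[OF \<tau>(1) f]])
  also have "(\<lambda>M\<in>S. inverse (?c - 1) * (\<lambda>M\<in>S. act \<tau> f M - f M) M) = restrict f S"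
    using \<tau> w by (intro restrict_ext) (auto simp: field_simps)
  finally show "f \<in> J" using function_algebra_extensional[OF f] by simp
qed

text \<open>Functions are moved by the inverse of \<open>\<tau>\<close>, so the coefficient at (i,
  j) has weight e_j - e_i and not e_i - e_j.\<close>

definition offdiag_weight :: "nat \<times> nat \<times> nat \<Rightarrow> nat \<Rightarrow> int" where
  "offdiag_weight = (\<lambda>(i, j, l) k. if k = j then 1 else if k = i then - 1 else 0)"

lemma torus_char_offdiag_weight:
  assumes "(i, j, l) \<in> X"
  shows "torus_char m (offdiag_weight (i, j, l)) \<tau> = \<tau> $$ (j - 1, j - 1) * inverse (\<tau> $$ (i - 1, i - 1))"
proof -
  have ij: "i \<in> {1..m}" "j \<in> {1..m}" "i \<noteq> j" using assms by (auto simp: offdiag_index_def)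
  have "torus_char m (offdiag_weight (i, j, l)) \<tau> =
    (\<Prod>k=1..m. (if k = j then \<tau> $$ (j - 1, j - 1) else 1) * (if k = i then inverse (\<tau> $$ (i - 1, i - 1)) else 1))"
    unfolding torus_char_def
    by (rule prod.cong) (use ij in \<open>auto simp: offdiag_weight_def power_int_minus\<close>)
  then show ?thesis using ij by (simp add: prod.distrib)
qed

lemma offdiag_weight_nontrivial:
  assumes "x \<in> X"
  shows "nontrivial_weight m (offdiag_weight x)"
proof -
  obtain i j l where x: "x = (i, j, l)" by (cases x)
  have ij: "i \<in> {1..m}" "j \<in> {1..m}" "i \<noteq> j" using assms by (auto simp: x offdiag_index_def)
  \<comment> \<open>The entries 2 at j and 1/2 at i keep the determinant 1 and give the character
    the value 4.\<close>
  let ?d = "\<lambda>p. (if p = j - 1 then 2 else 1) * (if p = i - 1 then inverse 2 else 1) :: complex"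
  define \<tau> :: "complex mat" where "\<tau> = mat m m (\<lambda>(p, q). if p = q then ?d p else 0)"
  have "det \<tau> = prod_list (diag_mat \<tau>)"
    by (rule det_upper_triangular[of _ m]) (auto simp: \<tau>_def)
  also have "\<dots> = (\<Prod>p=0..<m. ?d p)"
    unfolding prod_list_diag_prod by (auto simp: \<tau>_def intro!: prod.cong)
  also have "\<dots> = 1"
  proof -
    have "i - 1 \<in> {0..<m}" "j - 1 \<in> {0..<m}" using ij by auto
    then show ?thesis by (simp add: prod.distrib)
  qed
  finally have "\<tau> \<in> torus m" by (auto simp: torus_def \<tau>_def diagonal_mat_def)
  moreover have "i - 1 < m" "j - 1 < m" "i - 1 \<noteq> j - 1" using ij by auto
  then have "torus_char m (offdiag_weight x) \<tau> \<noteq> 1"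
    unfolding x torus_char_offdiag_weight[OF assms[unfolded x]] by (simp add: \<tau>_def)
  ultimately show ?thesis unfolding nontrivial_weight_def by blast
qed

lemma act_\<Delta>:
  assumes "\<tau> \<in> torus m" "x \<in> X"
  shows "act \<tau> (\<Delta> x) = (\<lambda>M\<in>S. torus_char m (offdiag_weight x) \<tau> * \<Delta> x M)"
proof -
  obtain i j l where x: "x = (i, j, l)" by (cases x)
  have ij: "i \<in> {1..m}" "j \<in> {1..m}" "i - 1 < m" "j - 1 < m" using assms(2) by (auto simp: x offdiag_index_def)
  note \<tau>' = torus_adj_mat(1)[OF assms(1)]
  show ?thesis
    unfolding act_eq[OF assms(1)] x torus_char_offdiag_weight[OF assms(2)[unfolded x]]
    using ij torus_conj_S[OF \<tau>'] torus_adj_mat(3)[OF assms(1)]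
    by (intro restrict_ext) (simp add: slice_Delta_def Delta_torus_conj[OF \<tau>'])
qed

lemma \<Delta>_in_torus_ideal: "x \<in> X \<Longrightarrow> \<Delta> x \<in> slice_torus_ideal m lam"
proof -
  assume x: "x \<in> X"
  have "\<Delta> x \<in> weight_space m A act (offdiag_weight x)"
    using mI_carrier[OF \<Delta>_in_mI[OF x]] act_\<Delta>[OF _ x] by (simp add: weight_space_def)
  then have "\<Delta> x \<in> nontrivial_weight_vectors m A act"
    using offdiag_weight_nontrivial[OF x] by (auto simp: nontrivial_weight_vectors_def)
  moreover have "nontrivial_weight_vectors m A act \<subseteq> carrier A"
    by (auto simp: nontrivial_weight_vectors_def weight_space_def)
  ultimately show ?thesis
    unfolding slice_torus_ideal_def slice_ring_eq using ring.genideal_self[OF A_ring] by blast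
qed

lemma torus_ideal_eq: "slice_torus_ideal m lam = J"
proof
  have "ideal (slice_torus_ideal m lam) A"
    unfolding slice_torus_ideal_def slice_ring_eq
    by (rule ring.genideal_ideal[OF A_ring]) (auto simp: nontrivial_weight_vectors_def weight_space_def)
  then show "J \<subseteq> slice_torus_ideal m lam"
    using ring.genideal_minimal[OF A_ring] \<Delta>_in_torus_ideal by blast
qed (rule torus_ideal_subset)

text \<open>If x is left out, all remaining generators lie in the ideal
  \<open>second_order x\<close>, and \<open>\<Delta> x\<close> does not.\<close>

lemma torus_ideal_minimal:
  assumes "Y \<subset> X"
  shows "Idl\<^bsub>A\<^esub> (\<Delta> ` Y) \<noteq> slice_torus_ideal m lam"
proof -
  obtain x where x: "x \<in> X" "x \<notin> Y" using assms by blast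
  have "\<Delta> ` Y \<subseteq> second_order x" using \<Delta>_second_order[OF x(1)] x assms by blast
  then have "Idl\<^bsub>A\<^esub> (\<Delta> ` Y) \<subseteq> second_order x"
    by (rule ring.genideal_minimal[OF A_ring second_order_ideal[OF x(1)]])
  then show ?thesis using \<Delta>_in_torus_ideal[OF x(1)] \<Delta>_second_order[OF x(1,1)] by blast
qed

section \<open>The torus action on the cotangent space\<close>

lemma act_mI:
  assumes "\<tau> \<in> torus m" "f \<in> mI"
  shows "act \<tau> f \<in> mI"
proof -
  have "torus_conj m (adj_mat \<tau>) (1\<^sub>m m) = 1\<^sub>m m"
  proof (rule eq_matI)
    have c: "torus_conj m (adj_mat \<tau>) (1\<^sub>m m) \<in> carrier_mat m m"
      using S_carrier(1)[OF torus_conj_S[OF torus_adj_mat(1)[OF assms(1)] one_in_S]] by simp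
    show "torus_conj m (adj_mat \<tau>) (1\<^sub>m m) $$ (i, j) = 1\<^sub>m m $$ (i, j)"
      if "i < dim_row (1\<^sub>m m :: complex fps mat)" "j < dim_col (1\<^sub>m m :: complex fps mat)" for i j
      using that torus_conj_index[OF torus_adj_mat(1)[OF assms(1)], of "1\<^sub>m m" i j]
        torus_adj_mat(2)[OF torus_adj_mat(1)[OF assms(1)]] by auto
    show "dim_row (torus_conj m (adj_mat \<tau>) (1\<^sub>m m)) = dim_row (1\<^sub>m m)"
      "dim_col (torus_conj m (adj_mat \<tau>) (1\<^sub>m m)) = dim_col (1\<^sub>m m)" using c by auto
  qed
  then have "act \<tau> f (1\<^sub>m m) = f (1\<^sub>m m)" unfolding act_eq[OF assms(1)] using one_in_S by simp
  then show ?thesis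
    using act_trivial_mod_J(1)[OF assms(1) mI_carrier[OF assms(2)]] assms(2) by (simp add: mI_def)
qed

lemma act_mI2:
  assumes "\<tau> \<in> torus m" "f \<in> mI2"
  shows "act \<tau> f \<in> mI2"
  using assms(2)
proof induction
  case (prod f g)
  have "act \<tau> (f \<otimes>\<^bsub>A\<^esub> g) = act \<tau> f \<otimes>\<^bsub>A\<^esub> act \<tau> g"
    unfolding act_eq[OF assms(1)] using torus_conj_S[OF torus_adj_mat(1)[OF assms(1)]] by auto
  then show ?case using ideal_prod.prod[OF act_mI[OF assms(1) prod(1)] act_mI[OF assms(1) prod(2)]] by (simp only:)
next
  case (sum f g)
  have "act \<tau> (f \<oplus>\<^bsub>A\<^esub> g) = act \<tau> f \<oplus>\<^bsub>A\<^esub> act \<tau> g"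
    unfolding act_eq[OF assms(1)] using torus_conj_S[OF torus_adj_mat(1)[OF assms(1)]] by auto
  then show ?case using ideal_prod.sum[OF sum.IH] by (simp only:)
qed

lemma act_diff:
  assumes "\<tau> \<in> torus m"
  shows "act \<tau> (\<lambda>M\<in>S. f M - g M) = (\<lambda>M\<in>S. act \<tau> f M - act \<tau> g M)"
  unfolding act_eq[OF assms] using torus_conj_S[OF torus_adj_mat(1)[OF assms]] by auto

lemma act_inverse:
  assumes "\<tau> \<in> torus m" "f \<in> carrier A"
  shows "act \<tau> (act (adj_mat \<tau>) f) = f"
proof -
  note \<tau>' = torus_adj_mat(1)[OF assms(1)]
  have "torus_conj m \<tau> (torus_conj m (adj_mat \<tau>) M) = M" if M: "M \<in> S" for M
  proof (rule eq_matI)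
    have c: "M \<in> carrier_mat m m" "torus_conj m (adj_mat \<tau>) M \<in> carrier_mat m m"
      "torus_conj m \<tau> (torus_conj m (adj_mat \<tau>) M) \<in> carrier_mat m m"
      using S_carrier(1) torus_conj_S[OF \<tau>' M] torus_conj_S[OF assms(1) torus_conj_S[OF \<tau>' M]] M by auto
    fix i j assume "i < dim_row M" "j < dim_col M"
    then have ij: "i < m" "j < m" using c(1) by auto
    show "torus_conj m \<tau> (torus_conj m (adj_mat \<tau>) M) $$ (i, j) = M $$ (i, j)"
      unfolding torus_conj_index[OF assms(1) c(2) ij] torus_conj_index[OF \<tau>' c(1) ij]
    proof -
      have "\<tau> $$ (i, i) * inverse (\<tau> $$ (j, j)) * (adj_mat \<tau> $$ (i, i) * inverse (adj_mat \<tau> $$ (j, j))) = 1"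
        using torus_adj_mat(2,3)[OF assms(1)] ij by (simp add: field_simps)
      then show "fps_const (\<tau> $$ (i, i) * inverse (\<tau> $$ (j, j))) *
          (fps_const (adj_mat \<tau> $$ (i, i) * inverse (adj_mat \<tau> $$ (j, j))) * M $$ (i, j)) = M $$ (i, j)"
        unfolding mult.assoc[symmetric, of "fps_const _"] fps_const_mult by simp
    qed
  qed (use S_carrier(1) torus_conj_S[OF assms(1) torus_conj_S[OF \<tau>' M]] M in auto)
  then have "act \<tau> (act (adj_mat \<tau>) f) = restrict f S"
    unfolding act_eq[OF assms(1)] act_eq[OF \<tau>'] torus_adj_mat(5)[OF assms(1)]
    using torus_conj_S[OF \<tau>'] by (intro restrict_ext) simp
  then show ?thesis using function_algebra_extensional[OF assms(2)] by simp
qed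

abbreviation "B \<equiv> (\<lambda>x. cls (\<Delta> x)) ` X"
abbreviation "N \<equiv> nontrivial_weight_vectors m V (\<lambda>\<tau> Y. act \<tau> ` Y)"

lemma B_subset_carrier: "B \<subseteq> carrier V"
  using \<Delta>_in_mI by (auto simp: V_simps(1))

text \<open>The torus acts on cosets by images, so an equality of sets is required; the inclusion of
  the target coset uses the action of the inverse torus element.\<close>

lemma act_cls_\<Delta>:
  assumes \<tau>: "\<tau> \<in> torus m" and x: "x \<in> X"
  shows "act \<tau> ` cls (\<Delta> x) = torus_char m (offdiag_weight x) \<tau> \<odot>\<^bsub>V\<^esub> cls (\<Delta> x)"
proof -
  let ?c = "torus_char m (offdiag_weight x) \<tau>"
  let ?g = "\<lambda>M\<in>S. ?c * \<Delta> x M"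
  note \<Delta>I = \<Delta>_in_mI[OF x]
  note \<Delta>A = mI_carrier[OF \<Delta>I]
  have gA: "?g \<in> carrier A" by (rule function_algebra_closed(3)[OF \<Delta>A \<Delta>A])
  note \<tau>' = torus_adj_mat(1)[OF \<tau>]
  have "act \<tau> ` cls (\<Delta> x) = cls ?g"
  proof (intro subset_antisym subsetI)
    fix h assume "h \<in> act \<tau> ` cls (\<Delta> x)"
    then obtain f where f: "f \<in> cls (\<Delta> x)" "h = act \<tau> f" by blast
    then have fA: "f \<in> carrier A" "(\<lambda>M\<in>S. f M - \<Delta> x M) \<in> mI2" using mem_cls_iff[OF \<Delta>A] by auto
    have "(\<lambda>M\<in>S. act \<tau> f M - act \<tau> (\<Delta> x) M) \<in> mI2" using act_mI2[OF \<tau> fA(2)] unfolding act_diff[OF \<tau>] .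
    then show "h \<in> cls ?g"
      unfolding mem_cls_iff[OF gA] f(2) act_\<Delta>[OF \<tau> x] using act_trivial_mod_J(1)[OF \<tau> fA(1)] by blast
  next
    fix h assume h: "h \<in> cls ?g"
    then have hA: "h \<in> carrier A" "(\<lambda>M\<in>S. h M - ?g M) \<in> mI2" using mem_cls_iff[OF gA] by auto
    have "act (adj_mat \<tau>) ?g = \<Delta> x"
      unfolding act_\<Delta>[OF \<tau> x, symmetric]
      using act_inverse[OF \<tau>' \<Delta>A] torus_adj_mat(5)[OF \<tau>] by simp
    then have "(\<lambda>M\<in>S. act (adj_mat \<tau>) h M - \<Delta> x M) \<in> mI2"
      using act_mI2[OF \<tau>' hA(2)] act_diff[OF \<tau>', of h ?g] by (simp only:)
    then have "act (adj_mat \<tau>) h \<in> cls (\<Delta> x)"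
      unfolding mem_cls_iff[OF \<Delta>A] using act_trivial_mod_J(1)[OF \<tau>' hA(1)] by blast
    then show "h \<in> act \<tau> ` cls (\<Delta> x)" using act_inverse[OF \<tau> hA(1)] by (metis imageI)
  qed
  then show ?thesis using V_smult[OF \<Delta>I] by simp
qed

lemma B_subset_N: "B \<subseteq> N"
proof
  fix v assume "v \<in> B"
  then obtain x where x: "x \<in> X" "v = cls (\<Delta> x)" by blast
  have "v \<in> weight_space m V (\<lambda>\<tau> Y. act \<tau> ` Y) (offdiag_weight x)"
    unfolding weight_space_def x(2) using act_cls_\<Delta>[OF _ x(1)] \<Delta>_in_mI[OF x(1)] by (simp add: V_simps(1))
  then show "v \<in> N" using offdiag_weight_nontrivial[OF x(1)] by (auto simp: nontrivial_weight_vectors_def)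
qed

text \<open>If f represents v, then (c - 1) v is the class of tau f - f. This difference lies in
  \<open>J\<close>, and classes of elements of \<open>J\<close> are linear combinations of classes
  of its generators.\<close>

lemma N_subset_span: "N \<subseteq> V.span B"
proof
  fix v assume "v \<in> N"
  then obtain \<mu> where \<mu>: "nontrivial_weight m \<mu>" and v: "v \<in> carrier V"
    and w: "\<forall>\<tau>\<in>torus m. act \<tau> ` v = torus_char m \<mu> \<tau> \<odot>\<^bsub>V\<^esub> v"
    by (auto simp: nontrivial_weight_vectors_def weight_space_def)
  obtain f where f: "f \<in> mI" "v = cls f" using v by (auto simp: V_simps(1))
  obtain \<tau> where \<tau>: "\<tau> \<in> torus m" "torus_char m \<mu> \<tau> \<noteq> 1" using \<mu> by (auto simp: nontrivial_weight_def)
  let ?c = "torus_char m \<mu> \<tau>"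
  note cf = mI_closed(2)[OF f(1,1)]
  have "act \<tau> f \<in> cls (\<lambda>M\<in>S. ?c * f M)"
    using w \<tau>(1) cls_self[OF mI_carrier[OF f(1)]] unfolding f(2) V_smult[OF f(1)] by blast
  then have 1: "(\<lambda>M\<in>S. act \<tau> f M - (\<lambda>M\<in>S. ?c * f M) M) \<in> mI2"
    using mem_cls_iff[OF mI_carrier[OF cf]] by blast
  let ?e = "\<lambda>M\<in>S. act \<tau> f M - f M"
  have eI: "?e \<in> mI" by (rule mI_closed(4)[OF act_mI[OF \<tau>(1) f(1)] f(1)])
  have "(\<lambda>M\<in>S. ?e M - (\<lambda>M\<in>S. (?c - 1) * f M) M) = (\<lambda>M\<in>S. act \<tau> f M - (\<lambda>M\<in>S. ?c * f M) M)"
    by (auto simp: algebra_simps)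
  then have "cls ?e = cls (\<lambda>M\<in>S. (?c - 1) * f M)"
    using cls_eq_iff[OF mI_carrier[OF eI] mI_carrier[OF cf]] 1 by simp
  moreover have "cls ?e \<in> V.span (cls ` \<Delta> ` X)"
    by (rule genideal_cls_in_span) (use \<Delta>_in_mI act_trivial_mod_J(2)[OF \<tau>(1) mI_carrier[OF f(1)]] in auto)
  ultimately have 2: "(?c - 1) \<odot>\<^bsub>V\<^esub> v \<in> V.span B"
    unfolding f(2) V_smult[OF f(1)] image_image by simp
  interpret S: submodule class_ring "V.span B" V by (rule V.span_is_submodule[OF B_subset_carrier])
  have "inverse (?c - 1) \<odot>\<^bsub>V\<^esub> ((?c - 1) \<odot>\<^bsub>V\<^esub> v) \<in> V.span B" by (rule S.smult_closed[OF _ 2]) simp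
  moreover have "inverse (?c - 1) \<odot>\<^bsub>V\<^esub> ((?c - 1) \<odot>\<^bsub>V\<^esub> v) = v"
    using V.smult_assoc1[of "inverse (?c - 1)" "?c - 1" v] V.smult_one[OF v] v \<tau>(2) by simp
  ultimately show "v \<in> V.span B" by simp
qed

lemma span_N: "V.span N = V.span B"
proof
  show "V.span N \<subseteq> V.span B"
    by (rule V.span_is_subset[OF N_subset_span V.span_is_submodule[OF B_subset_carrier]])
  show "V.span B \<subseteq> V.span N" by (rule V.span_is_monotone[OF B_subset_N])
qed

lemma \<Delta>_separated:
  "x \<in> X \<Longrightarrow> \<exists>K. ideal K A \<and> mI2 \<subseteq> K \<and> (\<forall>y\<in>X - {x}. \<Delta> y \<in> K) \<and> \<Delta> x \<notin> K"
  using second_order_ideal mI2_second_order \<Delta>_second_order by (intro exI[of _ "second_order x"]) auto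

lemmas \<Delta>_cls = cls_separated[OF finite_offdiag_index \<Delta>_in_mI \<Delta>_separated]

lemma cotangent_nontrivial_basis: "vectorspace.basis class_ring (slice_cotangent_nontrivial m lam) B"
proof -
  let ?U = "V\<lparr>carrier := V.span B\<rparr>"
  have sub: "submodule class_ring (V.span B) V" by (rule V.span_is_submodule[OF B_subset_carrier])
  have "B \<subseteq> V.span B" by (rule V.in_own_span[OF B_subset_carrier])
  \<comment> \<open>Linear independence in the span agrees with linear independence in the whole
    cotangent space, where the tangent vectors establish it.\<close>
  note dep = V.span_li_not_depend[OF this sub]
  have "vectorspace class_ring ?U"
    by (intro vectorspace.intro V.submodule_is_module sub class_field)
  then have "vectorspace.basis class_ring ?U B"
    unfolding vectorspace.basis_def[OF \<open>vectorspace class_ring ?U\<close>] dep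
    using \<Delta>_cls(3) \<open>B \<subseteq> V.span B\<close> by simp
  then show ?thesis
    unfolding slice_cotangent_nontrivial_def slice_cotangent_eq nontrivial_weight_part_def span_N .
qed

end

section \<open>Concavity of the coroot coefficients of a dominant coweight\<close>

theorem proposition8p5:
  fixes n :: nat and a lam :: "nat \<Rightarrow> int"
  assumes "n \<ge> 1"
    and "lam = (\<lambda>k. \<Sum>i=1..n. a i * simple_coroot i k)"
    and "dominant (n + 1) lam"
  shows "(\<forall>x \<in> offdiag_index (n + 1) (Min (a ` {1..n})).
            cotangent_class (n + 1) lam (slice_Delta (n + 1) lam x)
              \<noteq> \<zero>\<^bsub>slice_cotangent (n + 1) lam\<^esub>) \<and>
         inj_on (\<lambda>x. cotangent_class (n + 1) lam (slice_Delta (n + 1) lam x))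
           (offdiag_index (n + 1) (Min (a ` {1..n}))) \<and>
         vectorspace.basis class_ring (slice_cotangent_nontrivial (n + 1) lam)
           ((\<lambda>x. cotangent_class (n + 1) lam (slice_Delta (n + 1) lam x)) `
              offdiag_index (n + 1) (Min (a ` {1..n}))) \<and>
         (Min (a ` {1..n}) = a 1 \<or> Min (a ` {1..n}) = a n) \<and>
         slice_torus_ideal (n + 1) lam =
           Idl\<^bsub>slice_ring (n + 1) lam\<^esub>
             (slice_Delta (n + 1) lam ` offdiag_index (n + 1) (Min (a ` {1..n}))) \<and>
         (\<forall>J. J \<subset> offdiag_index (n + 1) (Min (a ` {1..n})) \<longrightarrow>
            Idl\<^bsub>slice_ring (n + 1) lam\<^esub> (slice_Delta (n + 1) lam ` J)
              \<noteq> slice_torus_ideal (n + 1) lam)"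
proof -
  \<comment> \<open>Extension by 0 at both ends makes every entry of the coweight a difference of
    neighbours, including the first and the last.\<close>
  define b where "b k = (if 1 \<le> k \<and> k \<le> n then a k else 0)" for k
  define d where "d = Min (a ` {1..n})"
  have lam: "lam = coweight_of_sums b"
  proof
    fix k
    have "a i * simple_coroot i k = (if i = k then a k else 0) - (if i = k - 1 then a (k - 1) else 0)"
      if "i \<in> {1..n}" for i using that by (auto simp: simple_coroot_def)
    then show "lam k = coweight_of_sums b k"
      unfolding assms(2) by (simp add: sum_subtractf coweight_of_sums_def b_def)
  qed
  have mono: "lam k \<le> lam i" if "1 \<le> i" "i \<le> k" "k \<le> n + 1" for i k
    using that(2,3)
  proof (induction k rule: dec_induct)
    case (step k)
    then have "k \<in> {1..<n + 1}" using that(1) by auto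
    then have "lam (k + 1) \<le> lam k" using assms(3) unfolding dominant_def by force
    then show ?case using step by simp
  qed simp
  have stp: "b k = b (k - 1) + lam k" for k by (simp add: lam coweight_of_sums_def)
  have b1: "b 0 = 0" "b (n + 1) = 0" "b 1 = a 1" "b n = a n" using assms(1) by (auto simp: b_def)
  \<comment> \<open>By dominance the increments of \<open>b\<close> decrease. If the one at k is
    nonnegative, so are all earlier ones, and \<open>b\<close> has not fallen below its first
    value.\<close>
  have up: "b 1 \<le> b k" if "1 \<le> k" "k \<le> n" "0 \<le> lam k" for k
    using that
  proof (induction k rule: dec_induct)
    case (step k)
    have "lam (Suc k) \<le> lam k" using mono[of k "Suc k"] step by simp
    then show ?case using step stp[of "Suc k"] by simp
  qed simp
  have down: "b n \<le> b k" if "k \<le> n" "1 \<le> k" "lam k \<le> 0" for k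
    using that
  proof (induction k rule: inc_induct)
    case (step k)
    have "lam (Suc k) \<le> lam k" using mono[of k "Suc k"] step by simp
    then show ?case using step stp[of "Suc k"] by simp
  qed simp
  have lam1: "lam 1 = b 1" "lam (n + 1) = - b n" using stp[of 1] stp[of "n + 1"] b1 by simp_all
  \<comment> \<open>A nonnegative entry is at most \<open>lam 1\<close>, which is
    \<open>b 1\<close>, and a negative entry is at least \<open>lam (n + 1)\<close>, which is
    \<open>- b n\<close>. So the end value used for comparison is itself nonnegative.\<close>
  have ge: "b 1 \<le> b k \<and> 0 \<le> b k \<or> b n \<le> b k \<and> 0 \<le> b k" if k: "k \<in> {1..n}" for k
  proof (cases "0 \<le> lam k")
    case True
    then show ?thesis using up[of k] mono[of 1 k] k lam1 by simp
  next
    case False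
    then show ?thesis using down[of k] mono[of k "n + 1"] k lam1 by simp
  qed
  have dle: "d \<le> b k" if "k \<in> {1..n}" for k using that by (simp add: d_def b_def)
  have "d \<in> a ` {1..n}" unfolding d_def using assms(1) by (intro Min_in) auto
  then obtain k0 where k0: "k0 \<in> {1..n}" "d = b k0" by (auto simp: b_def)
  have min: "d = a 1 \<or> d = a n" and d0: "0 \<le> d"
    using ge[OF k0(1)] dle[of 1] dle[of n] assms(1) b1 k0(2) by auto
  interpret slice_bounds "n + 1" b d
  proof
    \<comment> \<open>The greatest entry of the coweight is \<open>a 1\<close> and the least is
      \<open>- a n\<close>; whichever of \<open>a 1\<close> and \<open>a n\<close> equals d supplies
      its side of the disjunction.\<close>
    show "(\<forall>k\<in>{1..n + 1}. coweight_of_sums b k \<le> d) \<or> (\<forall>k\<in>{1..n + 1}. - d \<le> coweight_of_sums b k)"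
      using min mono[of 1] mono[of _ "n + 1"] lam1 b1 by (auto simp flip: lam)
  qed (use b1 d0 dle in auto)
  show ?thesis
    unfolding d_def[symmetric] lam slice_cotangent_eq cotangent_class_eq slice_ring_eq
    using \<Delta>_cls(1,2) cotangent_nontrivial_basis min torus_ideal_eq torus_ideal_minimal by blast
qed

end
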